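(* Assume $p(K)=0$. For every $r\in(0,r(K,\partial)]$ and every $M\in\mathcal C^f$, $F_{sp,[r,r]}M=F_{[r,r]}M$.
   Context: $K$ is a field of characteristic $0$, complete for a non-trivial non-archimedean absolute value $|\cdot|$, with a non-zero bounded derivation $\partial$. $p(K)$ is the residue characteristic, $\omega(K)=|p(K)|^{1/(p(K)-1)}$ if $p(K)>0$ (else $1$), $|\partial|_{sp,K}=\inf_{i\ge1}|\partial^i|_{op}^{1/i}$, $r(K,\partial)=\omega(K)/|\partial|_{sp,K}$. $K\langle T\rangle$ is the twisted polynomial ring with $Ta=aT+\partial(a)$; $\mathcal C^f$ is the category of left $K\langle T\rangle$-modules finite-dimensional over $K$. For irreducible $M\in\mathcal C^f$, choosing a norm on $M$, $m(M)(r)=\dim_KM$ if $r=\omega(K)/|T|_{sp,M}$ and $0$ otherwise; in general sum over Jordan–Hölder factors. $F_{sp,[r,r]}M$ is the largest submodule $N$ with $\{r':m(N)(r')\neq0\}\subseteq\{r\}$. $K[[X]]$ is a left $K\langle T\rangle$-module via $c\cdot F=(\sum_i\frac{\partial^i(c)}{i!}X^i)F$, $T\cdot F=dF/dX$. $K[[X/r]]_0=\{\sum a_iX^i:\sup|a_i|r^i<\infty\}$, $K\{X/r\}=\bigcap_{s<r}K[[X/s]]_0$, $K\{X/r+\}=\bigcup_{s>r}K[[X/s]]_0$ (submodules for $r\le r(K,\partial)$, resp. $r<r(K,\partial)$). $F_{[r,r(K,\partial)]}M=\{x: s(x)\in K\{X/r\}\ \forall s\in\mathrm{Hom}_{K\langle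 T\rangle}(M,K[[X]])\}$; for $r<r(K,\partial)$, $F_{(0,r]}M=\bigcap_{s\in\mathrm{Hom}(M,K\{X/r+\})}\ker s$; $F_{(0,r(K,\partial)]}M:=M$; $F_{[r,r]}M=F_{(0,r]}M\cap F_{[r,r(K,\partial)]}M$. *)

theory Defs
  imports
    "HOL-Analysis.Abstract_Metric_Spaces"
    "HOL-Computational_Algebra.Formal_Power_Series"
    "HOL-Algebra.QuotRing"
    "Jordan_Normal_Form.VS_Connect"
begin

section \<open>The base field\<close>

locale derivation =
  fixes \<delta> :: "'k::field_char_0 \<Rightarrow> 'k"
  assumes d_add: "\<delta> (x + y) = \<delta> x + \<delta> y"
    and d_mult: "\<delta> (x * y) = \<delta> x * y + x * \<delta> y"

locale complete_nonarch_diff_field = derivation \<delta>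
  for v :: "'k::field_char_0 \<Rightarrow> real" and \<delta> :: "'k \<Rightarrow> 'k" +
  assumes abs_nonneg: "0 \<le> v x"
    and abs_eq_0: "v x = 0 \<longleftrightarrow> x = 0"
    and abs_mult: "v (x * y) = v x * v y"
    and abs_ultrametric: "v (x + y) \<le> max (v x) (v y)"
    and abs_nontrivial: "\<exists>x. x \<noteq> 0 \<and> v x \<noteq> 1"
    and complete: "Metric_space.mcomplete UNIV (\<lambda>x y. v (x - y))"
    and d_bounded: "\<exists>C. \<forall>x. v (\<delta> x) \<le> C * v x"
    and d_nonzero: "\<exists>x. \<delta> x \<noteq> 0"

definition valuation_ring :: "('k::field \<Rightarrow> real) \<Rightarrow> 'k ring" where
  "valuation_ring v = \<lparr>carrier = {x. v x \<le> 1}, mult = (*), one = 1, zero = 0, add = (+)\<rparr>"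

definition residue_field :: "('k::field \<Rightarrow> real) \<Rightarrow> 'k set ring" where
  "residue_field v = valuation_ring v Quot {x. v x < 1}"

definition ring_char :: "('a, 'b) ring_scheme \<Rightarrow> nat" where
  "ring_char R = Gcd {n::nat. [n] \<cdot>\<^bsub>R\<^esub> \<one>\<^bsub>R\<^esub> = \<zero>\<^bsub>R\<^esub>}"

definition residue_char :: "('k::field \<Rightarrow> real) \<Rightarrow> nat" where
  "residue_char v = ring_char (residue_field v)"

definition omega :: "('k::field \<Rightarrow> real) \<Rightarrow> real" where
  "omega v = (let p = residue_char v in
     if p > 0 then v (of_nat p) powr (1 / (real p - 1)) else 1)"

definition op_norm :: "'a set \<Rightarrow> ('a \<Rightarrow> real) \<Rightarrow> ('a \<Rightarrow> 'a) \<Rightarrow> real" where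
  "op_norm A \<nu> f = (SUP x\<in>{x \<in> A. \<nu> x \<noteq> 0}. \<nu> (f x) / \<nu> x)"

definition spectral_norm :: "'a set \<Rightarrow> ('a \<Rightarrow> real) \<Rightarrow> ('a \<Rightarrow> 'a) \<Rightarrow> real" where
  "spectral_norm A \<nu> f = (INF i\<in>{1::nat..}. op_norm A \<nu> (f ^^ i) powr (1 / real i))"

text \<open>The denominator is positive whenever \<open>\<delta>\<close> is a nonzero bounded derivation: otherwise
  every Taylor series \<open>\<Sum>i. \<delta>\<^sup>i x / i! X\<^sup>i\<close> with \<open>x \<noteq> 0\<close> would be an invertible entire
  function, hence constant.\<close>

definition diff_radius :: "('k::field \<Rightarrow> real) \<Rightarrow> ('k \<Rightarrow> 'k) \<Rightarrow> real" where
  "diff_radius v \<delta> = omega v / spectral_norm UNIV v \<delta>"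


section \<open>The twisted polynomial ring\<close>

text \<open>The polynomial \<open>\<Sum>i. c\<^sub>i T\<^sup>i\<close> acts as \<open>\<Sum>i. c\<^sub>i L\<^sup>i\<close>, given the action \<open>sc\<close> of the
  constants and the action \<open>L\<close> of \<open>T\<close>.\<close>

definition twisted_act ::
  "('k::field_char_0 \<Rightarrow> 'v \<Rightarrow> 'v) \<Rightarrow> ('v \<Rightarrow> 'v) \<Rightarrow> 'k poly \<Rightarrow> 'v \<Rightarrow> 'v::ab_group_add" where
  "twisted_act sc L p x = (\<Sum>i\<le>degree p. sc (coeff p i) ((L ^^ i) x))"

text \<open>\<open>T (\<Sum>i. b\<^sub>i T\<^sup>i) = \<Sum>i. (b\<^sub>i T + \<delta> b\<^sub>i) T\<^sup>i\<close>\<close>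

definition T_mult :: "('k::field_char_0 \<Rightarrow> 'k) \<Rightarrow> 'k poly \<Rightarrow> 'k poly" where
  "T_mult \<delta> q = pCons 0 q + map_poly \<delta> q"

text \<open>A polynomial \<open>\<Sum>i. c\<^sub>i T\<^sup>i\<close>, coefficients on the left, is represented by an element of
  type \<^typ>\<open>'k poly\<close>; only the multiplication differs from the one of \<^typ>\<open>'k poly\<close>.\<close>

definition twisted_ring :: "('k::field_char_0 \<Rightarrow> 'k) \<Rightarrow> 'k poly ring" where
  "twisted_ring \<delta> = \<lparr>carrier = UNIV, mult = twisted_act Polynomial.smult (T_mult \<delta>),
     one = 1, zero = 0, add = (+)\<rparr>"

locale left_module = R?: ring R + M?: abelian_group M
  for R :: "('a, 'r) ring_scheme" (structure) and M :: "('a, 'b, 'm) module_scheme" (structure) +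
  assumes smult_closed: "\<lbrakk>a \<in> carrier R; x \<in> carrier M\<rbrakk> \<Longrightarrow> a \<odot>\<^bsub>M\<^esub> x \<in> carrier M"
    and smult_l_distr: "\<lbrakk>a \<in> carrier R; b \<in> carrier R; x \<in> carrier M\<rbrakk> \<Longrightarrow>
      (a \<oplus>\<^bsub>R\<^esub> b) \<odot>\<^bsub>M\<^esub> x = a \<odot>\<^bsub>M\<^esub> x \<oplus>\<^bsub>M\<^esub> b \<odot>\<^bsub>M\<^esub> x"
    and smult_r_distr: "\<lbrakk>a \<in> carrier R; x \<in> carrier M; y \<in> carrier M\<rbrakk> \<Longrightarrow>
      a \<odot>\<^bsub>M\<^esub> (x \<oplus>\<^bsub>M\<^esub> y) = a \<odot>\<^bsub>M\<^esub> x \<oplus>\<^bsub>M\<^esub> a \<odot>\<^bsub>M\<^esub> y"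
    and smult_assoc: "\<lbrakk>a \<in> carrier R; b \<in> carrier R; x \<in> carrier M\<rbrakk> \<Longrightarrow>
      (a \<otimes>\<^bsub>R\<^esub> b) \<odot>\<^bsub>M\<^esub> x = a \<odot>\<^bsub>M\<^esub> (b \<odot>\<^bsub>M\<^esub> x)"
    and smult_one: "x \<in> carrier M \<Longrightarrow> \<one>\<^bsub>R\<^esub> \<odot>\<^bsub>M\<^esub> x = x"

definition left_module_hom ::
  "('a, 'r) ring_scheme \<Rightarrow> ('a, 'b, 'm) module_scheme \<Rightarrow> ('a, 'c, 'n) module_scheme \<Rightarrow> ('b \<Rightarrow> 'c) set"
  where "left_module_hom R M N = {h \<in> hom (add_monoid M) (add_monoid N).
     \<forall>a\<in>carrier R. \<forall>x\<in>carrier M. h (a \<odot>\<^bsub>M\<^esub> x) = a \<odot>\<^bsub>N\<^esub> h x}"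

definition quotient_module :: "('a, 'b, 'm) module_scheme \<Rightarrow> 'b set \<Rightarrow> ('a, 'b set) module" where
  "quotient_module M N = \<lparr>carrier = a_rcosets\<^bsub>M\<^esub> N, mult = undefined, one = undefined, zero = N,
     add = set_add M, smult = (\<lambda>a X. \<Union>x\<in>X. N +>\<^bsub>M\<^esub> (a \<odot>\<^bsub>M\<^esub> x))\<rparr>"

definition irreducible_module :: "('a, 'r) ring_scheme \<Rightarrow> ('a, 'b, 'm) module_scheme \<Rightarrow> bool" where
  "irreducible_module R M \<longleftrightarrow> carrier M \<noteq> {\<zero>\<^bsub>M\<^esub>} \<and>
     (\<forall>N. Module.submodule N R M \<longrightarrow> N = {\<zero>\<^bsub>M\<^esub>} \<or> N = carrier M)"

definition composition_factor :: "('a, 'b, 'm) module_scheme \<Rightarrow> 'b set list \<Rightarrow> nat \<Rightarrow> ('a, 'b set) module" where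
  "composition_factor M Ns i = quotient_module (M\<lparr>carrier := Ns ! Suc i\<rparr>) (Ns ! i)"

definition composition_series ::
  "('a, 'r) ring_scheme \<Rightarrow> ('a, 'b, 'm) module_scheme \<Rightarrow> 'b set list \<Rightarrow> bool" where
  "composition_series R M Ns \<longleftrightarrow> Ns \<noteq> [] \<and> hd Ns = {\<zero>\<^bsub>M\<^esub>} \<and> last Ns = carrier M \<and>
     (\<forall>N\<in>set Ns. Module.submodule N R M) \<and>
     (\<forall>i. Suc i < length Ns \<longrightarrow>
        Ns ! i \<subseteq> Ns ! Suc i \<and> irreducible_module R (composition_factor M Ns i))"


section \<open>Finite-dimensional modules and the spectral filtration\<close>

definition base_space :: "('k::field_char_0 poly, 'b, 'm) module_scheme \<Rightarrow> ('k, 'b) module" where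
  "base_space M = \<lparr>carrier = carrier M, mult = mult M, one = one M, zero = zero M, add = add M,
     smult = (\<lambda>c x. [:c:] \<odot>\<^bsub>M\<^esub> x)\<rparr>"

definition fd_module :: "('k::field_char_0 \<Rightarrow> 'k) \<Rightarrow> ('k poly, 'b, 'm) module_scheme \<Rightarrow> bool" where
  "fd_module \<delta> M \<longleftrightarrow> left_module (twisted_ring \<delta>) M \<and>
     vectorspace.fin_dim class_ring (base_space M)"

definition module_norm ::
  "('k::field_char_0 \<Rightarrow> real) \<Rightarrow> ('k poly, 'b, 'm) module_scheme \<Rightarrow> ('b \<Rightarrow> real) \<Rightarrow> bool" where
  "module_norm v M \<nu> \<longleftrightarrow>
     (\<forall>x\<in>carrier M. 0 \<le> \<nu> x \<and> (\<nu> x = 0 \<longleftrightarrow> x = \<zero>\<^bsub>M\<^esub>)) \<and>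
     (\<forall>x\<in>carrier M. \<forall>y\<in>carrier M. \<nu> (x \<oplus>\<^bsub>M\<^esub> y) \<le> max (\<nu> x) (\<nu> y)) \<and>
     (\<forall>c. \<forall>x\<in>carrier M. \<nu> ([:c:] \<odot>\<^bsub>M\<^esub> x) = v c * \<nu> x)"

text \<open>All norms on a finite-dimensional space over the complete field are equivalent, so the
  value does not depend on the chosen one.\<close>

definition T_spectral_norm ::
  "('k::field_char_0 \<Rightarrow> real) \<Rightarrow> ('k poly, 'b, 'm) module_scheme \<Rightarrow> real" where
  "T_spectral_norm v M =
     spectral_norm (carrier M) (SOME \<nu>. module_norm v M \<nu>) (\<lambda>x. [:0, 1:] \<odot>\<^bsub>M\<^esub> x)"

definition mult_irreducible ::
  "('k::field_char_0 \<Rightarrow> real) \<Rightarrow> ('k poly, 'b, 'm) module_scheme \<Rightarrow> real \<Rightarrow> nat" where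
  "mult_irreducible v M r =
     (if r = omega v / T_spectral_norm v M
      then vectorspace.dim class_ring (base_space M) else 0)"

text \<open>By the Jordan-Hoelder theorem the value does not depend on the chosen series.\<close>

definition mult_function ::
  "('k::field_char_0 \<Rightarrow> real) \<Rightarrow> ('k \<Rightarrow> 'k) \<Rightarrow> ('k poly, 'b, 'm) module_scheme \<Rightarrow> real \<Rightarrow> nat" where
  "mult_function v \<delta> M r = (let Ns = (SOME Ns. composition_series (twisted_ring \<delta>) M Ns) in
     \<Sum>i<length Ns - 1. mult_irreducible v (composition_factor M Ns i) r)"

definition F_sp ::
  "('k::field_char_0 \<Rightarrow> real) \<Rightarrow> ('k \<Rightarrow> 'k) \<Rightarrow> real \<Rightarrow> ('k poly, 'b, 'm) module_scheme \<Rightarrow> 'b set" where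
  "F_sp v \<delta> r M = (GREATEST N. Module.submodule N (twisted_ring \<delta>) M \<and>
     {r'. mult_function v \<delta> (M\<lparr>carrier := N\<rparr>) r' \<noteq> 0} \<subseteq> {r})"


section \<open>Power series and the filtration by solutions\<close>

definition taylor :: "('k::field_char_0 \<Rightarrow> 'k) \<Rightarrow> 'k \<Rightarrow> 'k fps" where
  "taylor \<delta> c = Abs_fps (\<lambda>i. (\<delta> ^^ i) c / fact i)"

definition fps_module :: "('k::field_char_0 \<Rightarrow> 'k) \<Rightarrow> ('k poly, 'k fps) module" where
  "fps_module \<delta> = \<lparr>carrier = UNIV, mult = (*), one = 1, zero = 0, add = (+),
     smult = twisted_act (\<lambda>c F. taylor \<delta> c * F) fps_deriv\<rparr>"

definition fps_bounded :: "('k::field_char_0 \<Rightarrow> real) \<Rightarrow> real \<Rightarrow> 'k fps set" where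
  "fps_bounded v r = {F. bdd_above (range (\<lambda>i. v (fps_nth F i) * r ^ i))}"

definition fps_conv :: "('k::field_char_0 \<Rightarrow> real) \<Rightarrow> real \<Rightarrow> 'k fps set" where
  "fps_conv v r = (\<Inter>s\<in>{0<..<r}. fps_bounded v s)"

definition fps_overconv :: "('k::field_char_0 \<Rightarrow> real) \<Rightarrow> real \<Rightarrow> 'k fps set" where
  "fps_overconv v r = (\<Union>s\<in>{r<..}. fps_bounded v s)"

definition F_ge ::
  "('k::field_char_0 \<Rightarrow> real) \<Rightarrow> ('k \<Rightarrow> 'k) \<Rightarrow> real \<Rightarrow> ('k poly, 'b, 'm) module_scheme \<Rightarrow> 'b set" where
  "F_ge v \<delta> r M = {x \<in> carrier M.
     \<forall>s\<in>left_module_hom (twisted_ring \<delta>) M (fps_module \<delta>). s x \<in> fps_conv v r}"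

definition F_le ::
  "('k::field_char_0 \<Rightarrow> real) \<Rightarrow> ('k \<Rightarrow> 'k) \<Rightarrow> real \<Rightarrow> ('k poly, 'b, 'm) module_scheme \<Rightarrow> 'b set" where
  "F_le v \<delta> r M = (if r < diff_radius v \<delta> then {x \<in> carrier M.
     \<forall>s\<in>left_module_hom (twisted_ring \<delta>) M ((fps_module \<delta>)\<lparr>carrier := fps_overconv v r\<rparr>). s x = 0}
     else carrier M)"

definition F_sol ::
  "('k::field_char_0 \<Rightarrow> real) \<Rightarrow> ('k \<Rightarrow> 'k) \<Rightarrow> real \<Rightarrow> ('k poly, 'b, 'm) module_scheme \<Rightarrow> 'b set" where
  "F_sol v \<delta> r M = F_le v \<delta> r M \<inter> F_ge v \<delta> r M"


section \<open>Well-definedness of the ring and of the power series module\<close>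

lemma twisted_act_bound:
  assumes "degree p \<le> n" "\<And>x. sc 0 x = 0"
  shows "twisted_act sc L p x = (\<Sum>i\<le>n. sc (coeff p i) ((L ^^ i) x))"
  unfolding twisted_act_def
  by (rule sum.mono_neutral_left) (use assms in \<open>auto simp: coeff_eq_0\<close>)

locale twisted_action = derivation \<delta> for \<delta> :: "'k::field_char_0 \<Rightarrow> 'k" +
  fixes sc :: "'k \<Rightarrow> 'v::ab_group_add \<Rightarrow> 'v" and L :: "'v \<Rightarrow> 'v"
  assumes sc_add_left: "sc (a + b) x = sc a x + sc b x"
    and sc_add_right: "sc a (x + y) = sc a x + sc a y"
    and sc_mult: "sc (a * b) x = sc a (sc b x)"
    and sc_one: "sc 1 x = x"
    and L_add: "L (x + y) = L x + L y"
    and L_sc: "L (sc a x) = sc a (L x) + sc (\<delta> a) x"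
begin

lemma d_0: "\<delta> 0 = 0"
  using d_add[of 0 0] by simp

lemma sc_0_left: "sc 0 x = 0"
  using sc_add_left[of 0 0 x] by simp

lemma sc_0_right: "sc a 0 = 0"
  using sc_add_right[of a 0 0] by simp

lemma L_0: "L 0 = 0"
  using L_add[of 0 0] by simp

lemma sc_sum: "sc a (sum f A) = (\<Sum>i\<in>A. sc a (f i))"
  by (induction A rule: infinite_finite_induct) (simp_all add: sc_0_right sc_add_right)

lemma L_sum: "L (sum f A) = (\<Sum>i\<in>A. L (f i))"
  by (induction A rule: infinite_finite_induct) (simp_all add: L_0 L_add)

lemma Lpow_add: "(L ^^ i) (x + y) = (L ^^ i) x + (L ^^ i) y"
  by (induction i) (simp_all add: L_add)

abbreviation "act \<equiv> twisted_act sc L"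

lemma act_bound: "degree p \<le> n \<Longrightarrow> act p x = (\<Sum>i\<le>n. sc (coeff p i) ((L ^^ i) x))"
  by (rule twisted_act_bound) (simp_all add: sc_0_left)

lemma act_add_right: "act p (x + y) = act p x + act p y"
  by (simp add: twisted_act_def Lpow_add sc_add_right sum.distrib)

lemma act_add_left: "act (p + q) x = act p x + act q x"
proof -
  let ?n = "max (degree p) (degree q)"
  have "degree (p + q) \<le> ?n" by (rule degree_add_le_max)
  thus ?thesis
    by (simp add: act_bound[of _ ?n] sc_add_left sum.distrib)
qed

lemma act_smult: "act (Polynomial.smult c p) x = sc c (act p x)"
  unfolding act_bound[OF degree_smult_le] by (simp add: twisted_act_def sc_mult sc_sum)

lemma act_0: "act 0 x = 0"
  by (simp add: twisted_act_def sc_0_left)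

lemma act_sum: "act (sum f A) x = (\<Sum>i\<in>A. act (f i) x)"
  by (induction A rule: infinite_finite_induct) (simp_all add: act_0 act_add_left)

lemma act_one: "act 1 x = x"
  by (simp add: twisted_act_def sc_one)

lemma act_T_mult: "act (T_mult \<delta> q) x = L (act q x)"
proof -
  let ?n = "degree q"
  have "act (pCons 0 q) x = (\<Sum>i\<le>Suc ?n. sc (coeff (pCons 0 q) i) ((L ^^ i) x))"
    by (rule act_bound) (simp add: degree_pCons_le)
  also have "\<dots> = (\<Sum>i\<le>?n. sc (coeff q i) (L ((L ^^ i) x)))"
    by (subst sum.atMost_Suc_shift) (simp add: sc_0_left)
  finally have 1: "act (pCons 0 q) x = (\<Sum>i\<le>?n. sc (coeff q i) (L ((L ^^ i) x)))" .
  have "act (map_poly \<delta> q) x = (\<Sum>i\<le>?n. sc (coeff (map_poly \<delta> q) i) ((L ^^ i) x))"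
    by (rule act_bound) (rule degree_le, simp add: coeff_map_poly d_0 coeff_eq_0)
  hence 2: "act (map_poly \<delta> q) x = (\<Sum>i\<le>?n. sc (\<delta> (coeff q i)) ((L ^^ i) x))"
    by (simp add: coeff_map_poly d_0)
  show ?thesis
    by (simp add: T_mult_def act_add_left 1 2 act_bound[OF order.refl, of q] L_sum L_sc sum.distrib)
qed

lemma act_T_mult_pow: "act ((T_mult \<delta> ^^ i) q) x = (L ^^ i) (act q x)"
  by (induction i) (simp_all add: act_T_mult)

lemma act_mult: "act (twisted_act Polynomial.smult (T_mult \<delta>) p q) x = act p (act q x)"
  by (simp add: twisted_act_def[of Polynomial.smult] act_sum act_smult act_T_mult_pow)
     (simp add: twisted_act_def)

end

context derivation
begin

lemma d_zero: "\<delta> 0 = 0"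
  using d_add[of 0 0] by simp

lemma d_one: "\<delta> 1 = 0"
  using d_mult[of 1 1] by simp

lemma dpow_add: "(\<delta> ^^ i) (x + y) = (\<delta> ^^ i) x + (\<delta> ^^ i) y"
  by (induction i) (simp_all add: d_add)

lemma dpow_one: "(\<delta> ^^ i) 1 = (if i = 0 then 1 else 0)"
  by (induction i) (auto simp: d_one d_zero)

lemma twisted_action_poly: "twisted_action \<delta> Polynomial.smult (T_mult \<delta>)"
proof unfold_locales
  fix a :: 'k and p q :: "'k poly"
  show "T_mult \<delta> (p + q) = T_mult \<delta> p + T_mult \<delta> q"
    by (rule poly_eqI) (simp add: T_mult_def coeff_map_poly d_zero d_add coeff_pCons split: nat.split)
  show "T_mult \<delta> (Polynomial.smult a p) =
      Polynomial.smult a (T_mult \<delta> p) + Polynomial.smult (\<delta> a) p"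
    by (rule poly_eqI)
       (simp add: T_mult_def coeff_map_poly d_zero d_mult coeff_pCons algebra_simps split: nat.split)
qed (simp_all add: smult_add_left smult_add_right)

lemma T_mult_right: "twisted_act Polynomial.smult (T_mult \<delta>) [:0, 1:] [:a:] = [:\<delta> a, a:]"
  by (simp add: twisted_act_def T_mult_def map_poly_pCons d_zero)

lemma Lpow_T: "(T_mult \<delta> ^^ i) 1 = monom 1 i"
proof (induction i)
  case (Suc i)
  have "map_poly \<delta> (monom 1 i) = 0"
    by (rule poly_eqI) (simp add: coeff_map_poly d_zero d_one)
  with Suc show ?case by (simp add: T_mult_def monom_Suc)
qed simp

lemma ring_twisted_ring: "ring (twisted_ring \<delta>)"
proof -
  interpret twisted_action \<delta> Polynomial.smult "T_mult \<delta>" by (rule twisted_action_poly)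
  have one: "act p 1 = p" for p
    unfolding twisted_act_def Lpow_T
    by (simp add: smult_monom poly_as_sum_of_monoms)
  show ?thesis
  proof (rule ringI)
    show "abelian_group (twisted_ring \<delta>)"
      by (rule abelian_groupI)
         (auto simp: twisted_ring_def algebra_simps intro: exI[of _ "- _"] right_minus left_minus)
    show "monoid (twisted_ring \<delta>)"
      by (rule monoidI) (auto simp: twisted_ring_def act_mult act_one one)
  qed (auto simp: twisted_ring_def act_add_left act_add_right)
qed

lemma taylor_add: "taylor \<delta> (a + b) = taylor \<delta> a + taylor \<delta> b"
  by (rule fps_ext) (simp add: taylor_def dpow_add add_divide_distrib)

lemma taylor_one: "taylor \<delta> 1 = 1"
  by (rule fps_ext) (simp add: taylor_def dpow_one)

lemma fps_deriv_taylor: "fps_deriv (taylor \<delta> a) = taylor \<delta> (\<delta> a)"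
proof (rule fps_ext)
  fix n
  have "of_nat (Suc n) * (z / fact (Suc n)) = z / fact n" for z :: 'k
    by (simp add: fact_Suc del: of_nat_Suc)
  thus "fps_nth (fps_deriv (taylor \<delta> a)) n = fps_nth (taylor \<delta> (\<delta> a)) n"
    by (simp add: taylor_def funpow_swap1)
qed

lemma taylor_mult: "taylor \<delta> (a * b) = taylor \<delta> a * taylor \<delta> b"
proof (rule fps_ext)
  fix n
  show "fps_nth (taylor \<delta> (a * b)) n = fps_nth (taylor \<delta> a * taylor \<delta> b) n"
  proof (induction n arbitrary: a b)
    case 0
    show ?case by (simp add: taylor_def)
  next
    case (Suc n)
    have "of_nat (Suc n) * fps_nth (taylor \<delta> (a * b)) (Suc n) = fps_nth (taylor \<delta> (\<delta> (a * b))) n"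
      by (simp flip: fps_deriv_taylor)
    also have "\<dots> = fps_nth (fps_deriv (taylor \<delta> a * taylor \<delta> b)) n"
      by (simp add: d_mult taylor_add Suc.IH fps_deriv_taylor)
    also have "\<dots> = of_nat (Suc n) * fps_nth (taylor \<delta> a * taylor \<delta> b) (Suc n)"
      by (simp only: fps_deriv_nth Suc_eq_plus1)
    finally show ?case by (simp del: of_nat_Suc)
  qed
qed

lemma twisted_action_fps: "twisted_action \<delta> (\<lambda>c F. taylor \<delta> c * F) fps_deriv"
  by unfold_locales (simp_all add: taylor_add taylor_mult taylor_one fps_deriv_taylor algebra_simps)

lemma left_module_fps: "left_module (twisted_ring \<delta>) (fps_module \<delta>)"
proof -
  interpret twisted_action \<delta> "\<lambda>c F. taylor \<delta> c * F" fps_deriv by (rule twisted_action_fps)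
  interpret R: ring "twisted_ring \<delta>" by (rule ring_twisted_ring)
  have "abelian_group (fps_module \<delta>)"
    by (rule abelian_groupI)
       (auto simp: fps_module_def algebra_simps intro: exI[of _ "- _"] right_minus left_minus)
  then interpret M: abelian_group "fps_module \<delta>" .
  show ?thesis
    by unfold_locales
       (auto simp: twisted_ring_def fps_module_def act_add_left act_add_right act_mult act_one)
qed

end

end

theory Submission
  imports Defs
begin

text \<open>
  Write \<open>\<sigma>\<close> for the spectral norm of \<open>\<delta>\<close>. In residue characteristic \<open>0\<close> all nonzero integers have
  absolute value \<open>1\<close>, so integration does not increase Gauss norms, and \<open>taylor \<delta> c\<close> has Gauss norm
  \<open>v c\<close> at every radius \<open>s < 1 / \<sigma>\<close> because it is a unit. Hence a nonzero twisted polynomial \<open>P\<close> is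
  surjective on the overconvergent series at any radius \<open>t < 1 / \<sigma>\<close>: at a generic radius slightly
  larger than \<open>t\<close> a single term of \<open>P\<close> dominates, and the other terms are absorbed by a contraction.
  As left ideals of the twisted polynomial ring are principal, overconvergent solutions on a submodule
  extend to the whole module.

  An irreducible module has a nonzero overconvergent solution at radius \<open>t < 1 / \<sigma>\<close> if and only if
  the spectral norm of \<open>T\<close> is less than \<open>1 / t\<close>: such a solution is injective and pulls back the Gauss
  norm to a norm for which \<open>T\<close> is small, and conversely the coefficients of a solution are the values
  of a bounded functional on the iterates of \<open>T\<close>. Going up a composition series with these two facts
  shows that a submodule lies in \<open>F_sol\<close> if and only if all its factors have radius \<open>r\<close>.
\<close>

section \<open>Spectral norms\<close>

text \<open>The radius must be free to move. At radius \<open>t\<close> itself two terms of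
  \<open>P\<close> may have equal weight, which destroys the contraction; an overconvergent series
  leaves an interval above \<open>t\<close> in which the finitely many ties can be avoided. For this
  reason extension is proved for \<open>fps_overconv\<close> only, and membership in
  \<open>fps_conv v r\<close> is read as membership in \<open>fps_overconv v t\<close> for all
  \<open>t < r\<close>. The end point \<open>r = 1 / \<sigma>\<close> is different: there the
  estimates for Taylor series stop and \<open>F_le\<close> imposes nothing. What replaces it is that
  the spectral norm of \<open>T\<close> on a nonzero module is at least \<sigma>, so no factor has a
  radius beyond \<open>1 / \<sigma>\<close>. Solutions are plentiful because every linear functional
  \<open>\<phi>\<close> on \<open>M\<close> gives one, with coefficients
  \<open>\<phi> (T^i x) / i!\<close>. A functional that vanishes on a submodule \<open>U\<close>
  gives a solution that vanishes on \<open>U\<close> and descends to a factor \<open>U1 / U\<close>;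
  the radius of the factor is read off from such a solution.\<close>

locale bounded_operator =
  fixes A :: "'a set" and \<nu> :: "'a \<Rightarrow> real" and f :: "'a \<Rightarrow> 'a"
  assumes nonneg: "x \<in> A \<Longrightarrow> 0 \<le> \<nu> x"
    and closed: "x \<in> A \<Longrightarrow> f x \<in> A"
    and nontrivial: "\<exists>x\<in>A. \<nu> x \<noteq> 0"
    and bounded: "\<exists>C. \<forall>x\<in>A. \<nu> (f x) \<le> C * \<nu> x"
begin

lemma pow_closed: "x \<in> A \<Longrightarrow> (f ^^ i) x \<in> A"
  by (induction i) (auto simp: closed)

text \<open>A crude exponential bound whose base can be made as large as required:
  \<open>spectral_norm_lessD\<close> asks for \<open>B\<close> at least \<open>\<beta>\<close>, so
  that the powers of \<open>B / \<beta>\<close> increase.\<close>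

lemma pow_bounded:
  obtains B where "B \<ge> b" "B > 0" "\<And>i x. x \<in> A \<Longrightarrow> \<nu> ((f ^^ i) x) \<le> B ^ i * \<nu> x"
proof -
  obtain C where C: "\<forall>x\<in>A. \<nu> (f x) \<le> C * \<nu> x" using bounded by blast
  define B where "B = max (max C b) 1"
  have B: "\<nu> (f x) \<le> B * \<nu> x" if "x \<in> A" for x
    using C that mult_right_mono[of C B "\<nu> x"] nonneg[OF that] by (fastforce simp: B_def)
  have "\<nu> ((f ^^ i) x) \<le> B ^ i * \<nu> x" if "x \<in> A" for i x
  proof (induction i)
    case (Suc i)
    have "\<nu> ((f ^^ Suc i) x) \<le> B * \<nu> ((f ^^ i) x)"
      using B[OF pow_closed[OF that]] by simp
    also have "\<dots> \<le> B * (B ^ i * \<nu> x)"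
      using Suc by (intro mult_left_mono) (auto simp: B_def)
    finally show ?case by (simp add: mult_ac)
  qed simp
  moreover have "B \<ge> b" "B > 0" by (auto simp: B_def)
  ultimately show ?thesis using that by blast
qed

lemma op_norm_upper:
  assumes "x \<in> A"
  shows "\<nu> ((f ^^ i) x) \<le> op_norm A \<nu> (f ^^ i) * \<nu> x"
proof -
  obtain B where B: "B > 0" "\<And>i x. x \<in> A \<Longrightarrow> \<nu> ((f ^^ i) x) \<le> B ^ i * \<nu> x"
    using pow_bounded by blast
  show ?thesis
  proof (cases "\<nu> x = 0")
    case True
    thus ?thesis using B(2)[OF assms, of i] by simp
  next
    case False
    have "bdd_above ((\<lambda>x. \<nu> ((f ^^ i) x) / \<nu> x) ` {x \<in> A. \<nu> x \<noteq> 0})"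
      using B nonneg by (intro bdd_aboveI2[where M = "B ^ i"]) (fastforce simp: field_simps order.strict_iff_order)
    hence "\<nu> ((f ^^ i) x) / \<nu> x \<le> op_norm A \<nu> (f ^^ i)"
      unfolding op_norm_def using assms False by (intro cSUP_upper) auto
    moreover have "\<nu> x > 0" using nonneg[OF assms] False by simp
    ultimately show ?thesis by (simp add: field_simps)
  qed
qed

lemma op_norm_nonneg: "0 \<le> op_norm A \<nu> (f ^^ i)"
proof -
  obtain x where x: "x \<in> A" "\<nu> x > 0" using nontrivial nonneg by (metis order.not_eq_order_implies_strict)
  have "0 \<le> op_norm A \<nu> (f ^^ i) * \<nu> x"
    using nonneg[OF pow_closed[OF x(1)]] op_norm_upper[OF x(1)] by (meson order.trans)
  thus ?thesis using x(2) by (simp add: zero_le_mult_iff)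
qed

lemma op_norm_least:
  assumes "\<And>x. x \<in> A \<Longrightarrow> \<nu> ((f ^^ i) x) \<le> C * \<nu> x"
  shows "op_norm A \<nu> (f ^^ i) \<le> C"
  unfolding op_norm_def
proof (rule cSUP_least)
  fix x assume x: "x \<in> {x \<in> A. \<nu> x \<noteq> 0}"
  hence "\<nu> x > 0" using nonneg[of x] by (auto simp: less_le)
  thus "\<nu> ((f ^^ i) x) / \<nu> x \<le> C" using assms[of x] x by (auto simp: divide_le_eq)
qed (use nontrivial in auto)

lemma spectral_norm_le_root:
  assumes "i \<ge> 1"
  shows "spectral_norm A \<nu> f \<le> op_norm A \<nu> (f ^^ i) powr (1 / real i)"
  unfolding spectral_norm_def
  by (rule cINF_lower) (use assms in \<open>auto intro!: bdd_belowI2[where m = 0]\<close>)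

lemma spectral_norm_nonneg: "0 \<le> spectral_norm A \<nu> f"
  unfolding spectral_norm_def by (rule cINF_greatest) auto

text \<open>Constants do not matter for the spectral norm, because \<open>C powr (1 / n)\<close>
  tends to \<open>1\<close>. This is also what makes it insensitive to the choice among equivalent
  norms.\<close>

lemma spectral_norm_leI:
  assumes "0 \<le> \<beta>" and bd: "\<And>i x. x \<in> A \<Longrightarrow> \<nu> ((f ^^ i) x) \<le> C * \<beta> ^ i * \<nu> x"
  shows "spectral_norm A \<nu> f \<le> \<beta>"
proof (rule LIMSEQ_le_const)
  \<comment> \<open>\<open>C\<close> may be \<open>0\<close> or negative, and
    \<open>0 powr 0 = 0\<close>; the limit \<open>D powr 0 = 1\<close> needs a positive
    base.\<close>
  define D where "D = max C 1"
  have bd': "\<nu> ((f ^^ i) x) \<le> D * \<beta> ^ i * \<nu> x" if "x \<in> A" for i x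
    using bd[OF that, of i] mult_right_mono[of C D "\<beta> ^ i * \<nu> x"] assms(1) nonneg[OF that]
    by (fastforce simp: D_def mult.assoc)
  have "D \<noteq> 0" by (auto simp: D_def)
  have "(\<lambda>n. D powr (1 / real n) * \<beta>) \<longlonglongrightarrow> D powr 0 * \<beta>"
    by (intro tendsto_intros lim_1_over_n) (auto simp: D_def)
  thus "(\<lambda>n. D powr (1 / real n) * \<beta>) \<longlonglongrightarrow> \<beta>" using \<open>D \<noteq> 0\<close> by simp
  have "spectral_norm A \<nu> f \<le> D powr (1 / real n) * \<beta>" if n: "n \<ge> 1" for n
  proof -
    have "spectral_norm A \<nu> f \<le> op_norm A \<nu> (f ^^ n) powr (1 / real n)"
      by (rule spectral_norm_le_root[OF n])
    also have "\<dots> \<le> (D * \<beta> ^ n) powr (1 / real n)"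
      using op_norm_least[OF bd'] op_norm_nonneg by (intro powr_mono2) auto
    also have "\<dots> = D powr (1 / real n) * \<beta>"
    proof (cases "\<beta> = 0")
      case False
      hence "(\<beta> ^ n) powr (1 / real n) = \<beta>"
        using assms(1) n by (simp add: powr_powr flip: powr_realpow)
      thus ?thesis using assms(1) by (simp add: powr_mult D_def)
    qed (use n in \<open>simp add: zero_power\<close>)
    finally show ?thesis .
  qed
  thus "\<exists>N. \<forall>n\<ge>N. spectral_norm A \<nu> f \<le> D powr (1 / real n) * \<beta>" by blast
qed

text \<open>The infimum lies below \<open>\<beta>\<close> because of one exponent \<open>k\<close>,
  which controls all multiples of \<open>k\<close>. Division with remainder handles the rest: the
  fewer than \<open>k\<close> left-over iterations cost at most the factor
  \<open>(B / \<beta>) ^ k\<close>.\<close>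

lemma spectral_norm_lessD:
  assumes "spectral_norm A \<nu> f < \<beta>"
  obtains C where "C > 0" "\<And>i x. x \<in> A \<Longrightarrow> \<nu> ((f ^^ i) x) \<le> C * \<beta> ^ i * \<nu> x"
proof -
  have \<beta>: "\<beta> > 0" using spectral_norm_nonneg assms by linarith
  obtain k where k: "k \<ge> 1" "op_norm A \<nu> (f ^^ k) powr (1 / real k) < \<beta>"
    using assms unfolding spectral_norm_def
    by (subst (asm) cINF_less_iff) (auto intro!: bdd_belowI2[where m = 0])
  have "op_norm A \<nu> (f ^^ k) \<le> \<beta> ^ k"
  proof (cases "op_norm A \<nu> (f ^^ k) = 0")
    case False
    hence pos: "op_norm A \<nu> (f ^^ k) > 0" using op_norm_nonneg[of k] by linarith
    have "op_norm A \<nu> (f ^^ k) = (op_norm A \<nu> (f ^^ k) powr (1 / real k)) ^ k"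
      using pos k(1) by (simp add: powr_powr flip: powr_realpow)
    also have "\<dots> \<le> \<beta> ^ k" using k(2) by (intro power_mono) auto
    finally show ?thesis .
  qed (use \<beta> in simp)
  hence step: "\<nu> ((f ^^ k) x) \<le> \<beta> ^ k * \<nu> x" if "x \<in> A" for x
    using op_norm_upper[OF that, of k] mult_right_mono[OF _ nonneg[OF that]] by (meson order.trans)
  have steps: "\<nu> ((f ^^ (q * k)) x) \<le> \<beta> ^ (q * k) * \<nu> x" if "x \<in> A" for q x
  proof (induction q)
    case (Suc q)
    have "\<nu> ((f ^^ (Suc q * k)) x) \<le> \<beta> ^ k * \<nu> ((f ^^ (q * k)) x)"
      using step[OF pow_closed[OF that]] by (simp add: funpow_add)
    also have "\<dots> \<le> \<beta> ^ k * (\<beta> ^ (q * k) * \<nu> x)"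
      using Suc \<beta> by (intro mult_left_mono) auto
    finally show ?case by (simp add: power_add mult_ac)
  qed simp
  obtain B where B: "B \<ge> \<beta>" "B > 0" "\<And>i x. x \<in> A \<Longrightarrow> \<nu> ((f ^^ i) x) \<le> B ^ i * \<nu> x"
    using pow_bounded by blast
  have "\<nu> ((f ^^ i) x) \<le> (B / \<beta>) ^ k * \<beta> ^ i * \<nu> x" if x: "x \<in> A" for i x
  proof -
    define m where "m = i mod k"
    have i: "i = m + i div k * k" by (simp add: m_def)
    have m: "m < k" using k(1) by (simp add: m_def)
    have "\<nu> ((f ^^ i) x) \<le> B ^ m * \<nu> ((f ^^ (i div k * k)) x)"
      using B(3)[OF pow_closed[OF x], of m "i div k * k"] i by (metis comp_apply funpow_add)
    also have "\<dots> \<le> B ^ m * (\<beta> ^ (i div k * k) * \<nu> x)"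
      using steps[OF x] B by (intro mult_left_mono) auto
    also have "B ^ m = (B / \<beta>) ^ m * \<beta> ^ m" using \<beta> by (simp add: field_simps)
    also have "(B / \<beta>) ^ m * \<beta> ^ m * (\<beta> ^ (i div k * k) * \<nu> x) = (B / \<beta>) ^ m * (\<beta> ^ i * \<nu> x)"
      using i by (metis (no_types, lifting) mult.assoc power_add)
    also have "\<dots> \<le> (B / \<beta>) ^ k * (\<beta> ^ i * \<nu> x)"
      using B \<beta> m nonneg[OF x] by (intro mult_right_mono power_increasing) auto
    finally show ?thesis by (simp add: mult_ac)
  qed
  moreover have "(B / \<beta>) ^ k > 0" using B \<beta> by simp
  ultimately show ?thesis using that by blast
qed

end

section \<open>The base field\<close>

context complete_nonarch_diff_field
begin

lemma v_0 [simp]: "v 0 = 0"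
  by (simp add: abs_eq_0)

lemma v_pos: "x \<noteq> 0 \<Longrightarrow> v x > 0"
  using abs_nonneg[of x] abs_eq_0[of x] by linarith

lemma v_1 [simp]: "v 1 = 1"
proof -
  have "v 1 * v 1 = v 1" by (simp flip: abs_mult)
  moreover have "v 1 \<noteq> 0" by (simp add: abs_eq_0)
  ultimately show ?thesis by simp
qed

lemma v_minus [simp]: "v (- x) = v x"
proof -
  have "(v (- 1))\<^sup>2 = 1" by (simp add: power2_eq_square flip: abs_mult)
  hence "v (- 1) = 1" using abs_nonneg[of "- 1"] by (simp add: power2_eq_1_iff)
  thus ?thesis using abs_mult[of "- 1" x] by simp
qed

lemma v_add_le: "v x \<le> B \<Longrightarrow> v y \<le> B \<Longrightarrow> v (x + y) \<le> B"
  using abs_ultrametric[of x y] by linarith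

lemma v_add_less: "v x < B \<Longrightarrow> v y < B \<Longrightarrow> v (x + y) < B"
  using abs_ultrametric[of x y] by linarith

lemma v_diff_le: "v x \<le> B \<Longrightarrow> v y \<le> B \<Longrightarrow> v (x - y) \<le> B"
  using v_add_le[of x B "- y"] by simp

lemma v_commute: "v (x - y) = v (y - x)"
  using v_minus[of "x - y"] by simp

lemma v_inverse: "v (inverse x) = inverse (v x)"
proof (cases "x = 0")
  case False
  hence "v x * v (inverse x) = 1" by (simp flip: abs_mult)
  thus ?thesis by (metis inverse_unique)
qed simp

lemma v_divide: "v (x / y) = v x / v y"
  by (simp add: divide_inverse abs_mult v_inverse)

lemma v_sum_le:
  assumes "\<And>i. i \<in> I \<Longrightarrow> v (f i) \<le> B" "0 \<le> B"
  shows "v (sum f I) \<le> B"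
  using assms
proof (induction I rule: infinite_finite_induct)
  case (insert i I)
  hence "v (f i) \<le> B" "v (sum f I) \<le> B" by auto
  thus ?case using insert.hyps by (simp add: v_add_le)
qed auto

lemma v_sum_less:
  assumes "finite I" "\<And>i. i \<in> I \<Longrightarrow> v (f i) < B" "0 < B"
  shows "v (sum f I) < B"
  using assms
proof (induction I rule: finite_induct)
  case (insert i I)
  hence "v (f i) < B" "v (sum f I) < B" by auto
  thus ?case using insert.hyps by (simp add: v_add_less)
qed auto

lemma v_of_nat_le_1: "v (of_nat n) \<le> 1"
proof (induction n)
  case (Suc n)
  thus ?case using abs_ultrametric[of 1 "of_nat n"] by simp
qed simp

lemma Metric_space_v: "Metric_space UNIV (\<lambda>x y. v (x - y))"
proof
  fix x y z
  show "v (x - z) \<le> v (x - y) + v (y - z)"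
    using abs_ultrametric[of "x - y" "y - z"] abs_nonneg[of "x - y"] abs_nonneg[of "y - z"] by simp
qed (simp_all add: abs_nonneg abs_eq_0 v_commute)

lemma Cauchy_convergent:
  fixes x :: "nat \<Rightarrow> 'k"
  assumes "\<And>e. e > 0 \<Longrightarrow> \<exists>N. \<forall>m\<ge>N. \<forall>n\<ge>N. v (x m - x n) < e"
  obtains l where "(\<lambda>n. v (x n - l)) \<longlonglongrightarrow> 0"
proof -
  interpret Metric_space UNIV "\<lambda>x y. v (x - y)" by (rule Metric_space_v)
  have "MCauchy x" unfolding MCauchy_def using assms by fastforce
  then obtain l where "limitin mtopology x l sequentially"
    using complete unfolding mcomplete_def by blast
  hence "(\<lambda>n. v (x n - l)) \<longlonglongrightarrow> 0"
    by (subst (asm) limitin_metric) (auto simp: tendsto_iff dist_real_def abs_nonneg)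
  thus ?thesis using that by blast
qed

lemma bounded_operator_derivation: "bounded_operator UNIV v \<delta>"
  by unfold_locales (use abs_nonneg d_bounded in \<open>auto intro: exI[of _ 1]\<close>)

text \<open>Any \<open>\<beta>\<close> strictly between the spectral norm and \<open>1 / t\<close>
  serves, with \<open>q = \<beta> * t\<close>. The geometric factor is what makes the terms of a
  Taylor series at radius \<open>t\<close> a null sequence.\<close>

lemma derivation_pow_growth:
  assumes "0 < t" "t * spectral_norm UNIV v \<delta> < 1"
  obtains q C where "0 < q" "q < 1" "\<And>i x. v ((\<delta> ^^ i) x) * t ^ i \<le> C * q ^ i * v x"
proof -
  interpret bounded_operator UNIV v \<delta> by (rule bounded_operator_derivation)
  have "spectral_norm UNIV v \<delta> < 1 / t" using assms by (simp add: field_simps)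
  then obtain \<beta> where \<beta>: "spectral_norm UNIV v \<delta> < \<beta>" "\<beta> < 1 / t" using dense by blast
  have pos: "\<beta> > 0" using spectral_norm_nonneg \<beta> by linarith
  obtain C where C: "C > 0" "\<And>i x. v ((\<delta> ^^ i) x) \<le> C * \<beta> ^ i * v x"
    using spectral_norm_lessD[OF \<beta>(1)] by auto
  have "v ((\<delta> ^^ i) x) * t ^ i \<le> C * (\<beta> * t) ^ i * v x" for i x
    using mult_right_mono[OF C(2)[of i x], of "t ^ i"] assms(1)
    by (simp add: power_mult_distrib mult_ac)
  moreover have "0 < \<beta> * t" "\<beta> * t < 1" using pos assms(1) \<beta>(2) by (auto simp: field_simps)
  ultimately show ?thesis using that by blast
qed

end

text \<open>The first maximum is wanted, not just any: in a product of two series, every other pair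
  of indices with the same sum as the two first maxima then has a strict loss in one factor.\<close>

lemma null_sequence_first_max:
  fixes a :: "nat \<Rightarrow> real"
  assumes "a \<longlonglongrightarrow> 0" "a 0 > 0"
  obtains i where "\<And>j. a j \<le> a i" "\<And>j. j < i \<Longrightarrow> a j < a i"
proof -
  obtain N where N: "\<And>n. n \<ge> N \<Longrightarrow> a n < a 0"
    using order_tendstoD(2)[OF assms] by (auto simp: eventually_sequentially)
  define m where "m = Max (a ` {..N})"
  have m_in: "m \<in> a ` {..N}" unfolding m_def by (rule Max_in) auto
  have m_ge: "a j \<le> m" for j
  proof (cases "j \<le> N")
    case False
    hence "a j < a 0" by (simp add: N)
    also have "a 0 \<le> m" unfolding m_def by (rule Max_ge) auto
    finally show ?thesis by simp
  qed (simp add: m_def)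
  define i where "i = (LEAST i. a i = m)"
  have i: "a i = m" unfolding i_def by (rule LeastI_ex) (use m_in in auto)
  show ?thesis
  proof (rule that)
    show "a j \<le> a i" for j using m_ge i by simp
    show "a j < a i" if "j < i" for j
      using m_ge[of j] not_less_Least[OF that[unfolded i_def]] i by linarith
  qed
qed

text \<open>Elements of the quotient ring are cosets of the maximal ideal, so the multiple
  \<open>n\<close> of its unit is a set, the open ball of radius \<open>1\<close> around the integer
  \<open>n\<close>; adding two such balls adds their centres.\<close>

lemma residue_field_of_nat:
  assumes "complete_nonarch_diff_field v \<delta>"
  shows "add_pow (residue_field v) n \<one>\<^bsub>residue_field v\<^esub> = {x. v (x - of_nat n) < 1}"
proof -
  interpret complete_nonarch_diff_field v \<delta> by fact
  have one: "\<one>\<^bsub>residue_field v\<^esub> = {x. v (x - 1) < 1}"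
  proof -
    have "\<one>\<^bsub>residue_field v\<^esub> = (\<lambda>h. h + 1) ` {x. v x < 1}"
      by (auto simp: residue_field_def FactRing_def a_r_coset_def r_coset_def valuation_ring_def)
    also have "\<dots> = {x. v (x - 1) < 1}"
      by (auto intro!: image_eqI[of _ _ "_ - 1"])
    finally show ?thesis .
  qed
  show ?thesis
  proof (induction n)
    case 0
    show ?case by (auto simp: add_pow_def nat_pow_def residue_field_def FactRing_def)
  next
    case (Suc n)
    have "add_pow (residue_field v) (Suc n) \<one>\<^bsub>residue_field v\<^esub> =
        add_pow (residue_field v) n \<one>\<^bsub>residue_field v\<^esub> \<oplus>\<^bsub>residue_field v\<^esub> \<one>\<^bsub>residue_field v\<^esub>"
      by (simp add: add_pow_def nat_pow_def)
    also have "\<dots> = {x. v (x - of_nat n) < 1} \<oplus>\<^bsub>residue_field v\<^esub> {x. v (x - 1) < 1}"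
      by (simp only: Suc flip: one)
    also have "\<dots> = (\<Union>h\<in>{x. v (x - of_nat n) < 1}. \<Union>k\<in>{x. v (x - 1) < 1}. {h + k})"
      by (simp add: residue_field_def FactRing_def set_add_def set_mult_def valuation_ring_def)
    also have "\<dots> = {x. v (x - of_nat (Suc n)) < 1}"
    proof (intro equalityI subsetI)
      fix x assume "x \<in> (\<Union>h\<in>{x. v (x - of_nat n) < 1}. \<Union>k\<in>{x. v (x - 1) < 1}. {h + k})"
      then obtain h k where "v (h - of_nat n) < 1" "v (k - 1) < 1" "x = h + k" by auto
      thus "x \<in> {x. v (x - of_nat (Suc n)) < 1}"
        using v_add_less[of "h - of_nat n" 1 "k - 1"] by (simp add: algebra_simps)
    next
      fix x assume "x \<in> {x. v (x - of_nat (Suc n)) < 1}"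
      thus "x \<in> (\<Union>h\<in>{x. v (x - of_nat n) < 1}. \<Union>k\<in>{x. v (x - 1) < 1}. {h + k})"
        by (intro UN_I[of "x - 1"] UN_I[of 1]) (auto simp: algebra_simps)
    qed
    finally show ?case .
  qed
qed

locale residue_char_0_diff_field = complete_nonarch_diff_field v \<delta>
  for v :: "'k::field_char_0 \<Rightarrow> real" and \<delta> :: "'k \<Rightarrow> 'k" +
  assumes v_of_nat: "0 < n \<Longrightarrow> v (of_nat n) = 1"

text \<open>An integer of absolute value below \<open>1\<close> vanishes in the residue field and
  hence is a multiple of the residue characteristic, which is \<open>0\<close>.\<close>

lemma residue_char_0_diff_fieldI:
  assumes "complete_nonarch_diff_field v \<delta>" "residue_char v = 0"
  shows "residue_char_0_diff_field v \<delta>"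
proof -
  interpret complete_nonarch_diff_field v \<delta> by fact
  have "v (of_nat n) = 1" if "0 < n" for n
  proof (rule ccontr)
    assume "v (of_nat n) \<noteq> 1"
    hence less: "v (of_nat n) < 1" using v_of_nat_le_1[of n] by simp
    have "{x. v (x - of_nat n) < 1} = {x. v x < 1}"
      using v_add_less[OF _ less] v_add_less[of _ 1 "- of_nat n"] less by fastforce
    hence "add_pow (residue_field v) n \<one>\<^bsub>residue_field v\<^esub> = \<zero>\<^bsub>residue_field v\<^esub>"
      unfolding residue_field_of_nat[OF assms(1)] by (simp add: residue_field_def FactRing_def)
    hence "residue_char v dvd n" unfolding residue_char_def ring_char_def by (intro Gcd_dvd) simp
    with assms(2) that show False by simp
  qed
  thus ?thesis by unfold_locales
qed

section \<open>Bounded power series\<close>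

text \<open>A relation instead of a supremum: estimates compose without side conditions on
  boundedness, and the supremum \<open>gauss_norm\<close> appears only where an actual norm on a
  module is built.\<close>

definition gauss_bound :: "('k::field_char_0 \<Rightarrow> real) \<Rightarrow> real \<Rightarrow> real \<Rightarrow> 'k fps \<Rightarrow> bool" where
  "gauss_bound v s C F \<longleftrightarrow> (\<forall>i. v (fps_nth F i) * s ^ i \<le> C)"

lemma fps_bounded_iff: "F \<in> fps_bounded v s \<longleftrightarrow> (\<exists>C. gauss_bound v s C F)"
  by (auto simp: fps_bounded_def gauss_bound_def bdd_above_def)

lemma gauss_bound_mono: "gauss_bound v s C F \<Longrightarrow> C \<le> D \<Longrightarrow> gauss_bound v s D F"
  unfolding gauss_bound_def by (meson order.trans)

context residue_char_0_diff_field
begin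

lemma v_fact [simp]: "v (fact n) = 1"
proof (induction n)
  case (Suc n)
  thus ?case by (simp add: fact_Suc abs_mult v_of_nat del: of_nat_Suc)
qed simp

text \<open>The first indices \<open>i\<close>, \<open>j\<close> at which \<open>F\<close> and its inverse \<open>G\<close> attain their Gauss norms make the
  coefficient of degree \<open>i + j\<close> of \<open>F * G\<close> nonzero, so both are \<open>0\<close>.\<close>

lemma unit_dominated_by_constant_term:
  assumes t: "t > 0" and FG: "F * G = (1 :: 'k fps)"
    and F: "(\<lambda>i. v (fps_nth F i) * t ^ i) \<longlonglongrightarrow> 0"
    and G: "(\<lambda>i. v (fps_nth G i) * t ^ i) \<longlonglongrightarrow> 0"
  shows "v (fps_nth F i) * t ^ i \<le> v (fps_nth F 0)"
proof -
  let ?a = "\<lambda>i. v (fps_nth F i) * t ^ i" and ?b = "\<lambda>i. v (fps_nth G i) * t ^ i"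
  have "fps_nth F 0 * fps_nth G 0 = 1" using FG by (metis fps_mult_nth_0 fps_one_nth)
  hence pos: "?a 0 > 0" "?b 0 > 0" by (auto intro!: v_pos)
  obtain i where i: "\<And>j. ?a j \<le> ?a i" "\<And>j. j < i \<Longrightarrow> ?a j < ?a i"
    using null_sequence_first_max[OF F pos(1)] by blast
  obtain j where j: "\<And>k. ?b k \<le> ?b j" "\<And>k. k < j \<Longrightarrow> ?b k < ?b j"
    using null_sequence_first_max[OF G pos(2)] by blast
  have ai: "?a i > 0" and bj: "?b j > 0" using i(1)[of 0] j(1)[of 0] pos by linarith+
  have nn: "?a k \<ge> 0" "?b k \<ge> 0" for k using t by (simp_all add: abs_nonneg)
  have tn: "t ^ (i + j) > 0" using t by simp
  have "i + j = 0"
  proof (rule ccontr)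
    assume ne: "i + j \<noteq> 0"
    let ?f = "\<lambda>k. fps_nth F k * fps_nth G (i + j - k)"
    have 0: "(\<Sum>k=0..i+j. ?f k) = 0" using FG ne by (metis fps_mult_nth fps_one_nth)
    have f: "v (?f k) * t ^ (i + j) = ?a k * ?b (i + j - k)" if "k \<le> i + j" for k
      using that power_add[of t k "i + j - k"] by (simp add: abs_mult mult_ac)
    \<comment> \<open>For the same total degree, \<open>k < i\<close> puts \<open>F\<close> before
      its first maximum and \<open>k > i\<close> puts \<open>G\<close> before its own, so every term
      but \<open>k = i\<close> is strictly smaller and the sum cannot vanish.\<close>
    have small: "v (?f k) < v (?f i)" if "k \<in> {0..i+j} - {i}" for k
    proof -
      have "?a k * ?b (i + j - k) < ?a i * ?b j"
      proof (cases "k < i")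
        case True
        have "?a k * ?b (i + j - k) \<le> ?a k * ?b j" by (rule mult_left_mono[OF j(1) nn(1)])
        also have "\<dots> < ?a i * ?b j" by (rule mult_strict_right_mono[OF i(2)[OF True] bj])
        finally show ?thesis .
      next
        case False
        have "?a k * ?b (i + j - k) \<le> ?a i * ?b (i + j - k)" by (rule mult_right_mono[OF i(1) nn(2)])
        also have "\<dots> < ?a i * ?b j"
          by (rule mult_strict_left_mono[OF j(2) ai]) (use that False in auto)
        finally show ?thesis .
      qed
      hence "v (?f k) * t ^ (i + j) < v (?f i) * t ^ (i + j)"
        using f[of k] f[of i] that by simp
      thus ?thesis using tn mult_less_cancel_right_pos by blast
    qed
    have "0 < ?a i * ?b j" using ai bj by (rule mult_pos_pos)
    hence "0 < v (?f i) * t ^ (i + j)" using f[of i] by simp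
    hence vi: "0 < v (?f i)" using tn zero_less_mult_pos2 by blast
    have "v (\<Sum>k\<in>{0..i+j} - {i}. ?f k) < v (?f i)"
      by (rule v_sum_less) (use small vi in auto)
    moreover have "(\<Sum>k\<in>{0..i+j} - {i}. ?f k) = - ?f i"
      using 0 by (subst (asm) sum.remove[of _ i]) (auto simp: eq_neg_iff_add_eq_0 add.commute)
    ultimately show False by simp
  qed
  thus ?thesis using i(1) by simp
qed

text \<open>The growth estimate for \<open>\<delta>\<close> gives this only up to a constant, and
  that loss would ruin the contraction factor in \<open>twisted_poly_surj\<close>. Since the series
  is a unit, with inverse \<open>taylor \<delta> (1 / c)\<close>, the constant can be
  removed.\<close>

lemma taylor_bound:
  assumes t: "0 < t" "t * spectral_norm UNIV v \<delta> < 1"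
  shows "gauss_bound v t (v c) (taylor \<delta> c)"
proof (cases "c = 0")
  case True
  have "(\<delta> ^^ i) 0 = 0" for i by (induction i) (auto simp: d_zero)
  thus ?thesis using True by (simp add: gauss_bound_def taylor_def)
next
  case False
  obtain q C where q: "0 < q" "q < 1" "\<And>i x. v ((\<delta> ^^ i) x) * t ^ i \<le> C * q ^ i * v x"
    using derivation_pow_growth[OF t] by blast
  have lim: "(\<lambda>i. v (fps_nth (taylor \<delta> x) i) * t ^ i) \<longlonglongrightarrow> 0" for x
  proof (rule tendsto_sandwich[of "\<lambda>_. 0" _ _ "\<lambda>i. C * q ^ i * v x"])
    have "(\<lambda>i. C * q ^ i * v x) \<longlonglongrightarrow> C * 0 * v x"
      using q by (intro tendsto_intros LIMSEQ_realpow_zero) auto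
    thus "(\<lambda>i. C * q ^ i * v x) \<longlonglongrightarrow> 0" by simp
  qed (use q t in \<open>auto simp: taylor_def v_divide abs_nonneg\<close>)
  have "taylor \<delta> c * taylor \<delta> (1 / c) = 1" using False by (simp add: taylor_one flip: taylor_mult)
  from unit_dominated_by_constant_term[OF t(1) this lim lim]
  show ?thesis by (simp add: gauss_bound_def taylor_def)
qed

section \<open>Arithmetic of Gauss bounds\<close>

lemma gauss_bound_nonneg: "gauss_bound v s C F \<Longrightarrow> 0 \<le> C"
  unfolding gauss_bound_def using abs_nonneg[of "fps_nth F 0"]
  by (metis mult.right_neutral order.trans power_0)

lemma gauss_bound_0: "gauss_bound v s 0 0"
  by (simp add: gauss_bound_def)

lemma gauss_bound_add:
  assumes "s > 0" "gauss_bound v s C F" "gauss_bound v s C G"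
  shows "gauss_bound v s C (F + G)"
  unfolding gauss_bound_def
proof
  fix i
  have "v (fps_nth F i) \<le> C / s ^ i" "v (fps_nth G i) \<le> C / s ^ i"
    using assms by (auto simp: gauss_bound_def field_simps)
  hence "v (fps_nth (F + G) i) \<le> C / s ^ i" by (simp add: v_add_le)
  thus "v (fps_nth (F + G) i) * s ^ i \<le> C" using assms(1) by (simp add: field_simps)
qed

lemma gauss_bound_uminus: "gauss_bound v s C F \<Longrightarrow> gauss_bound v s C (- F)"
  by (simp add: gauss_bound_def)

lemma gauss_bound_diff:
  assumes "s > 0" "gauss_bound v s C F" "gauss_bound v s C G"
  shows "gauss_bound v s C (F - G)"
  using gauss_bound_add[OF assms(1,2) gauss_bound_uminus[OF assms(3)]] by simp

lemma gauss_bound_sum: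
  assumes "s > 0" "0 \<le> C" "\<And>i. i \<in> I \<Longrightarrow> gauss_bound v s C (f i)"
  shows "gauss_bound v s C (sum f I)"
  using assms(3)
proof (induction I rule: infinite_finite_induct)
  case (insert i I)
  thus ?case using gauss_bound_add[OF assms(1)] by simp
qed (use assms(2) in \<open>auto intro: gauss_bound_mono[OF gauss_bound_0]\<close>)

lemma gauss_bound_mult:
  assumes s: "s > 0" and F: "gauss_bound v s C F" and G: "gauss_bound v s D G"
  shows "gauss_bound v s (C * D) (F * G)"
  unfolding gauss_bound_def
proof
  fix n
  have "v (fps_nth F i * fps_nth G (n - i)) \<le> C * D / s ^ n" if "i \<in> {0..n}" for i
  proof -
    have "v (fps_nth F i * fps_nth G (n - i)) * s ^ n
        = (v (fps_nth F i) * s ^ i) * (v (fps_nth G (n - i)) * s ^ (n - i))"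
      using that power_add[of s i "n - i"] by (simp add: abs_mult mult_ac)
    also have "\<dots> \<le> C * D"
      using F G s gauss_bound_nonneg[OF F]
      by (intro mult_mono) (auto simp: gauss_bound_def abs_nonneg)
    finally show ?thesis using s by (simp add: field_simps)
  qed
  hence "v (fps_nth (F * G) n) \<le> C * D / s ^ n"
    unfolding fps_mult_nth using s gauss_bound_nonneg[OF F] gauss_bound_nonneg[OF G]
    by (intro v_sum_le) auto
  thus "v (fps_nth (F * G) n) * s ^ n \<le> C * D" using s by (simp add: field_simps)
qed

lemma gauss_bound_deriv:
  assumes "s > 0" "gauss_bound v s C F"
  shows "gauss_bound v s (C / s) (fps_deriv F)"
  unfolding gauss_bound_def
proof
  fix i
  have "v (fps_nth F (Suc i)) * s ^ Suc i \<le> C" using assms(2) unfolding gauss_bound_def by blast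
  thus "v (fps_nth (fps_deriv F) i) * s ^ i \<le> C / s"
    using assms(1) by (simp add: abs_mult v_of_nat field_simps del: of_nat_Suc)
qed

lemma gauss_bound_deriv_pow:
  assumes "s > 0" "gauss_bound v s C F"
  shows "gauss_bound v s (C / s ^ k) ((fps_deriv ^^ k) F)"
proof (induction k)
  case (Suc k)
  thus ?case using gauss_bound_deriv[OF assms(1) Suc] by (simp add: field_simps)
qed (use assms in auto)

text \<open>The denominators \<open>j + 1\<close> have absolute value \<open>1\<close>, so
  integration costs only a factor \<open>s\<close>, which cancels the \<open>1 / s\<close> of
  \<open>gauss_bound_deriv\<close>.\<close>

lemma gauss_bound_integral:
  assumes "s > 0" "gauss_bound v s C F"
  shows "gauss_bound v s (C * s) (fps_integral0 F)"
  unfolding gauss_bound_def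
proof
  fix i
  show "v (fps_nth (fps_integral0 F) i) * s ^ i \<le> C * s"
  proof (cases i)
    case 0
    thus ?thesis using assms gauss_bound_nonneg[OF assms(2)] by (simp add: fps_integral_def)
  next
    case (Suc j)
    have "v (fps_nth F j) * s ^ j \<le> C" using assms(2) unfolding gauss_bound_def by blast
    thus ?thesis using assms(1) v_of_nat[of "Suc j"] Suc
      by (simp add: fps_integral_def abs_mult v_inverse mult_ac del: of_nat_Suc)
  qed
qed

lemma gauss_bound_integral_pow:
  assumes "s > 0" "gauss_bound v s C F"
  shows "gauss_bound v s (C * s ^ k) ((fps_integral0 ^^ k) F)"
proof (induction k)
  case (Suc k)
  thus ?case using gauss_bound_integral[OF assms(1) Suc] by (simp add: mult_ac)
qed (use assms in auto)

text \<open>This is the geometric series of \<open>L\<close> applied to \<open>H\<close>. It is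
  summed coefficient by coefficient, so that completeness of the base field is enough and no
  complete space of series has to be introduced; the Gauss bounds then pass to the limit.\<close>

lemma gauss_contraction_fixpoint:
  fixes L :: "'k fps \<Rightarrow> 'k fps"
  assumes s: "s > 0" and \<theta>: "0 \<le> \<theta>" "\<theta> < 1"
    and L_diff: "\<And>F G. L (F - G) = L F - L G"
    and L: "\<And>C F. gauss_bound v s C F \<Longrightarrow> gauss_bound v s (\<theta> * C) (L F)"
    and H: "gauss_bound v s C H"
  obtains F where "gauss_bound v s C F" "F = H + L F"
proof -
  have C: "0 \<le> C" by (rule gauss_bound_nonneg[OF H])
  have L_add: "L (F + G) = L F + L G" for F G
    using L_diff[of "F + G" G] by (simp add: algebra_simps)
  have L_0: "L 0 = 0" using L_diff[of 0 0] by simp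
  define S where "S m = (\<Sum>j<m. (L ^^ j) H)" for m
  have S_Suc: "S (Suc m) = H + L (S m)" for m
  proof (induction m)
    case 0 show ?case by (simp add: S_def L_0)
  next
    case (Suc m)
    have "S (Suc (Suc m)) = S (Suc m) + L ((L ^^ m) H)" by (simp add: S_def)
    also have "\<dots> = H + L (S (Suc m))" by (subst Suc) (simp add: S_def L_add algebra_simps)
    finally show ?case .
  qed
  have Lpow: "gauss_bound v s (\<theta> ^ m * C) ((L ^^ m) H)" for m
  proof (induction m)
    case (Suc m) thus ?case using L[OF Suc] by (simp add: mult_ac)
  qed (use H in auto)
  \<comment> \<open>By the ultrametric inequality a finite piece of the series is bounded like its
    first term, without a geometric sum.\<close>
  have tail: "gauss_bound v s (\<theta> ^ m * C) (S n - S m)" if "m \<le> n" for m n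
  proof -
    have "S n - S m = (\<Sum>j\<in>{m..<n}. (L ^^ j) H)"
      unfolding S_def using that sum_diff_nat_ivl[of 0 m n "\<lambda>j. (L ^^ j) H"] by (simp add: lessThan_atLeast0)
    also have "gauss_bound v s (\<theta> ^ m * C) \<dots>"
      using s \<theta> C
      by (intro gauss_bound_sum gauss_bound_mono[OF Lpow] mult_right_mono power_decreasing) auto
    finally show ?thesis .
  qed
  have null: "(\<lambda>m. \<theta> ^ m * C / s ^ i) \<longlonglongrightarrow> 0" for i
    using s \<theta> LIMSEQ_realpow_zero[OF \<theta>] by (auto intro!: tendsto_eq_intros)
  have coeff: "v (fps_nth (S n) i - fps_nth (S m) i) \<le> \<theta> ^ m * C / s ^ i" if "m \<le> n" for m n i
    using tail[OF that] s unfolding gauss_bound_def by (simp add: field_simps)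
  have "\<exists>l. (\<lambda>n. v (fps_nth (S n) i - l)) \<longlonglongrightarrow> 0" for i
  proof (rule Cauchy_convergent[of "\<lambda>n. fps_nth (S n) i"])
    fix e :: real assume "e > 0"
    hence "\<forall>\<^sub>F m in sequentially. \<theta> ^ m * C / s ^ i < e" by (rule order_tendstoD(2)[OF null])
    then obtain N where N: "\<theta> ^ N * C / s ^ i < e" unfolding eventually_sequentially by blast
    have "v (fps_nth (S m) i - fps_nth (S n) i) < e" if "m \<ge> N" "n \<ge> N" for m n
    proof -
      have "v ((fps_nth (S m) i - fps_nth (S N) i) - (fps_nth (S n) i - fps_nth (S N) i)) \<le> \<theta> ^ N * C / s ^ i"
        by (intro v_diff_le coeff that)
      thus ?thesis using N by simp
    qed
    thus "\<exists>N. \<forall>m\<ge>N. \<forall>n\<ge>N. v (fps_nth (S m) i - fps_nth (S n) i) < e" by blast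
  qed blast
  then obtain l where l: "\<And>i. (\<lambda>n. v (fps_nth (S n) i - l i)) \<longlonglongrightarrow> 0" by metis
  define F where "F = Abs_fps l"
  have F_tail: "gauss_bound v s (\<theta> ^ m * C) (F - S m)" for m
    unfolding gauss_bound_def
  proof
    fix i
    have "v (l i - fps_nth (S m) i) \<le> \<theta> ^ m * C / s ^ i"
    proof (rule field_le_epsilon)
      fix e :: real assume "e > 0"
      from order_tendstoD(2)[OF l this] obtain n where n: "n \<ge> m" "v (fps_nth (S n) i - l i) < e"
        unfolding eventually_sequentially by (meson nle_le)
      have "0 \<le> \<theta> ^ m * C / s ^ i" using \<theta> C s by simp
      hence "v ((fps_nth (S n) i - fps_nth (S m) i) - (fps_nth (S n) i - l i)) \<le> \<theta> ^ m * C / s ^ i + e"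
        using coeff[OF n(1), of i] n(2) \<open>e > 0\<close> by - (rule v_diff_le, auto)
      thus "v (l i - fps_nth (S m) i) \<le> \<theta> ^ m * C / s ^ i + e" by simp
    qed
    thus "v (fps_nth (F - S m) i) * s ^ i \<le> \<theta> ^ m * C" using s by (simp add: F_def field_simps)
  qed
  have "F - (H + L F) = 0"
  proof (rule fps_ext)
    fix i
    \<comment> \<open>Compare with the recursion \<open>S (Suc m) = H + L (S m)\<close>: the defect
      is a difference of two quantities that tend to \<open>0\<close> with growing
      \<open>m\<close>.\<close>
    have "v (fps_nth (F - (H + L F)) i) \<le> \<theta> ^ m * C / s ^ i" for m
    proof -
      have "F - (H + L F) = (F - S (Suc m)) - L (F - S m)" by (simp add: S_Suc L_diff)
      also have "gauss_bound v s (\<theta> ^ Suc m * C) \<dots>"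
        using L[OF F_tail[of m]] F_tail[of "Suc m"] by - (rule gauss_bound_diff[OF s], auto simp: mult_ac)
      finally have "v (fps_nth (F - (H + L F)) i) * s ^ i \<le> \<theta> ^ Suc m * C"
        unfolding gauss_bound_def by blast
      also have "\<dots> \<le> \<theta> ^ m * C" using \<theta> C by (intro mult_right_mono power_decreasing) auto
      finally show ?thesis using s by (simp add: field_simps)
    qed
    hence "v (fps_nth (F - (H + L F)) i) \<le> 0" using LIMSEQ_le_const[OF null] by blast
    thus "fps_nth (F - (H + L F)) i = fps_nth 0 i"
      using abs_nonneg[of "fps_nth (F - (H + L F)) i"] abs_eq_0 by (metis antisym fps_zero_nth)
  qed
  moreover have "gauss_bound v s C F" using F_tail[of 0] by (simp add: S_def)
  ultimately show ?thesis using that by (metis eq_iff_diff_eq_0)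
qed

text \<open>The weight \<open>v (coeff P i) / s ^ i\<close> is the size of the term of degree
  \<open>i\<close> acting on series of radius \<open>s\<close>, each derivative costing
  \<open>1 / s\<close>. Two nonzero terms tie at one radius at most, a root of a quotient of
  absolute values, so all but finitely many radii of the interval have a unique maximum.\<close>

lemma dominant_term:
  fixes P :: "'k poly"
  assumes P: "P \<noteq> 0" and t: "0 < t" "t < u"
  obtains s k where "t < s" "s < u" "coeff P k \<noteq> 0"
    "\<And>i. i \<noteq> k \<Longrightarrow> v (coeff P i) / s ^ i < v (coeff P k) / s ^ k"
proof -
  define w where "w s i = v (coeff P i) / s ^ i" for s i
  define bad where "bad = (\<Union>i\<in>{..degree P}. \<Union>j\<in>{i<..degree P}.
    {s. s > 0 \<and> coeff P i \<noteq> 0 \<and> coeff P j \<noteq> 0 \<and> w s i = w s j})"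
  have "finite bad"
    unfolding bad_def
  proof (intro finite_UN_I finite_atMost finite_greaterThanAtMost)
    fix i j assume ij: "j \<in> {i<..degree P}"
    have "{s. s > 0 \<and> coeff P i \<noteq> 0 \<and> coeff P j \<noteq> 0 \<and> w s i = w s j}
        \<subseteq> {root (j - i) (v (coeff P j) / v (coeff P i))}"
    proof
      fix s assume "s \<in> {s. s > 0 \<and> coeff P i \<noteq> 0 \<and> coeff P j \<noteq> 0 \<and> w s i = w s j}"
      hence s: "s > 0" "coeff P i \<noteq> 0" "w s i = w s j" by auto
      have "s ^ j = s ^ i * s ^ (j - i)" using ij by (simp flip: power_add)
      hence "v (coeff P j) / v (coeff P i) = s ^ (j - i)"
        using s v_pos[OF s(2)] by (simp add: w_def field_simps)
      thus "s \<in> {root (j - i) (v (coeff P j) / v (coeff P i))}"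
        using ij s(1) by (simp add: real_root_power_cancel)
    qed
    thus "finite {s. s > 0 \<and> coeff P i \<noteq> 0 \<and> coeff P j \<noteq> 0 \<and> w s i = w s j}"
      using finite_subset by blast
  qed
  hence "infinite ({t<..<u} - bad)" using t by (simp add: infinite_Ioo)
  then obtain s where s: "t < s" "s < u" "s \<notin> bad" by (metis Diff_iff finite.emptyI greaterThanLessThan_iff ex_in_conv)
  have pos: "s > 0" using s t by simp
  have "Max (w s ` {..degree P}) \<in> w s ` {..degree P}" by (rule Max_in) auto
  then obtain k where k: "k \<le> degree P" "w s k = Max (w s ` {..degree P})"
    by (metis atMost_iff imageE)
  have max: "w s i \<le> w s k" if "i \<le> degree P" for i using that k(2) by simp
  have "w s (degree P) > 0" using P pos by (simp add: w_def v_pos)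
  hence wk: "w s k > 0" using max[of "degree P"] by simp
  hence ck: "coeff P k \<noteq> 0" by (auto simp: w_def)
  have "w s i < w s k" if "i \<noteq> k" for i
  proof (cases "coeff P i = 0")
    case True
    thus ?thesis using wk by (simp add: w_def)
  next
    case False
    hence i: "i \<le> degree P" by (rule le_degree)
    have "w s i \<noteq> w s k"
      using s(3) i k(1) that pos False ck unfolding bad_def
      by (cases i k rule: linorder_cases) fastforce+
    thus ?thesis using max[OF i] by simp
  qed
  thus ?thesis using that s ck by (simp add: w_def)
qed

section \<open>Overconvergent series and radii below the radius of the base field\<close>

lemma fps_overconv_iff: "F \<in> fps_overconv v t \<longleftrightarrow> (\<exists>s>t. \<exists>C. gauss_bound v s C F)"
  by (auto simp: fps_overconv_def fps_bounded_iff)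

lemma gauss_bound_antimono:
  assumes "0 < s" "s \<le> s'" "gauss_bound v s' C F"
  shows "gauss_bound v s C F"
  unfolding gauss_bound_def
proof
  fix i
  have "v (fps_nth F i) * s ^ i \<le> v (fps_nth F i) * s' ^ i"
    using assms by (intro mult_left_mono power_mono abs_nonneg) auto
  thus "v (fps_nth F i) * s ^ i \<le> C" using assms(3) unfolding gauss_bound_def by (meson order.trans)
qed

lemma diff_radius_eq: "diff_radius v \<delta> = 1 / spectral_norm UNIV v \<delta>" if "residue_char v = 0"
  using that by (simp add: diff_radius_def omega_def)

lemma spectral_derivation_nonneg: "0 \<le> spectral_norm UNIV v \<delta>"
  using bounded_operator.spectral_norm_nonneg[OF bounded_operator_derivation] .

text \<open>Shrinks a radius above \<open>t\<close> until Taylor series are controlled there. If the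
  spectral norm is \<open>0\<close> there is no upper limit, and \<open>1 / 0 = 0\<close> would be a
  wrong one, hence the case distinction.\<close>

lemma radius_margin:
  assumes "t * spectral_norm UNIV v \<delta> < 1" "t < s'"
  obtains s where "t < s" "s \<le> s'" "s * spectral_norm UNIV v \<delta> < 1"
proof (cases "spectral_norm UNIV v \<delta> = 0")
  case False
  hence pos: "spectral_norm UNIV v \<delta> > 0" using spectral_derivation_nonneg by simp
  hence "t < 1 / spectral_norm UNIV v \<delta>" using assms by (simp add: field_simps)
  then obtain s where s: "t < s" "s < min s' (1 / spectral_norm UNIV v \<delta>)"
    using assms(2) dense[of t "min s' (1 / spectral_norm UNIV v \<delta>)"] by auto
  hence "s * spectral_norm UNIV v \<delta> < 1" using pos by (simp add: field_simps)
  thus ?thesis using s that by simp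
qed (use assms that[of s'] in auto)

abbreviation fps_act :: "'k poly \<Rightarrow> 'k fps \<Rightarrow> 'k fps" where
  "fps_act \<equiv> twisted_act (\<lambda>c F. taylor \<delta> c * F) fps_deriv"

text \<open>At a generic radius \<open>s\<close> a single term \<open>a\<^sub>k T\<^sup>k\<close> of \<open>P\<close> dominates all others, and it has a right
  inverse given by \<open>k\<close>-fold integration, which does not increase norms in residue characteristic \<open>0\<close>.\<close>

lemma twisted_poly_surj:
  assumes P: "P \<noteq> 0" and t: "0 < t" "t * spectral_norm UNIV v \<delta> < 1"
    and G: "G \<in> fps_overconv v t"
  obtains F where "F \<in> fps_overconv v t" "fps_act P F = G"
proof -
  let ?I = "fps_integral0 :: 'k fps \<Rightarrow> 'k fps" and ?\<sigma> = "spectral_norm UNIV v \<delta>"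
  let ?n = "degree P"
  interpret bounded_operator UNIV v \<delta> by (rule bounded_operator_derivation)
  obtain s0 C0 where s0: "t < s0" "gauss_bound v s0 C0 G" using G fps_overconv_iff by blast
  \<comment> \<open>Two ceilings for the working radius: \<open>s0\<close>, up to which
    \<open>G\<close> is bounded, and \<open>u\<close>, up to which the Taylor series of the
    coefficients of \<open>P\<close> are under control.\<close>
  obtain u where u: "t < u" "u * ?\<sigma> < 1" using radius_margin[OF t(2), of "t + 1"] by auto
  obtain s k where s: "t < s" "s < min s0 u" and k: "coeff P k \<noteq> 0"
    and dom: "\<And>i. i \<noteq> k \<Longrightarrow> v (coeff P i) / s ^ i < v (coeff P k) / s ^ k"
    using dominant_term[OF P t(1), of "min s0 u"] s0(1) u(1) by (metis min_less_iff_conj)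
  have spos: "s > 0" using s t by simp
  have "s * ?\<sigma> \<le> u * ?\<sigma>" using s spectral_norm_nonneg by (intro mult_right_mono) auto
  hence s\<sigma>: "s * ?\<sigma> < 1" using u by simp
  note \<tau> = gauss_bound_mult[OF spos taylor_bound[OF spos s\<sigma>]]
  define A where "A = {..?n} - {k}"
  define ratio where "ratio i = (v (coeff P i) / s ^ i) / (v (coeff P k) / s ^ k)" for i
  \<comment> \<open>\<open>0\<close> is inserted because \<open>A\<close> is empty when
    \<open>P\<close> is a constant.\<close>
  define \<theta> where "\<theta> = Max (insert 0 (ratio ` A))"
  have vk: "v (coeff P k) > 0" by (rule v_pos[OF k])
  have \<theta>_ge: "ratio i \<le> \<theta>" if "i \<in> A" for i unfolding \<theta>_def using that by (auto simp: A_def)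
  have \<theta>0: "0 \<le> \<theta>" unfolding \<theta>_def by (rule Max_ge) (auto simp: A_def)
  have "ratio i < 1" if "i \<in> A" for i
  proof -
    have "0 < v (coeff P k) / s ^ k" using vk spos by simp
    thus ?thesis using dom[of i] that unfolding ratio_def A_def by (subst divide_less_eq_1_pos) auto
  qed
  hence \<theta>1: "\<theta> < 1"
    unfolding \<theta>_def by (subst Max_less_iff) (auto simp: A_def)
  \<comment> \<open>The equation \<open>fps_act P F = G\<close>, divided by the dominant coefficient
    and integrated \<open>k\<close> times with zero initial values, becomes
    \<open>F = H + L F\<close>.\<close>
  define L where "L F = (?I ^^ k) (taylor \<delta> (1 / coeff P k) *
    (\<Sum>i\<in>A. - (taylor \<delta> (coeff P i) * (fps_deriv ^^ i) F)))" for F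
  define H where "H = (?I ^^ k) (taylor \<delta> (1 / coeff P k) * G)"
  have I_diff: "(?I ^^ m) (F - G) = (?I ^^ m) F - (?I ^^ m) G" for m F G
  proof (induction m)
    case (Suc m)
    have "?I (X - Y) = ?I X - ?I Y" for X Y
      by (rule fps_ext) (simp add: fps_integral_def algebra_simps)
    thus ?case by (simp add: Suc)
  qed simp
  have D_diff: "(fps_deriv ^^ m) (F - G) = (fps_deriv ^^ m) F - (fps_deriv ^^ m) G" for m and F G :: "'k fps"
    by (induction m) auto
  have ID: "(fps_deriv ^^ m) ((?I ^^ m) F) = F" for m F
  proof (induction m arbitrary: F)
    case (Suc m)
    have "(fps_deriv ^^ Suc m) ((?I ^^ Suc m) F) = (fps_deriv ^^ m) (fps_deriv (?I ((?I ^^ m) F)))"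
      by (simp add: funpow_swap1)
    thus ?case by (simp add: fps_deriv_fps_integral Suc)
  qed simp
  have L_diff: "L (F - G) = L F - L G" for F G
    by (simp add: L_def D_diff I_diff[symmetric] right_diff_distrib[symmetric] sum_subtractf[symmetric])
       (simp add: right_diff_distrib)
  have L_bound: "gauss_bound v s (\<theta> * C) (L F)" if F: "gauss_bound v s C F" for C F
  proof -
    have C: "0 \<le> C" by (rule gauss_bound_nonneg[OF F])
    have "gauss_bound v s (\<theta> * C * (v (coeff P k) / s ^ k)) (- (taylor \<delta> (coeff P i) * (fps_deriv ^^ i) F))"
      if i: "i \<in> A" for i
    proof (rule gauss_bound_uminus, rule gauss_bound_mono[OF \<tau>[OF gauss_bound_deriv_pow[OF spos F]]])
      have "v (coeff P i) / s ^ i = ratio i * (v (coeff P k) / s ^ k)"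
        using vk spos by (simp add: ratio_def)
      also have "\<dots> \<le> \<theta> * (v (coeff P k) / s ^ k)"
        using \<theta>_ge[OF i] vk spos by (intro mult_right_mono) auto
      finally have "v (coeff P i) / s ^ i * C \<le> \<theta> * (v (coeff P k) / s ^ k) * C"
        using C by (rule mult_right_mono)
      thus "v (coeff P i) * (C / s ^ i) \<le> \<theta> * C * (v (coeff P k) / s ^ k)" by (simp add: mult_ac)
    qed
    hence "gauss_bound v s (\<theta> * C * (v (coeff P k) / s ^ k)) (\<Sum>i\<in>A. - (taylor \<delta> (coeff P i) * (fps_deriv ^^ i) F))"
      using spos \<theta>0 C vk by (intro gauss_bound_sum) auto
    from gauss_bound_integral_pow[OF spos \<tau>[OF this], of "1 / coeff P k" k]
    show ?thesis unfolding L_def using vk spos by (simp add: v_divide)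
  qed
  have "gauss_bound v s C0 G" using gauss_bound_antimono[OF spos _ s0(2)] s by simp
  hence "gauss_bound v s (v (1 / coeff P k) * C0 * s ^ k) H"
    unfolding H_def by (intro gauss_bound_integral_pow \<tau> spos)
  then obtain F where F: "gauss_bound v s (v (1 / coeff P k) * C0 * s ^ k) F" "F = H + L F"
    using gauss_contraction_fixpoint[of s \<theta> L] spos \<theta>0 \<theta>1 L_diff L_bound by blast
  \<comment> \<open>Only differentiation after integration is the identity, and this is the order
    needed: the fixed point equation is differentiated \<open>k\<close> times to recover the
    original one.\<close>
  have "(fps_deriv ^^ k) F = (fps_deriv ^^ k) H + (fps_deriv ^^ k) (L F)"
    using F(2) D_diff[of k F "L F"] by (metis add_diff_cancel_right' diff_add_cancel)
  also have "\<dots> = taylor \<delta> (1 / coeff P k) * (G - (\<Sum>i\<in>A. taylor \<delta> (coeff P i) * (fps_deriv ^^ i) F))"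
    by (simp add: H_def L_def ID sum_negf algebra_simps)
  finally have Dk: "(fps_deriv ^^ k) F =
    taylor \<delta> (1 / coeff P k) * (G - (\<Sum>i\<in>A. taylor \<delta> (coeff P i) * (fps_deriv ^^ i) F))" .
  have inv: "taylor \<delta> (coeff P k) * (taylor \<delta> (1 / coeff P k) * X) = X" for X
    using k by (simp add: taylor_one mult.assoc[symmetric] taylor_mult[symmetric])
  have "k \<le> ?n" using k by (rule le_degree)
  hence "fps_act P F = taylor \<delta> (coeff P k) * (fps_deriv ^^ k) F
      + (\<Sum>i\<in>A. taylor \<delta> (coeff P i) * (fps_deriv ^^ i) F)"
    unfolding twisted_act_def A_def by (subst sum.remove[of _ k]) auto
  also have "\<dots> = G" by (simp add: Dk inv)
  finally have "fps_act P F = G" .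
  moreover have "F \<in> fps_overconv v t" using F(1) s fps_overconv_iff by blast
  ultimately show ?thesis using that by blast
qed

end

section \<open>Finite-dimensional differential modules\<close>

lemma twisted_ring_simps [simp]:
  "carrier (twisted_ring \<delta>) = UNIV" "zero (twisted_ring \<delta>) = 0" "one (twisted_ring \<delta>) = 1"
  "add (twisted_ring \<delta>) = (+)" "mult (twisted_ring \<delta>) = twisted_act Polynomial.smult (T_mult \<delta>)"
  by (simp_all add: twisted_ring_def)

definition adjoin :: "('k::field_char_0 poly, 'b, 'm) module_scheme \<Rightarrow> 'b set \<Rightarrow> 'b \<Rightarrow> 'b set" where
  "adjoin M W e = {w \<oplus>\<^bsub>M\<^esub> [:c:] \<odot>\<^bsub>M\<^esub> e | w c. w \<in> W}"

definition subspace_of :: "('k::field_char_0 poly, 'b, 'm) module_scheme \<Rightarrow> 'b set \<Rightarrow> bool" where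
  "subspace_of M W \<longleftrightarrow> W \<subseteq> carrier M \<and> \<zero>\<^bsub>M\<^esub> \<in> W \<and>
     (\<forall>x\<in>W. \<forall>y\<in>W. x \<oplus>\<^bsub>M\<^esub> y \<in> W) \<and> (\<forall>c. \<forall>x\<in>W. [:c:] \<odot>\<^bsub>M\<^esub> x \<in> W)"

text \<open>Adjoining one vector at a time turns finite dimension into an induction principle; rank,
  completeness and the existence of norms are all proved along it.\<close>

inductive fin_span :: "('k::field_char_0 poly, 'b, 'm) module_scheme \<Rightarrow> 'b set \<Rightarrow> bool" for M where
  zero: "fin_span M {\<zero>\<^bsub>M\<^esub>}"
| adjoin: "fin_span M W \<Longrightarrow> e \<in> carrier M \<Longrightarrow> fin_span M (adjoin M W e)"

locale diff_module = residue_char_0_diff_field v \<delta> + left_module "twisted_ring \<delta>" M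
  for v :: "'k::field_char_0 \<Rightarrow> real" and \<delta> :: "'k \<Rightarrow> 'k"
    and M :: "('k poly, 'b, 'm) module_scheme" (structure)
begin

abbreviation act (infixr \<open>\<cdot>\<close> 75) where "p \<cdot> x \<equiv> p \<odot>\<^bsub>M\<^esub> x"
abbreviation T where "T x \<equiv> [:0, 1:] \<odot>\<^bsub>M\<^esub> x"

lemma act_closed [simp, intro]: "x \<in> carrier M \<Longrightarrow> p \<cdot> x \<in> carrier M"
  using smult_closed by simp

lemma act_add_left: "x \<in> carrier M \<Longrightarrow> (p + q) \<cdot> x = p \<cdot> x \<oplus> q \<cdot> x"
  using smult_l_distr[of p q x] by simp

lemma act_add_right: "x \<in> carrier M \<Longrightarrow> y \<in> carrier M \<Longrightarrow> p \<cdot> (x \<oplus> y) = p \<cdot> x \<oplus> p \<cdot> y"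
  using smult_r_distr[of p x y] by simp

lemma act_mult: "x \<in> carrier M \<Longrightarrow> twisted_act Polynomial.smult (T_mult \<delta>) p q \<cdot> x = p \<cdot> (q \<cdot> x)"
  using smult_assoc[of p q x] by simp

lemma act_1 [simp]: "x \<in> carrier M \<Longrightarrow> 1 \<cdot> x = x"
  using smult_one by simp

lemma act_0_left [simp]: "x \<in> carrier M \<Longrightarrow> 0 \<cdot> x = \<zero>"
  using act_add_left[of x 0 0] by (simp add: M.add.r_cancel_one')

lemma act_0_right [simp]: "p \<cdot> \<zero> = \<zero>"
  using act_add_right[of \<zero> \<zero> p] by (simp add: M.add.r_cancel_one')

lemma act_uminus_left: "x \<in> carrier M \<Longrightarrow> (- p) \<cdot> x = \<ominus>\<^bsub>M\<^esub> (p \<cdot> x)"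
  using act_add_left[of x "- p" p] by (simp add: M.minus_equality)

lemma act_uminus_right: "x \<in> carrier M \<Longrightarrow> p \<cdot> (\<ominus>\<^bsub>M\<^esub> x) = \<ominus>\<^bsub>M\<^esub> (p \<cdot> x)"
  using act_add_right[of "\<ominus>\<^bsub>M\<^esub> x" x p] by (simp add: M.minus_equality M.l_neg)

lemma act_diff_left: "x \<in> carrier M \<Longrightarrow> (p - q) \<cdot> x = p \<cdot> x \<ominus> q \<cdot> x"
  using act_add_left[of x p "- q"] by (simp add: act_uminus_left M.minus_eq)

lemma act_diff_right: "x \<in> carrier M \<Longrightarrow> y \<in> carrier M \<Longrightarrow> p \<cdot> (x \<ominus> y) = p \<cdot> x \<ominus> p \<cdot> y"
  by (simp add: act_add_right act_uminus_right M.minus_eq)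

lemma twisted_const_mult: "twisted_act Polynomial.smult (T_mult \<delta>) [:a:] q = Polynomial.smult a q"
  by (simp add: twisted_act_def)

lemma smult_act: "x \<in> carrier M \<Longrightarrow> Polynomial.smult a p \<cdot> x = [:a:] \<cdot> p \<cdot> x"
  using act_mult[of x "[:a:]" p] by (simp add: twisted_const_mult)

lemma sc_sc: "x \<in> carrier M \<Longrightarrow> [:a:] \<cdot> [:b:] \<cdot> x = [:a * b:] \<cdot> x"
  using smult_act[of x a "[:b:]"] by simp

lemma sc_1 [simp]: "x \<in> carrier M \<Longrightarrow> [:1:] \<cdot> x = x"
  by (simp flip: one_pCons)

lemma sc_add: "x \<in> carrier M \<Longrightarrow> [:a + b:] \<cdot> x = [:a:] \<cdot> x \<oplus> [:b:] \<cdot> x"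
  using act_add_left[of x "[:a:]" "[:b:]"] by simp

lemma sc_diff: "x \<in> carrier M \<Longrightarrow> [:a - b:] \<cdot> x = [:a:] \<cdot> x \<ominus> [:b:] \<cdot> x"
  using act_diff_left[of x "[:a:]" "[:b:]"] by simp

lemma T_sc: "x \<in> carrier M \<Longrightarrow> T ([:a:] \<cdot> x) = [:a:] \<cdot> T x \<oplus> [:\<delta> a:] \<cdot> x"
proof -
  assume x: "x \<in> carrier M"
  have "T ([:a:] \<cdot> x) = ([:0, a:] + [:\<delta> a:]) \<cdot> x"
    using act_mult[OF x, of "[:0, 1:]" "[:a:]"] by (simp add: T_mult_right)
  also have "\<dots> = Polynomial.smult a [:0, 1:] \<cdot> x \<oplus> [:\<delta> a:] \<cdot> x"
    by (subst act_add_left[OF x]) simp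
  finally show ?thesis by (simp only: smult_act[OF x])
qed

text \<open>Coefficients stand on the left, so a factor \<open>T\<close> on the right is only a
  shift. This gives \<open>pCons_act\<close>, where \<open>T\<close> is applied to the vector first,
  and with it induction on polynomials with the vector generalised.\<close>

lemma twisted_mult_T: "twisted_act Polynomial.smult (T_mult \<delta>) p [:0, 1:] = pCons 0 p"
proof -
  have "(T_mult \<delta> ^^ i) [:0, 1:] = monom 1 (Suc i)" for i
    using Lpow_T[of "Suc i"] Lpow_T[of 1] by (simp add: funpow_swap1 monom_Suc flip: one_pCons)
  hence "twisted_act Polynomial.smult (T_mult \<delta>) p [:0, 1:]
      = pCons 0 (\<Sum>i\<le>degree p. monom (coeff p i) i)"
    by (simp add: twisted_act_def smult_monom monom_Suc)
       (simp add: poly_eq_iff coeff_sum coeff_pCons split: nat.split)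
  thus ?thesis by (simp add: poly_as_sum_of_monoms)
qed

lemma pCons_act: "x \<in> carrier M \<Longrightarrow> pCons c p \<cdot> x = [:c:] \<cdot> x \<oplus> p \<cdot> T x"
proof -
  assume x: "x \<in> carrier M"
  have "pCons c p = [:c:] + pCons 0 p" by simp
  also have "\<dots> \<cdot> x = [:c:] \<cdot> x \<oplus> pCons 0 p \<cdot> x" by (rule act_add_left[OF x])
  also have "pCons 0 p \<cdot> x = p \<cdot> T x" using act_mult[OF x, of p "[:0, 1:]"] by (simp add: twisted_mult_T)
  finally show ?thesis .
qed

lemma T_add: "x \<in> carrier M \<Longrightarrow> y \<in> carrier M \<Longrightarrow> T (x \<oplus> y) = T x \<oplus> T y"
  by (rule act_add_right)

lemma Tpow_closed: "x \<in> carrier M \<Longrightarrow> ((\<lambda>x. T x) ^^ i) x \<in> carrier M"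
  by (induction i) auto

lemma neg_zero: "\<ominus> \<zero> = \<zero>"
  by (rule M.minus_equality) simp_all

lemma neg_cancel3:
  assumes "x \<in> carrier M" "y \<in> carrier M" "z \<in> carrier M"
  shows "x \<oplus> (y \<oplus> (\<ominus> x \<oplus> z)) = y \<oplus> z" "x \<oplus> (y \<oplus> \<ominus> x) = y"
  using assms M.a_lcomm[of x y "\<ominus> x \<oplus> z"] M.a_lcomm[of x y "\<ominus> x"] by (simp_all add: M.r_neg2 M.r_neg)

lemmas group_simps = neg_cancel3 neg_zero M.minus_eq M.minus_add M.minus_minus M.a_ac M.r_neg M.l_neg M.r_neg1 M.r_neg2

section \<open>Linear subspaces over the base field\<close>

lemma subspaceD:
  assumes "subspace_of M W"
  shows "W \<subseteq> carrier M" "\<zero> \<in> W" "x \<in> W \<Longrightarrow> y \<in> W \<Longrightarrow> x \<oplus> y \<in> W" "x \<in> W \<Longrightarrow> [:c:] \<cdot> x \<in> W"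
    "x \<in> W \<Longrightarrow> \<ominus>\<^bsub>M\<^esub> x \<in> W" "x \<in> W \<Longrightarrow> y \<in> W \<Longrightarrow> x \<ominus> y \<in> W"
proof -
  show 1: "W \<subseteq> carrier M" "\<zero> \<in> W" "x \<in> W \<Longrightarrow> y \<in> W \<Longrightarrow> x \<oplus> y \<in> W"
      "x \<in> W \<Longrightarrow> [:c:] \<cdot> x \<in> W" for x y c
    using assms by (auto simp: subspace_of_def)
  show neg: "\<ominus>\<^bsub>M\<^esub> x \<in> W" if "x \<in> W" for x
    using 1(4)[OF that, of "- 1"] act_uminus_left[of x "[:1:]"] 1(1) that by auto
  show "x \<in> W \<Longrightarrow> y \<in> W \<Longrightarrow> x \<ominus> y \<in> W"
    using 1(3) neg by (simp add: M.minus_eq)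
qed

lemma subspace_carrier: "subspace_of M (carrier M)"
  by (auto simp: subspace_of_def)

lemma subspace_zero: "subspace_of M {\<zero>}"
  by (auto simp: subspace_of_def)

lemma subspace_Int: "subspace_of M U \<Longrightarrow> subspace_of M W \<Longrightarrow> subspace_of M (U \<inter> W)"
  by (auto simp: subspace_of_def)

lemma subspace_adjoin:
  assumes W: "subspace_of M W" and e: "e \<in> carrier M"
  shows "subspace_of M (adjoin M W e)"
  unfolding subspace_of_def
proof (intro conjI ballI allI)
  note WD = subspaceD[OF W]
  show "adjoin M W e \<subseteq> carrier M" using WD(1) e by (auto simp: adjoin_def)
  show "\<zero> \<in> adjoin M W e"
    unfolding adjoin_def using WD(2) e by (auto intro!: exI[of _ \<zero>] exI[of _ 0])
  fix x assume "x \<in> adjoin M W e"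
  then obtain w c where x: "w \<in> W" "x = w \<oplus> [:c:] \<cdot> e" by (auto simp: adjoin_def)
  have wM: "w \<in> carrier M" using x WD by auto
  {
    fix y assume "y \<in> adjoin M W e"
    then obtain w' c' where y: "w' \<in> W" "y = w' \<oplus> [:c':] \<cdot> e" by (auto simp: adjoin_def)
    have "w' \<in> carrier M" using y WD by auto
    hence "x \<oplus> y = (w \<oplus> w') \<oplus> [:c + c':] \<cdot> e"
      unfolding x y using wM e by (simp add: sc_add M.a_ac)
    thus "x \<oplus> y \<in> adjoin M W e" unfolding adjoin_def using WD(3)[OF x(1) y(1)] by blast
  }
  fix d
  have "[:d:] \<cdot> x = [:d:] \<cdot> w \<oplus> [:d * c:] \<cdot> e"
    unfolding x using wM e by (simp add: act_add_right sc_sc)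
  thus "[:d:] \<cdot> x \<in> adjoin M W e" unfolding adjoin_def using WD(4)[OF x(1)] by blast
qed

lemma adjoin_superset: "subspace_of M W \<Longrightarrow> e \<in> carrier M \<Longrightarrow> W \<subseteq> adjoin M W e"
proof
  fix w assume "subspace_of M W" "e \<in> carrier M" "w \<in> W"
  hence "w = w \<oplus> [:0:] \<cdot> e" using subspaceD(1) by fastforce
  thus "w \<in> adjoin M W e" using \<open>w \<in> W\<close> unfolding adjoin_def by blast
qed

lemma adjoin_self: "subspace_of M W \<Longrightarrow> e \<in> carrier M \<Longrightarrow> e \<in> adjoin M W e"
proof -
  assume "subspace_of M W" "e \<in> carrier M"
  hence "e = \<zero> \<oplus> [:1:] \<cdot> e" "\<zero> \<in> W" using subspaceD(2) by auto
  thus ?thesis unfolding adjoin_def by blast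
qed

lemma adjoin_absorb: "subspace_of M W \<Longrightarrow> e \<in> W \<Longrightarrow> adjoin M W e = W"
proof (rule equalityI)
  assume W: "subspace_of M W" "e \<in> W"
  thus "W \<subseteq> adjoin M W e" using adjoin_superset subspaceD(1) by blast
  show "adjoin M W e \<subseteq> W" unfolding adjoin_def using subspaceD(3,4)[OF W(1)] W(2) by auto
qed

lemma fin_span_subspace: "fin_span M W \<Longrightarrow> subspace_of M W"
  by (induction rule: fin_span.induct) (auto intro: subspace_adjoin subspace_zero)

text \<open>Since \<open>adjoin M W e = W\<close> for \<open>e \<in> W\<close>, only proper extensions matter.\<close>

lemma fin_span_strict_induct [consumes 1, case_names zero adjoin]:
  assumes "fin_span M W" "P {\<zero>}"
    and "\<And>W e. fin_span M W \<Longrightarrow> subspace_of M W \<Longrightarrow> P W \<Longrightarrow> e \<in> carrier M \<Longrightarrow> e \<notin> W \<Longrightarrow> P (adjoin M W e)"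
  shows "P W"
  using assms(1)
proof induction
  case (adjoin W e)
  show ?case
  proof (cases "e \<in> W")
    case True
    thus ?thesis using adjoin adjoin_absorb fin_span_subspace by simp
  next
    case False
    thus ?thesis using adjoin assms(3) fin_span_subspace by simp
  qed
qed fact

lemma adjoin_unique:
  assumes W: "subspace_of M W" and e: "e \<in> carrier M" "e \<notin> W"
    and w: "w \<in> W" "w' \<in> W" and eq: "w \<oplus> [:c:] \<cdot> e = w' \<oplus> [:c':] \<cdot> e"
  shows "w = w' \<and> c = c'"
proof -
  have wM: "w \<in> carrier M" "w' \<in> carrier M" using w subspaceD(1)[OF W] by auto
  have "[:c - c':] \<cdot> e = w' \<ominus> w"
  proof -
    have "[:c - c':] \<cdot> e = (w \<oplus> [:c:] \<cdot> e) \<ominus> w \<ominus> [:c':] \<cdot> e"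
      using e wM by (simp add: sc_diff M.minus_eq M.a_ac M.r_neg2 M.r_neg1)
    also have "\<dots> = (w' \<oplus> [:c':] \<cdot> e) \<ominus> w \<ominus> [:c':] \<cdot> e" by (simp only: eq)
    also have "\<dots> = w' \<ominus> w"
      using e wM by (simp add: M.minus_eq M.a_ac M.r_neg)
    finally show ?thesis .
  qed
  hence in_W: "[:c - c':] \<cdot> e \<in> W" using subspaceD(6)[OF W] w by simp
  have "c = c'"
  proof (rule ccontr)
    assume "c \<noteq> c'"
    hence "[:1 / (c - c'):] \<cdot> [:c - c':] \<cdot> e = e" using e by (simp add: sc_sc)
    thus False using subspaceD(4)[OF W in_W] e(2) by metis
  qed
  thus ?thesis using eq e wM by (simp add: M.add.right_cancel)
qed

end

section \<open>Chain conditions and functionals in finite dimension\<close>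

locale fd_diff_module = diff_module +
  assumes fin_span_carrier: "fin_span M (carrier M)"
begin

text \<open>A strictly increasing rank replaces dimension and bounds the length of chains. Adjoining
  \<open>e\<close> adds \<open>1\<close> exactly for the subspaces that leave \<open>W\<close>. This
  detects a proper inclusion of \<open>U\<close> in \<open>U'\<close> with equal traces on
  \<open>W\<close>: if \<open>U\<close> already had a vector outside \<open>W\<close>, a multiple of
  it would move any vector of \<open>U'\<close> into \<open>W\<close>, and so into
  \<open>U\<close>.\<close>

lemma fin_span_rank:
  "fin_span M W \<Longrightarrow> \<exists>f. \<forall>U U'. subspace_of M U \<longrightarrow> subspace_of M U' \<longrightarrow> U \<subset> U' \<longrightarrow> U' \<subseteq> W \<longrightarrow> f U < (f U' :: nat)"
proof (induction rule: fin_span_strict_induct)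
  case zero
  have "\<not> U \<subset> U'" if "subspace_of M U" "U' \<subseteq> {\<zero>}" for U U'
    using that subspaceD(2) by fastforce
  thus ?case by blast
next
  case (adjoin W e)
  obtain f where f: "\<And>U U'. subspace_of M U \<Longrightarrow> subspace_of M U' \<Longrightarrow> U \<subset> U' \<Longrightarrow> U' \<subseteq> W \<Longrightarrow> f U < (f U' :: nat)"
    using adjoin.IH by blast
  define g where "g U = f (U \<inter> W) + (if U \<subseteq> W then 0 else 1)" for U
  have "g U < g U'" if U: "subspace_of M U" "subspace_of M U'" "U \<subset> U'" "U' \<subseteq> adjoin M W e" for U U'
  proof (cases "U \<inter> W = U' \<inter> W")
    case False
    hence "f (U \<inter> W) < f (U' \<inter> W)" using f[of "U \<inter> W" "U' \<inter> W"] U adjoin.hyps(2) subspace_Int by auto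
    thus ?thesis using U(3) by (auto simp: g_def)
  next
    case True
    have "\<not> U' \<subseteq> W" using True U(3) by auto
    moreover have "U \<subseteq> W"
    proof (rule ccontr)
      assume "\<not> U \<subseteq> W"
      then obtain u where u: "u \<in> U" "u \<notin> W" by blast
      obtain u' where u': "u' \<in> U'" "u' \<notin> U" using U(3) by blast
      obtain w c where w: "w \<in> W" "u = w \<oplus> [:c:] \<cdot> e" using u U by (fastforce simp: adjoin_def)
      obtain w' c' where w': "w' \<in> W" "u' = w' \<oplus> [:c':] \<cdot> e" using u' U by (fastforce simp: adjoin_def)
      note WD = subspaceD[OF adjoin.hyps(2)]
      have wM: "w \<in> carrier M" "w' \<in> carrier M" "e \<in> carrier M" using w w' WD adjoin by auto
      have "c \<noteq> 0" using u w wM by auto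
      \<comment> \<open>Chosen so that the components along \<open>e\<close> cancel in
        \<open>u' \<ominus> [:?d:] \<cdot> u\<close>.\<close>
      let ?d = "c' / c"
      have "[:?d:] \<cdot> u = [:?d:] \<cdot> w \<oplus> [:c':] \<cdot> e"
        using w wM \<open>c \<noteq> 0\<close> by (simp add: act_add_right sc_sc)
      hence "u' \<ominus> [:?d:] \<cdot> u = w' \<ominus> [:?d:] \<cdot> w"
        using w' wM by (simp add: M.minus_eq M.minus_add M.a_ac M.r_neg M.r_neg1 M.r_neg2)
      hence "u' \<ominus> [:?d:] \<cdot> u \<in> W" using WD(6)[OF w'(1) WD(4)[OF w(1)]] by simp
      moreover have "u' \<ominus> [:?d:] \<cdot> u \<in> U'"
        using U(3) u by (intro subspaceD(6)[OF U(2) u'(1)] subspaceD(4)[OF U(2)]) blast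
      ultimately have "u' \<ominus> [:?d:] \<cdot> u \<in> U" using True by blast
      hence "(u' \<ominus> [:?d:] \<cdot> u) \<oplus> [:?d:] \<cdot> u \<in> U" using subspaceD(3,4)[OF U(1)] u by blast
      moreover have "(u' \<ominus> [:?d:] \<cdot> u) \<oplus> [:?d:] \<cdot> u = u'"
      proof -
        have "u \<in> carrier M" "u' \<in> carrier M"
          using u u' subspaceD(1)[OF U(1)] subspaceD(1)[OF U(2)] by blast+
        thus ?thesis by (simp add: M.minus_eq M.a_assoc M.l_neg)
      qed
      ultimately show False using u' by simp
    qed
    ultimately show ?thesis using True by (simp add: g_def)
  qed
  thus ?case by (intro exI[of _ g]) simp
qed

text \<open>Ranks are bounded by the rank of the whole module, so one of greatest rank exists among
  the subspaces with \<open>Q\<close>. The predicate is arbitrary because it will also mean being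
  the domain of an extension, or having a composition series.\<close>

lemma maximal_subspace:
  assumes "Q U0" "\<And>U. Q U \<Longrightarrow> subspace_of M U"
  obtains U where "Q U" "\<And>U'. Q U' \<Longrightarrow> U \<subseteq> U' \<Longrightarrow> U' = U"
proof -
  obtain f where f: "\<And>U U'. subspace_of M U \<Longrightarrow> subspace_of M U' \<Longrightarrow> U \<subset> U' \<Longrightarrow> U' \<subseteq> carrier M \<Longrightarrow> f U < (f U' :: nat)"
    using fin_span_rank[OF fin_span_carrier] by blast
  have "f U \<le> f (carrier M)" if "Q U" for U
    using f[OF assms(2)[OF that] subspace_carrier] subspaceD(1)[OF assms(2)[OF that]]
    by (cases "U = carrier M") (auto simp: psubset_eq)
  then obtain U where U: "Q U" "\<And>U'. Q U' \<Longrightarrow> f U' \<le> f U"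
    using ex_has_greatest_nat[of Q U0 f "Suc (f (carrier M))"] assms(1) by (metis le_imp_less_Suc)
  show ?thesis
  proof (rule that[OF U(1)])
    fix U' assume U': "Q U'" "U \<subseteq> U'"
    show "U' = U"
    proof (rule ccontr)
      assume "U' \<noteq> U"
      hence "f U < f U'"
        using U'(2) by (intro f assms(2) U U'(1) subspaceD(1)) auto
      with U(2)[OF U'(1)] show False by simp
    qed
  qed
qed

lemma minimal_subspace:
  assumes "Q U0" "\<And>U. Q U \<Longrightarrow> subspace_of M U"
  obtains U where "Q U" "\<And>U'. Q U' \<Longrightarrow> U' \<subseteq> U \<Longrightarrow> U' = U"
proof -
  obtain f where f: "\<And>U U'. subspace_of M U \<Longrightarrow> subspace_of M U' \<Longrightarrow> U \<subset> U' \<Longrightarrow> U' \<subseteq> carrier M \<Longrightarrow> f U < (f U' :: nat)"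
    using fin_span_rank[OF fin_span_carrier] by blast
  obtain U where U: "Q U" "\<And>U'. Q U' \<Longrightarrow> f U \<le> f U'"
    using ex_has_least_nat[of Q U0 f] assms(1) by blast
  show ?thesis
  proof (rule that[OF U(1)])
    fix U' assume U': "Q U'" "U' \<subseteq> U"
    show "U' = U"
    proof (rule ccontr)
      assume "U' \<noteq> U"
      hence "f U' < f U"
        using U'(2) by (intro f assms(2) U U'(1) subspaceD(1)) auto
      with U(2)[OF U'(1)] show False by simp
    qed
  qed
qed

text \<open>A subspace maximal among those containing \<open>W\<close> but not \<open>x\<close> is a hyperplane.\<close>

lemma separating_functional:
  assumes W: "subspace_of M W" and x: "x \<in> carrier M" "x \<notin> W"
  obtains \<phi> where "\<And>w. w \<in> W \<Longrightarrow> \<phi> w = (0::'a)" "\<phi> x = 1"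
    "\<And>y z. y \<in> carrier M \<Longrightarrow> z \<in> carrier M \<Longrightarrow> \<phi> (y \<oplus> z) = \<phi> y + \<phi> z"
    "\<And>c y. y \<in> carrier M \<Longrightarrow> \<phi> ([:c:] \<cdot> y) = c * \<phi> y"
proof -
  obtain H where H: "subspace_of M H" "W \<subseteq> H" "x \<notin> H"
    and max: "\<And>U. subspace_of M U \<Longrightarrow> W \<subseteq> U \<Longrightarrow> x \<notin> U \<Longrightarrow> H \<subseteq> U \<Longrightarrow> U = H"
    by (rule maximal_subspace[of "\<lambda>U. subspace_of M U \<and> W \<subseteq> U \<and> x \<notin> U" W]) (use W x in auto)
  note HD = subspaceD[OF H(1)]
  have decomp: "\<exists>h c. h \<in> H \<and> y = h \<oplus> [:c:] \<cdot> x" if y: "y \<in> carrier M" for y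
  proof (cases "y \<in> H")
    case True
    hence "y = y \<oplus> [:0:] \<cdot> x" using x y by simp
    thus ?thesis using True by blast
  next
    case False
    \<comment> \<open>Enlarging \<open>H\<close> by \<open>y\<close> must break one of the
      conditions on \<open>H\<close>, and only \<open>x\<close> entering is possible. Solving for
      \<open>y\<close> needs \<open>c\<close> nonzero, which holds as \<open>x\<close> is outside
      \<open>H\<close>.\<close>
    have "adjoin M H y \<noteq> H" using adjoin_self[OF H(1) y] False by blast
    hence "x \<in> adjoin M H y"
      using max[OF subspace_adjoin[OF H(1) y]] adjoin_superset[OF H(1) y] H(2) by blast
    then obtain h c where h: "h \<in> H" "x = h \<oplus> [:c:] \<cdot> y" by (auto simp: adjoin_def)
    have hM: "h \<in> carrier M" using h HD by auto
    have "c \<noteq> 0" using h H(3) hM y by auto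
    have "[:1 / c:] \<cdot> x = [:1 / c:] \<cdot> h \<oplus> y"
      unfolding h(2) using hM y \<open>c \<noteq> 0\<close> by (simp add: act_add_right sc_sc)
    hence "y = \<ominus>\<^bsub>M\<^esub> ([:1 / c:] \<cdot> h) \<oplus> [:1 / c:] \<cdot> x"
      using hM y by (simp add: M.r_neg2 M.r_neg1)
    moreover have "\<ominus>\<^bsub>M\<^esub> ([:1 / c:] \<cdot> h) \<in> H" using HD(4,5) h by blast
    ultimately show ?thesis by blast
  qed
  define \<phi> where "\<phi> y = (THE c. \<exists>h\<in>H. y = h \<oplus> [:c:] \<cdot> x)" for y
  have \<phi>: "\<phi> (h \<oplus> [:c:] \<cdot> x) = c" if "h \<in> H" for h c
    unfolding \<phi>_def
    by (rule the_equality) (use that adjoin_unique[OF H(1) x(1) H(3)] in blast)+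
  show ?thesis
  proof (rule that)
    show "\<phi> w = 0" if "w \<in> W" for w
    proof -
      have "w = w \<oplus> [:0:] \<cdot> x" using that x subspaceD(1)[OF W] by auto
      thus ?thesis using \<phi>[of w 0] that H(2) by auto
    qed
    have "x = \<zero> \<oplus> [:1:] \<cdot> x" using x by simp
    thus "\<phi> x = 1" using \<phi>[OF HD(2)] by metis
  next
    fix y z assume yz: "y \<in> carrier M" "z \<in> carrier M"
    obtain h c where y: "h \<in> H" "y = h \<oplus> [:c:] \<cdot> x" using decomp yz by blast
    obtain h' c' where z: "h' \<in> H" "z = h' \<oplus> [:c':] \<cdot> x" using decomp yz by blast
    have "y \<oplus> z = (h \<oplus> h') \<oplus> [:c + c':] \<cdot> x"
      unfolding y z using y z x HD(1) by (auto simp: sc_add M.a_ac subset_iff)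
    thus "\<phi> (y \<oplus> z) = \<phi> y + \<phi> z" using \<phi> y z HD(3) by simp
  next
    fix c y assume "y \<in> carrier M"
    then obtain h d where y: "h \<in> H" "y = h \<oplus> [:d:] \<cdot> x" using decomp by blast
    have "[:c:] \<cdot> y = [:c:] \<cdot> h \<oplus> [:c * d:] \<cdot> x"
      unfolding y using y x HD(1) by (auto simp: act_add_right sc_sc subset_iff)
    thus "\<phi> ([:c:] \<cdot> y) = c * \<phi> y" using \<phi> y HD(4) by simp
  qed
qed

end

section \<open>Norms on finite-dimensional modules\<close>

lemma module_normD:
  assumes "module_norm v M \<nu>" "x \<in> carrier M"
  shows "0 \<le> \<nu> x" "\<nu> x = 0 \<longleftrightarrow> x = \<zero>\<^bsub>M\<^esub>" "\<nu> ([:c:] \<odot>\<^bsub>M\<^esub> x) = v c * \<nu> x"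
    "y \<in> carrier M \<Longrightarrow> \<nu> (x \<oplus>\<^bsub>M\<^esub> y) \<le> max (\<nu> x) (\<nu> y)"
  using assms by (auto simp: module_norm_def)

context fd_diff_module
begin

lemma norm_uminus: "module_norm v M \<nu> \<Longrightarrow> x \<in> carrier M \<Longrightarrow> \<nu> (\<ominus>\<^bsub>M\<^esub> x) = \<nu> x"
  using module_normD(3)[of v M \<nu> x "- 1"] act_uminus_left[of x "[:1:]"] by simp

lemma norm_diff:
  "module_norm v M \<nu> \<Longrightarrow> x \<in> carrier M \<Longrightarrow> y \<in> carrier M \<Longrightarrow> \<nu> (x \<ominus> y) \<le> max (\<nu> x) (\<nu> y)"
  using module_normD(4)[of v M \<nu> x "\<ominus>\<^bsub>M\<^esub> y"] by (simp add: norm_uminus M.minus_eq)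

definition norm_complete :: "('b \<Rightarrow> real) \<Rightarrow> 'b set \<Rightarrow> bool" where
  "norm_complete \<nu> W \<longleftrightarrow> (\<forall>w. (\<forall>n. w n \<in> W) \<longrightarrow>
     (\<forall>\<epsilon>>0. \<exists>N. \<forall>m\<ge>N. \<forall>n\<ge>N. \<nu> (w m \<ominus> w n) < \<epsilon>) \<longrightarrow>
     (\<exists>l\<in>W. (\<lambda>n. \<nu> (w n \<ominus> l)) \<longlonglongrightarrow> 0))"

text \<open>A vector at distance \<open>0\<close> from a complete subspace is the limit of a
  sequence in it, so \<open>e\<close> outside \<open>W\<close> has a positive distance
  \<open>d\<close>. Scaling by \<open>c\<close> turns this into a bound of the coordinate along
  \<open>e\<close> by the norm.\<close>

lemma norm_complete_distance:
  assumes \<nu>: "module_norm v M \<nu>" and W: "subspace_of M W" "norm_complete \<nu> W"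
    and e: "e \<in> carrier M" "e \<notin> W"
  obtains d where "d > 0" "\<And>w c. w \<in> W \<Longrightarrow> d * v c \<le> \<nu> (w \<oplus> [:c:] \<cdot> e)"
proof -
  note WD = subspaceD[OF W(1)]
  have "\<exists>d>0. \<forall>w\<in>W. d \<le> \<nu> (w \<oplus> e)"
  proof (rule ccontr)
    assume "\<not> (\<exists>d>0. \<forall>w\<in>W. d \<le> \<nu> (w \<oplus> e))"
    hence "\<exists>w\<in>W. \<nu> (w \<oplus> e) < 1 / real (Suc n)" for n
      by (metis not_le of_nat_0_less_iff zero_less_Suc zero_less_divide_1_iff)
    then obtain w where w: "\<And>n. w n \<in> W" "\<And>n. \<nu> (w n \<oplus> e) < 1 / real (Suc n)" by metis
    have wM: "w n \<in> carrier M" for n using w WD(1) by blast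
    have "\<exists>N. \<forall>m\<ge>N. \<forall>n\<ge>N. \<nu> (w m \<ominus> w n) < \<epsilon>" if \<epsilon>: "\<epsilon> > 0" for \<epsilon>
    proof -
      obtain N where N: "1 / real (Suc N) < \<epsilon>" by (rule nat_approx_posE[OF \<epsilon>])
      have "\<nu> (w m \<ominus> w n) < \<epsilon>" if mn: "m \<ge> N" "n \<ge> N" for m n
      proof -
        \<comment> \<open>\<open>e\<close> cancels, so vectors that nearly attain distance
          \<open>0\<close> form a Cauchy sequence.\<close>
        have "w m \<ominus> w n = (w m \<oplus> e) \<ominus> (w n \<oplus> e)" using wM e by (simp add: group_simps)
        hence "\<nu> (w m \<ominus> w n) \<le> max (\<nu> (w m \<oplus> e)) (\<nu> (w n \<oplus> e))"
          using norm_diff[OF \<nu>] wM e by simp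
        moreover have "\<nu> (w k \<oplus> e) < \<epsilon>" if "k \<ge> N" for k
        proof -
          have "1 / real (Suc k) \<le> 1 / real (Suc N)" using that by (intro divide_left_mono) auto
          thus ?thesis using w(2)[of k] N by linarith
        qed
        ultimately show ?thesis using mn by (smt (verit))
      qed
      thus ?thesis by blast
    qed
    then obtain l where l: "l \<in> W" "(\<lambda>n. \<nu> (w n \<ominus> l)) \<longlonglongrightarrow> 0"
      using W(2) w(1) unfolding norm_complete_def by blast
    have lM: "l \<in> carrier M" using l WD(1) by blast
    have lim: "(\<lambda>n. max (1 / real (Suc n)) (\<nu> (w n \<ominus> l))) \<longlonglongrightarrow> max 0 0"
      by (intro tendsto_max l(2) LIMSEQ_Suc[OF lim_1_over_n])
    have "\<nu> (l \<oplus> e) \<le> max (1 / real (Suc n)) (\<nu> (w n \<ominus> l))" for n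
    proof -
      have "l \<oplus> e = (w n \<oplus> e) \<ominus> (w n \<ominus> l)" using wM[of n] lM e by (simp add: group_simps)
      hence "\<nu> (l \<oplus> e) \<le> max (\<nu> (w n \<oplus> e)) (\<nu> (w n \<ominus> l))"
        using norm_diff[OF \<nu>, of "w n \<oplus> e" "w n \<ominus> l"] wM[of n] e lM by simp
      thus ?thesis using w(2)[of n] by linarith
    qed
    hence "\<nu> (l \<oplus> e) \<le> 0" using LIMSEQ_le_const[OF lim] by auto
    hence "l \<oplus> e = \<zero>" using module_normD(1,2)[OF \<nu>, of "l \<oplus> e"] lM e by auto
    hence "e = \<ominus>\<^bsub>M\<^esub> l" using lM e by (metis M.minus_equality M.minus_minus)
    thus False using WD(5)[OF l(1)] e(2) by simp
  qed
  then obtain d where d: "d > 0" "\<And>w. w \<in> W \<Longrightarrow> d \<le> \<nu> (w \<oplus> e)" by blast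
  have "d * v c \<le> \<nu> (w \<oplus> [:c:] \<cdot> e)" if w: "w \<in> W" for w c
  proof (cases "c = 0")
    case True
    thus ?thesis using module_normD(1)[OF \<nu>, of w] w WD(1) e by auto
  next
    case False
    have wM: "w \<in> carrier M" using w WD by blast
    have "[:c:] \<cdot> ([:1 / c:] \<cdot> w \<oplus> e) = w \<oplus> [:c:] \<cdot> e"
      using False wM e by (simp add: act_add_right sc_sc)
    hence "\<nu> (w \<oplus> [:c:] \<cdot> e) = v c * \<nu> ([:1 / c:] \<cdot> w \<oplus> e)"
      using module_normD(3)[OF \<nu>, of "[:1 / c:] \<cdot> w \<oplus> e" c] wM e by simp
    also have "\<dots> \<ge> v c * d" using d(2)[OF WD(4)[OF w]] abs_nonneg by (intro mult_left_mono) auto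
    finally show ?thesis by (simp add: mult.commute)
  qed
  thus ?thesis using that d(1) by blast
qed

text \<open>By the distance bound the coordinates along \<open>e\<close> of a Cauchy sequence are
  Cauchy in the field, and subtracting that component leaves a Cauchy sequence in
  \<open>W\<close>.\<close>

lemma fin_span_complete:
  assumes \<nu>: "module_norm v M \<nu>"
  shows "fin_span M W \<Longrightarrow> norm_complete \<nu> W"
proof (induction rule: fin_span_strict_induct)
  case zero
  have "w n = \<zero>" if "\<forall>n. w n \<in> {\<zero>}" for w :: "nat \<Rightarrow> 'b" and n using that by simp
  thus ?case
    unfolding norm_complete_def using module_normD(2)[OF \<nu>, of \<zero>] norm_uminus[OF \<nu>, of \<zero>]
    by (auto simp: M.minus_eq)
next
  case (adjoin W e)
  note WD = subspaceD[OF adjoin.hyps(2)] and e = adjoin.hyps(3,4)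
  obtain d where d: "d > 0" "\<And>w c. w \<in> W \<Longrightarrow> d * v c \<le> \<nu> (w \<oplus> [:c:] \<cdot> e)"
    using norm_complete_distance[OF \<nu> adjoin.hyps(2) adjoin.IH e] by blast
  show ?case
    unfolding norm_complete_def
  proof (intro allI impI)
    fix x :: "nat \<Rightarrow> 'b"
    assume x: "\<forall>n. x n \<in> adjoin M W e"
      and Cauchy: "\<forall>\<epsilon>>0. \<exists>N. \<forall>m\<ge>N. \<forall>n\<ge>N. \<nu> (x m \<ominus> x n) < \<epsilon>"
    have "\<exists>w c. w \<in> W \<and> x n = w \<oplus> [:c:] \<cdot> e" for n using x unfolding adjoin_def by blast
    then obtain w c where wc: "\<And>n. w n \<in> W" "\<And>n. x n = w n \<oplus> [:c n:] \<cdot> e" by metis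
    have wM: "w n \<in> carrier M" for n using wc WD(1) by blast
    have split: "x m \<ominus> x n = (w m \<ominus> w n) \<oplus> [:c m - c n:] \<cdot> e" for m n
      unfolding wc using wM[of m] wM[of n] e by (simp add: sc_diff group_simps)
    have c_le: "d * v (c m - c n) \<le> \<nu> (x m \<ominus> x n)" for m n
      unfolding split by (rule d(2)[OF WD(6)[OF wc(1) wc(1)]])
    have w_le: "\<nu> (w m \<ominus> w n) \<le> max (\<nu> (x m \<ominus> x n)) (v (c m - c n) * \<nu> e)" for m n
    proof -
      have "w m \<ominus> w n = (x m \<ominus> x n) \<ominus> [:c m - c n:] \<cdot> e"
        unfolding split using wM[of m] wM[of n] e by (simp add: group_simps)
      moreover have "x m \<ominus> x n \<in> carrier M" using wM[of m] wM[of n] e by (simp add: wc)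
      ultimately show ?thesis
        using norm_diff[OF \<nu>, of "x m \<ominus> x n" "[:c m - c n:] \<cdot> e"] e module_normD(3)[OF \<nu> e(1)] by simp
    qed
    have "\<exists>N. \<forall>m\<ge>N. \<forall>n\<ge>N. v (c m - c n) < \<epsilon>" if \<epsilon>: "\<epsilon> > 0" for \<epsilon>
    proof -
      obtain N where N: "\<forall>m\<ge>N. \<forall>n\<ge>N. \<nu> (x m \<ominus> x n) < d * \<epsilon>"
        using Cauchy mult_pos_pos[OF d(1) \<epsilon>] by blast
      have "v (c m - c n) < \<epsilon>" if "m \<ge> N" "n \<ge> N" for m n
      proof -
        have "d * v (c m - c n) < d * \<epsilon>" using c_le[of m n] N that by (meson le_less_trans)
        thus ?thesis using d(1) by simp
      qed
      thus ?thesis by blast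
    qed
    note c_Cauchy = this
    then obtain c' where c': "(\<lambda>n. v (c n - c')) \<longlonglongrightarrow> 0" using Cauchy_convergent[of c] by blast
    have "\<exists>N. \<forall>m\<ge>N. \<forall>n\<ge>N. \<nu> (w m \<ominus> w n) < \<epsilon>" if \<epsilon>: "\<epsilon> > 0" for \<epsilon>
    proof -
      have "\<nu> e \<ge> 0" using module_normD(1)[OF \<nu> e(1)] .
      hence pos: "\<epsilon> / (\<nu> e + 1) > 0" using \<epsilon> by simp
      obtain N1 where N1: "\<forall>m\<ge>N1. \<forall>n\<ge>N1. \<nu> (x m \<ominus> x n) < \<epsilon>" using Cauchy \<epsilon> by blast
      obtain N2 where N2: "\<forall>m\<ge>N2. \<forall>n\<ge>N2. v (c m - c n) < \<epsilon> / (\<nu> e + 1)" using c_Cauchy[OF pos] by blast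
      have "\<nu> (w m \<ominus> w n) < \<epsilon>" if mn: "m \<ge> max N1 N2" "n \<ge> max N1 N2" for m n
      proof -
        have "v (c m - c n) < \<epsilon> / (\<nu> e + 1)" using N2 mn by simp
        hence "v (c m - c n) * (\<nu> e + 1) < \<epsilon>" using \<open>\<nu> e \<ge> 0\<close> by (simp add: field_simps)
        moreover have "v (c m - c n) * \<nu> e \<le> v (c m - c n) * (\<nu> e + 1)"
          by (intro mult_left_mono abs_nonneg) auto
        moreover have "\<nu> (x m \<ominus> x n) < \<epsilon>" using N1 mn by simp
        ultimately show ?thesis using w_le[of m n] by linarith
      qed
      thus ?thesis by blast
    qed
    then obtain l where l: "l \<in> W" "(\<lambda>n. \<nu> (w n \<ominus> l)) \<longlonglongrightarrow> 0"
      using adjoin.IH wc(1) unfolding norm_complete_def by blast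
    have lM: "l \<in> carrier M" using l WD(1) by blast
    show "\<exists>l\<in>adjoin M W e. (\<lambda>n. \<nu> (x n \<ominus> l)) \<longlonglongrightarrow> 0"
    proof (rule bexI)
      show "l \<oplus> [:c':] \<cdot> e \<in> adjoin M W e" using l unfolding adjoin_def by blast
      have le: "\<nu> (x n \<ominus> (l \<oplus> [:c':] \<cdot> e)) \<le> max (\<nu> (w n \<ominus> l)) (v (c n - c') * \<nu> e)" for n
      proof -
        have "x n \<ominus> (l \<oplus> [:c':] \<cdot> e) = (w n \<ominus> l) \<oplus> [:c n - c':] \<cdot> e"
          unfolding wc using wM[of n] lM e by (simp add: sc_diff group_simps)
        thus ?thesis
          using module_normD(4)[OF \<nu>, of "w n \<ominus> l" "[:c n - c':] \<cdot> e"] wM[of n] lM e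
            module_normD(3)[OF \<nu> e(1)] by simp
      qed
      have "(\<lambda>n. max (\<nu> (w n \<ominus> l)) (v (c n - c') * \<nu> e)) \<longlonglongrightarrow> max 0 (0 * \<nu> e)"
        by (intro tendsto_intros l(2) c')
      hence lim: "(\<lambda>n. max (\<nu> (w n \<ominus> l)) (v (c n - c') * \<nu> e)) \<longlonglongrightarrow> 0" by simp
      have ge: "0 \<le> \<nu> (x n \<ominus> (l \<oplus> [:c':] \<cdot> e))" for n
        using module_normD(1)[OF \<nu>] wM[of n] lM e by (simp add: wc)
      show "(\<lambda>n. \<nu> (x n \<ominus> (l \<oplus> [:c':] \<cdot> e))) \<longlonglongrightarrow> 0"
        by (rule tendsto_sandwich[OF always_eventually[OF allI[OF ge]] always_eventually[OF allI[OF le]] tendsto_const lim])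
    qed
  qed
qed

text \<open>This contains the equivalence of norms and the boundedness of linear functionals and of \<open>T\<close>.\<close>

lemma norm_dominates:
  assumes \<nu>: "module_norm v M \<nu>"
    and add: "\<And>x y. x \<in> carrier M \<Longrightarrow> y \<in> carrier M \<Longrightarrow> \<phi> (x \<oplus> y) \<le> max (\<phi> x) (\<phi> y)"
    and sc: "\<And>x. x \<in> carrier M \<Longrightarrow> \<exists>K. \<forall>c. \<phi> ([:c:] \<cdot> x) \<le> v c * K"
  obtains C :: real where "C > 0" "\<And>x. x \<in> carrier M \<Longrightarrow> \<phi> x \<le> C * \<nu> x"
proof -
  have "\<exists>C>0. \<forall>x\<in>W. \<phi> x \<le> C * \<nu> x" if "fin_span M W" for W
    using that
  proof (induction rule: fin_span_strict_induct)
    case zero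
    obtain K where "\<forall>c. \<phi> ([:c:] \<cdot> \<zero>) \<le> v c * K" using sc[of \<zero>] by auto
    from this[rule_format, of 0] have "\<phi> \<zero> \<le> 0" by simp
    moreover have "\<nu> \<zero> = 0" using module_normD(2)[OF \<nu>, of \<zero>] by simp
    ultimately show ?case by (auto intro: exI[of _ 1])
  next
    case (adjoin W e)
    note WD = subspaceD[OF adjoin.hyps(2)] and e = adjoin.hyps(3,4)
    obtain d where d: "d > 0" "\<And>w c. w \<in> W \<Longrightarrow> d * v c \<le> \<nu> (w \<oplus> [:c:] \<cdot> e)"
      using norm_complete_distance[OF \<nu> adjoin.hyps(2) fin_span_complete[OF \<nu> adjoin.hyps(1)] e] by blast
    obtain C where C: "C > 0" "\<And>x. x \<in> W \<Longrightarrow> \<phi> x \<le> C * \<nu> x" using adjoin.IH by blast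
    obtain K where K: "\<And>c. \<phi> ([:c:] \<cdot> e) \<le> v c * K" using sc e by blast
    have \<nu>e: "\<nu> e \<ge> 0" using module_normD(1)[OF \<nu> e(1)] .
    \<comment> \<open>The entries come from the two components of \<open>x\<close>:
      \<open>\<nu> w\<close> is at most \<open>max 1 (\<nu> e / d) * \<nu> x\<close> because
      \<open>v c \<le> \<nu> x / d\<close>, and the component along \<open>e\<close> costs
      \<open>K\<close>, raised to be positive.\<close>
    define D where "D = max (C * max 1 (\<nu> e / d)) (max K 1 / d)"
    have "\<phi> x \<le> D * \<nu> x" if x_in: "x \<in> adjoin M W e" for x
    proof -
      obtain w c where x: "w \<in> W" "x = w \<oplus> [:c:] \<cdot> e" using x_in unfolding adjoin_def by blast
      have wM: "w \<in> carrier M" using x WD(1) by blast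
      have xM: "x \<in> carrier M" using wM e x by simp
      have \<nu>x: "0 \<le> \<nu> x" using module_normD(1)[OF \<nu> xM] .
      have vc: "v c \<le> \<nu> x / d" using d(2)[OF x(1), of c] d(1) x(2) by (simp add: field_simps)
      have "w = x \<ominus> [:c:] \<cdot> e" unfolding x using wM e by (simp add: group_simps)
      hence "\<nu> w \<le> max (\<nu> x) (v c * \<nu> e)"
        using norm_diff[OF \<nu>, of x "[:c:] \<cdot> e"] xM e module_normD(3)[OF \<nu> e(1)] by simp
      also have "\<dots> \<le> max 1 (\<nu> e / d) * \<nu> x"
      proof (rule max.boundedI)
        show "\<nu> x \<le> max 1 (\<nu> e / d) * \<nu> x" using mult_right_mono[OF max.cobounded1[of 1 "\<nu> e / d"] \<nu>x] by simp
        have "v c * \<nu> e \<le> \<nu> x / d * \<nu> e" by (rule mult_right_mono[OF vc \<nu>e])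
        also have "\<dots> = \<nu> e / d * \<nu> x" by simp
        also have "\<dots> \<le> max 1 (\<nu> e / d) * \<nu> x" by (rule mult_right_mono[OF max.cobounded2 \<nu>x])
        finally show "v c * \<nu> e \<le> max 1 (\<nu> e / d) * \<nu> x" .
      qed
      finally have "C * \<nu> w \<le> C * max 1 (\<nu> e / d) * \<nu> x"
        using C(1) mult_left_mono[of "\<nu> w" "max 1 (\<nu> e / d) * \<nu> x" C] by (simp add: mult.assoc)
      also have "\<dots> \<le> D * \<nu> x" unfolding D_def by (rule mult_right_mono[OF max.cobounded1 \<nu>x])
      finally have 1: "\<phi> w \<le> D * \<nu> x" using C(2)[OF x(1)] by simp
      have "v c * K \<le> v c * max K 1" by (intro mult_left_mono abs_nonneg) auto
      also have "\<dots> \<le> \<nu> x / d * max K 1" by (rule mult_right_mono[OF vc]) auto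
      also have "\<dots> = max K 1 / d * \<nu> x" by simp
      also have "\<dots> \<le> D * \<nu> x" unfolding D_def by (rule mult_right_mono[OF max.cobounded2 \<nu>x])
      finally have "v c * K \<le> D * \<nu> x" .
      hence 2: "\<phi> ([:c:] \<cdot> e) \<le> D * \<nu> x" using K[of c] by simp
      show ?thesis using add[of w "[:c:] \<cdot> e"] 1 2 wM e x(2) by simp
    qed
    moreover have "D > 0" using C(1) by (simp add: D_def less_max_iff_disj)
    ultimately show ?case by blast
  qed
  thus ?thesis using that fin_span_carrier by blast
qed

text \<open>The maximum norm in the coordinates given by the successively adjoined vectors;
  \<open>adjoin_unique\<close> makes these coordinates well defined.\<close>

lemma norm_exists: "\<exists>\<nu>. module_norm v M \<nu>"
proof -
  have "\<exists>\<nu>. module_norm v (M\<lparr>carrier := W\<rparr>) \<nu>" if "fin_span M W" for W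
    using that
  proof (induction rule: fin_span_strict_induct)
    case zero
    show ?case by (rule exI[of _ "\<lambda>_. 0"]) (simp add: module_norm_def)
  next
    case (adjoin W e)
    note WD = subspaceD[OF adjoin.hyps(2)] and e = adjoin.hyps(3,4)
    obtain \<nu> where \<nu>: "module_norm v (M\<lparr>carrier := W\<rparr>) \<nu>" using adjoin.IH by blast
    define p where "p x = (THE wc. fst wc \<in> W \<and> x = fst wc \<oplus> [:snd wc:] \<cdot> e)" for x
    have p: "p (w \<oplus> [:c:] \<cdot> e) = (w, c)" if "w \<in> W" for w c
      unfolding p_def
    proof (rule the_equality)
      fix wc assume "fst wc \<in> W \<and> w \<oplus> [:c:] \<cdot> e = fst wc \<oplus> [:snd wc:] \<cdot> e"
      thus "wc = (w, c)"
        using adjoin_unique[OF adjoin.hyps(2) e that, of "fst wc" c "snd wc"] by (simp add: prod_eq_iff)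
    qed (use that in simp)
    define \<mu> where "\<mu> x = max (\<nu> (fst (p x))) (v (snd (p x)))" for x
    have \<mu>: "\<mu> (w \<oplus> [:c:] \<cdot> e) = max (\<nu> w) (v c)" if "w \<in> W" for w c
      using p[OF that] by (simp add: \<mu>_def)
    have N: "0 \<le> \<nu> w" "\<nu> w = 0 \<longleftrightarrow> w = \<zero>" "\<nu> ([:c:] \<cdot> w) = v c * \<nu> w"
      "u \<in> W \<Longrightarrow> \<nu> (w \<oplus> u) \<le> max (\<nu> w) (\<nu> u)" if "w \<in> W" for w u c
      using module_normD[OF \<nu>, of w] that by simp_all
    have "module_norm v (M\<lparr>carrier := adjoin M W e\<rparr>) \<mu>"
      unfolding module_norm_def
    proof (intro conjI ballI allI; simp)
      fix x assume "x \<in> adjoin M W e"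
      then obtain w c where x: "w \<in> W" "x = w \<oplus> [:c:] \<cdot> e" unfolding adjoin_def by blast
      have wM: "w \<in> carrier M" using x WD(1) by blast
      show "0 \<le> \<mu> x" using \<mu>[OF x(1)] x N(1) by (simp add: le_max_iff_disj)
      show "\<mu> x = 0 \<longleftrightarrow> x = \<zero>"
      proof
        assume "\<mu> x = 0"
        hence "\<nu> w = 0" "v c = 0"
          using \<mu>[OF x(1), of c] x(2) N(1)[OF x(1)] abs_nonneg[of c] by auto
        thus "x = \<zero>" using N(2)[OF x(1)] x(2) e by (simp add: abs_eq_0)
      next
        assume "x = \<zero>"
        hence "w \<oplus> [:c:] \<cdot> e = \<zero> \<oplus> [:0:] \<cdot> e" using x e by simp
        hence "w = \<zero> \<and> c = 0" using adjoin_unique[OF adjoin.hyps(2) e x(1) WD(2)] by blast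
        thus "\<mu> x = 0" using \<mu>[OF x(1), of c] x(2) N(2)[OF x(1)] by simp
      qed
      show "\<mu> ([:d:] \<cdot> x) = v d * \<mu> x" for d
      proof -
        have "[:d:] \<cdot> x = [:d:] \<cdot> w \<oplus> [:d * c:] \<cdot> e" unfolding x using wM e by (simp add: act_add_right sc_sc)
        hence "\<mu> ([:d:] \<cdot> x) = max (v d * \<nu> w) (v d * v c)"
          using \<mu>[OF WD(4)[OF x(1)]] N(3)[OF x(1)] by (simp add: abs_mult)
        also have "\<dots> = v d * max (\<nu> w) (v c)" using abs_nonneg[of d] by (simp add: max_mult_distrib_left)
        finally show ?thesis using \<mu>[OF x(1)] x(2) by simp
      qed
      fix y assume "y \<in> adjoin M W e"
      then obtain u d where y: "u \<in> W" "y = u \<oplus> [:d:] \<cdot> e" unfolding adjoin_def by blast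
      have uM: "u \<in> carrier M" using y WD(1) by blast
      have "x \<oplus> y = (w \<oplus> u) \<oplus> [:c + d:] \<cdot> e" unfolding x y using wM uM e by (simp add: sc_add M.a_ac)
      hence "\<mu> (x \<oplus> y) = max (\<nu> (w \<oplus> u)) (v (c + d))" using \<mu>[OF WD(3)[OF x(1) y(1)]] by simp
      also have "\<dots> \<le> max (max (\<nu> w) (v c)) (max (\<nu> u) (v d))"
        using N(4)[OF x(1) y(1)] abs_ultrametric[of c d] by (auto simp: le_max_iff_disj)
      finally show "\<mu> (x \<oplus> y) \<le> max (\<mu> x) (\<mu> y)" using \<mu> x y by simp
    qed
    thus ?case by blast
  qed
  from this[OF fin_span_carrier] show ?thesis by (simp add: module_norm_def)
qed

text \<open>\<open>T\<close> is not linear over the field, but on a line the Leibniz rule and the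
  bound on \<open>\<delta>\<close> give an estimate by \<open>v c * K\<close>. Together with
  additivity that is all that \<open>norm_dominates\<close> asks for.\<close>

lemma bounded_operator_T:
  assumes \<nu>: "module_norm v M \<nu>" and "carrier M \<noteq> {\<zero>}"
  shows "bounded_operator (carrier M) \<nu> (\<lambda>x. T x)"
proof
  show "\<exists>x\<in>carrier M. \<nu> x \<noteq> 0"
    using assms(2) module_normD(2)[OF \<nu>] M.zero_closed by blast
  obtain B where B: "\<And>x. v (\<delta> x) \<le> B * v x" using d_bounded by blast
  obtain C where "\<And>x. x \<in> carrier M \<Longrightarrow> \<nu> (T x) \<le> C * \<nu> x"
  proof (rule norm_dominates[OF \<nu>, of "\<lambda>x. \<nu> (T x)"])
    show "\<nu> (T (x \<oplus> y)) \<le> max (\<nu> (T x)) (\<nu> (T y))" if "x \<in> carrier M" "y \<in> carrier M" for x y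
      using that module_normD(4)[OF \<nu>] by (simp add: T_add)
    fix x assume x: "x \<in> carrier M"
    have "\<nu> (T ([:c:] \<cdot> x)) \<le> v c * max (\<nu> (T x)) (B * \<nu> x)" for c
    proof -
      have "\<nu> (T ([:c:] \<cdot> x)) \<le> max (v c * \<nu> (T x)) (v (\<delta> c) * \<nu> x)"
        using module_normD(4)[OF \<nu>, of "[:c:] \<cdot> T x" "[:\<delta> c:] \<cdot> x"] x module_normD(3)[OF \<nu>] by (simp add: T_sc)
      also have "\<dots> \<le> v c * max (\<nu> (T x)) (B * \<nu> x)"
      proof (rule max.boundedI)
        show "v c * \<nu> (T x) \<le> v c * max (\<nu> (T x)) (B * \<nu> x)" by (intro mult_left_mono abs_nonneg) auto
        have "v (\<delta> c) * \<nu> x \<le> (B * v c) * \<nu> x" using module_normD(1)[OF \<nu> x] B by (intro mult_right_mono)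
        also have "\<dots> = v c * (B * \<nu> x)" by simp
        also have "\<dots> \<le> v c * max (\<nu> (T x)) (B * \<nu> x)" by (intro mult_left_mono abs_nonneg) auto
        finally show "v (\<delta> c) * \<nu> x \<le> v c * max (\<nu> (T x)) (B * \<nu> x)" .
      qed
      finally show ?thesis .
    qed
    thus "\<exists>K. \<forall>c. \<nu> (T ([:c:] \<cdot> x)) \<le> v c * K" by blast
  qed blast
  thus "\<exists>C. \<forall>x\<in>carrier M. \<nu> (T x) \<le> C * \<nu> x" by blast
qed (use module_normD(1)[OF \<nu>] in auto)

end

section \<open>Solutions as homomorphisms into power series\<close>

lemma fps_module_simps [simp]:
  "carrier (fps_module \<delta>) = UNIV" "add (fps_module \<delta>) = (+)" "zero (fps_module \<delta>) = 0"
  "smult (fps_module \<delta>) = twisted_act (\<lambda>c F. taylor \<delta> c * F) fps_deriv"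
  by (simp_all add: fps_module_def)

text \<open>\<open>D\<close> is any set of series: a target can be enlarged or shrunk without first
  checking that it is a submodule.\<close>

definition fps_hom ::
  "('k::field_char_0 \<Rightarrow> 'k) \<Rightarrow> ('k poly, 'b, 'm) module_scheme \<Rightarrow> 'k fps set \<Rightarrow> ('b \<Rightarrow> 'k fps) \<Rightarrow> bool" where
  "fps_hom \<delta> M D h \<longleftrightarrow> (\<forall>x\<in>carrier M. h x \<in> D) \<and>
     (\<forall>x\<in>carrier M. \<forall>y\<in>carrier M. h (x \<oplus>\<^bsub>M\<^esub> y) = h x + h y) \<and>
     (\<forall>p. \<forall>x\<in>carrier M. h (p \<odot>\<^bsub>M\<^esub> x) = twisted_act (\<lambda>c F. taylor \<delta> c * F) fps_deriv p (h x))"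

lemma left_module_hom_fps:
  "h \<in> left_module_hom (twisted_ring \<delta>) M ((fps_module \<delta>)\<lparr>carrier := D\<rparr>) \<longleftrightarrow> fps_hom \<delta> M D h"
  by (auto simp: left_module_hom_def hom_def fps_hom_def)

lemma left_module_hom_fps_UNIV:
  "h \<in> left_module_hom (twisted_ring \<delta>) M (fps_module \<delta>) \<longleftrightarrow> fps_hom \<delta> M UNIV h"
  by (auto simp: left_module_hom_def hom_def fps_hom_def)

lemma fps_homD:
  assumes "fps_hom \<delta> M D h" "x \<in> carrier M"
  shows "h x \<in> D" "y \<in> carrier M \<Longrightarrow> h (x \<oplus>\<^bsub>M\<^esub> y) = h x + h y"
    "h (p \<odot>\<^bsub>M\<^esub> x) = twisted_act (\<lambda>c F. taylor \<delta> c * F) fps_deriv p (h x)"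
    "h ([:c:] \<odot>\<^bsub>M\<^esub> x) = taylor \<delta> c * h x"
  using assms by (auto simp: fps_hom_def twisted_act_def)

lemma fps_hom_restrict: "fps_hom \<delta> M D h \<Longrightarrow> N \<subseteq> carrier M \<Longrightarrow> fps_hom \<delta> (M\<lparr>carrier := N\<rparr>) D h"
  by (auto simp: fps_hom_def subset_iff)

lemma fps_hom_mono: "fps_hom \<delta> M D h \<Longrightarrow> (\<And>x. x \<in> carrier M \<Longrightarrow> h x \<in> D') \<Longrightarrow> fps_hom \<delta> M D' h"
  by (auto simp: fps_hom_def)

context residue_char_0_diff_field
begin

lemma diff_module_fps: "diff_module v \<delta> (fps_module \<delta>)"
  by (intro diff_module.intro left_module_fps residue_char_0_diff_field_axioms)

lemma taylor_zero [simp]: "taylor \<delta> 0 = 0"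
  using taylor_add[of 0 0] by simp

lemma fps_act_const: "fps_act [:c:] F = taylor \<delta> c * F"
  by (simp add: twisted_act_def)

lemma fps_act_T: "fps_act [:0, 1:] F = fps_deriv F"
  by (simp add: twisted_act_def taylor_one)

lemma fps_bounded_add: "s > 0 \<Longrightarrow> F \<in> fps_bounded v s \<Longrightarrow> G \<in> fps_bounded v s \<Longrightarrow> F + G \<in> fps_bounded v s"
  unfolding fps_bounded_iff by (meson gauss_bound_add gauss_bound_mono max.cobounded1 max.cobounded2)

lemma fps_bounded_sum:
  "s > 0 \<Longrightarrow> (\<And>i. i \<in> I \<Longrightarrow> f i \<in> fps_bounded v s) \<Longrightarrow> sum f I \<in> fps_bounded v s"
proof (induction I rule: infinite_finite_induct)
  case (insert i I)
  thus ?case by (simp add: fps_bounded_add)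
qed (use gauss_bound_0 in \<open>auto simp: fps_bounded_iff\<close>)

lemma fps_bounded_act:
  assumes s: "0 < s" "s * spectral_norm UNIV v \<delta> < 1" and F: "F \<in> fps_bounded v s"
  shows "fps_act p F \<in> fps_bounded v s"
proof -
  obtain C where C: "gauss_bound v s C F" using F fps_bounded_iff by blast
  have "taylor \<delta> c * (fps_deriv ^^ i) F \<in> fps_bounded v s" for c i
    using gauss_bound_mult[OF s(1) taylor_bound[OF s] gauss_bound_deriv_pow[OF s(1) C]] fps_bounded_iff by blast
  thus ?thesis unfolding twisted_act_def using s(1) by (intro fps_bounded_sum) auto
qed

lemma fps_bounded_antimono: "0 < s \<Longrightarrow> s \<le> s' \<Longrightarrow> F \<in> fps_bounded v s' \<Longrightarrow> F \<in> fps_bounded v s"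
  unfolding fps_bounded_iff using gauss_bound_antimono by blast

lemma fps_overconvE:
  assumes "0 < t" "t * spectral_norm UNIV v \<delta> < 1" "F \<in> fps_overconv v t"
  obtains s where "t < s" "s * spectral_norm UNIV v \<delta> < 1" "F \<in> fps_bounded v s"
proof -
  obtain s' where s': "t < s'" "F \<in> fps_bounded v s'" using assms(3) by (auto simp: fps_overconv_def)
  obtain s where s: "t < s" "s \<le> s'" "s * spectral_norm UNIV v \<delta> < 1"
    using radius_margin[OF assms(2) s'(1)] by blast
  have "F \<in> fps_bounded v s" using fps_bounded_antimono[OF _ s(2) s'(2)] s(1) assms(1) by simp
  thus ?thesis using that s by blast
qed

lemma fps_overconv_add:
  assumes t: "0 < t" "t * spectral_norm UNIV v \<delta> < 1" and FG: "F \<in> fps_overconv v t" "G \<in> fps_overconv v t"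
  shows "F + G \<in> fps_overconv v t"
proof -
  obtain s s' where s: "t < s" "F \<in> fps_bounded v s" "t < s'" "G \<in> fps_bounded v s'"
    using FG by (auto simp: fps_overconv_def)
  have "F + G \<in> fps_bounded v (min s s')"
    using s t by (intro fps_bounded_add fps_bounded_antimono[OF _ _ s(2)] fps_bounded_antimono[OF _ _ s(4)]) auto
  thus ?thesis using s by (auto simp: fps_overconv_def intro!: bexI[of _ "min s s'"])
qed

lemma fps_overconv_act:
  assumes t: "0 < t" "t * spectral_norm UNIV v \<delta> < 1" and F: "F \<in> fps_overconv v t"
  shows "fps_act p F \<in> fps_overconv v t"
proof -
  obtain s where s: "t < s" "s * spectral_norm UNIV v \<delta> < 1" "F \<in> fps_bounded v s"
    using fps_overconvE[OF assms] by blast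
  thus ?thesis using fps_bounded_act[OF _ s(2,3), of p] t by (auto simp: fps_overconv_def)
qed

end

context diff_module
begin

text \<open>Constants and \<open>T\<close> generate the twisted ring. The induction peels off the
  same term on both sides, the power series being themselves a \<open>diff_module\<close>.\<close>

lemma fps_homI:
  assumes "\<And>x. x \<in> carrier M \<Longrightarrow> h x \<in> D"
    and add: "\<And>x y. x \<in> carrier M \<Longrightarrow> y \<in> carrier M \<Longrightarrow> h (x \<oplus> y) = h x + h y"
    and sc: "\<And>c x. x \<in> carrier M \<Longrightarrow> h ([:c:] \<cdot> x) = taylor \<delta> c * h x"
    and T: "\<And>x. x \<in> carrier M \<Longrightarrow> h (T x) = fps_deriv (h x)"
  shows "fps_hom \<delta> M D h"
proof -
  interpret F: diff_module v \<delta> "fps_module \<delta>" by (rule diff_module_fps)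
  have "h (p \<cdot> x) = fps_act p (h x)" if "x \<in> carrier M" for p x
    using that
  proof (induction p arbitrary: x)
    case 0
    have "h \<zero> = 0" using add[of \<zero> \<zero>] by simp
    thus ?case using 0 F.act_0_left[of "h x"] by simp
  next
    case (pCons c p)
    have "h (pCons c p \<cdot> x) = h ([:c:] \<cdot> x \<oplus> p \<cdot> T x)" by (subst pCons_act[OF pCons.prems]) simp
    also have "\<dots> = taylor \<delta> c * h x + fps_act p (fps_deriv (h x))"
      using pCons.prems pCons.IH[of "T x"] by (simp add: add sc T)
    also have "\<dots> = fps_act (pCons c p) (h x)"
      using F.pCons_act[of "h x" c p, simplified] unfolding fps_act_const fps_act_T by simp
    finally show ?case .
  qed
  thus ?thesis using assms by (simp add: fps_hom_def)
qed

lemma fps_hom_T: "fps_hom \<delta> M D h \<Longrightarrow> x \<in> carrier M \<Longrightarrow> h (T x) = fps_deriv (h x)"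
  using fps_homD(3)[of \<delta> M D h x "[:0, 1:]"] by (simp add: fps_act_T)

lemma fps_hom_zero: "fps_hom \<delta> M D h \<Longrightarrow> h \<zero> = 0"
  using fps_homD(2)[of \<delta> M D h \<zero> \<zero>] by simp

lemma fps_hom_diff: "fps_hom \<delta> M D h \<Longrightarrow> x \<in> carrier M \<Longrightarrow> y \<in> carrier M \<Longrightarrow> h (x \<ominus> y) = h x - h y"
  using fps_homD(2)[of \<delta> M D h "x \<ominus> y" y] by (simp add: M.minus_eq M.a_assoc M.l_neg)

text \<open>Taylor's formula: \<open>T\<close> acts as the derivative, so a solution is determined
  by its constant term, a functional evaluated on the iterates of \<open>T\<close>. The converse is
  \<open>functional_fps_hom\<close>.\<close>

lemma fps_hom_coeff:
  assumes h: "fps_hom \<delta> M D h" and x: "x \<in> carrier M"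
  shows "fps_nth (h x) i = fps_nth (h (((\<lambda>x. T x) ^^ i) x)) 0 / fact i"
  using x
proof (induction i arbitrary: x)
  case (Suc i)
  have "of_nat (Suc i) * fps_nth (h x) (Suc i) = fps_nth (h (T x)) i"
    using fps_hom_T[OF h Suc.prems] by simp
  also have "\<dots> = fps_nth (h (((\<lambda>x. T x) ^^ Suc i) x)) 0 / fact i"
    using Suc by (simp add: funpow_swap1)
  finally show ?case by (simp add: fact_Suc field_simps del: of_nat_Suc)
qed simp

text \<open>Compatibility with \<open>taylor \<delta> c\<close> holds because both sides have the
  same constant term and, by the Leibniz rules for \<open>T\<close> and for series, derivatives of
  the same shape; this is an induction on the degree of the coefficient with \<open>c\<close> and
  \<open>x\<close> generalised.\<close>

lemma functional_fps_hom:
  assumes add: "\<And>y z. y \<in> carrier M \<Longrightarrow> z \<in> carrier M \<Longrightarrow> \<phi> (y \<oplus> z) = \<phi> y + \<phi> z"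
    and sc: "\<And>c y. y \<in> carrier M \<Longrightarrow> \<phi> ([:c:] \<cdot> y) = c * \<phi> y"
  shows "fps_hom \<delta> M UNIV (\<lambda>x. Abs_fps (\<lambda>i. \<phi> (((\<lambda>x. T x) ^^ i) x) / fact i))"
    (is "fps_hom \<delta> M UNIV ?h")
proof (rule fps_homI)
  have Tpow_add: "((\<lambda>x. T x) ^^ i) (x \<oplus> y) = ((\<lambda>x. T x) ^^ i) x \<oplus> ((\<lambda>x. T x) ^^ i) y"
    if "x \<in> carrier M" "y \<in> carrier M" for x y i
    by (induction i) (use that in \<open>auto simp: T_add Tpow_closed\<close>)
  show h_add: "?h (x \<oplus> y) = ?h x + ?h y" if "x \<in> carrier M" "y \<in> carrier M" for x y
    using that by (intro fps_ext) (simp add: Tpow_add add Tpow_closed add_divide_distrib)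
  show h_T: "?h (T x) = fps_deriv (?h x)" if "x \<in> carrier M" for x
  proof (rule fps_ext)
    fix n
    have "of_nat (Suc n) * (z / fact (Suc n)) = z / fact n" for z :: 'k
      by (simp add: fact_Suc del: of_nat_Suc)
    thus "fps_nth (?h (T x)) n = fps_nth (fps_deriv (?h x)) n"
      by (simp add: funpow_swap1 del: of_nat_Suc)
  qed
  show "?h ([:c:] \<cdot> x) = taylor \<delta> c * ?h x" if "x \<in> carrier M" for c x
  proof (rule fps_ext)
    fix n
    show "fps_nth (?h ([:c:] \<cdot> x)) n = fps_nth (taylor \<delta> c * ?h x) n"
      using that
    proof (induction n arbitrary: c x)
      case 0
      thus ?case by (simp add: sc taylor_def)
    next
      case (Suc n)
      have "of_nat (Suc n) * fps_nth (?h ([:c:] \<cdot> x)) (Suc n) = fps_nth (?h (T ([:c:] \<cdot> x))) n"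
        unfolding h_T[OF act_closed[OF Suc.prems]] by (simp only: fps_deriv_nth Suc_eq_plus1)
      also have "\<dots> = fps_nth (?h ([:c:] \<cdot> T x) + ?h ([:\<delta> c:] \<cdot> x)) n"
        by (subst h_add[symmetric]) (use Suc.prems in \<open>simp_all add: T_sc\<close>)
      also have "\<dots> = fps_nth (?h ([:c:] \<cdot> T x)) n + fps_nth (?h ([:\<delta> c:] \<cdot> x)) n"
        by (rule fps_add_nth)
      also have "\<dots> = fps_nth (taylor \<delta> c * ?h (T x)) n + fps_nth (taylor \<delta> (\<delta> c) * ?h x) n"
        using Suc.IH[OF act_closed[OF Suc.prems]] Suc.IH[OF Suc.prems] by presburger
      also have "\<dots> = fps_nth (fps_deriv (taylor \<delta> c * ?h x)) n"
        unfolding h_T[OF Suc.prems] by (simp add: fps_deriv_taylor)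
      also have "\<dots> = of_nat (Suc n) * fps_nth (taylor \<delta> c * ?h x) (Suc n)"
        by (simp only: fps_deriv_nth Suc_eq_plus1)
      finally show ?case by (simp del: of_nat_Suc fps_nth_Abs_fps)
    qed
  qed
qed simp

subsection \<open>Submodules\<close>

lemma submodule_iff:
  "Module.submodule N (twisted_ring \<delta>) M \<longleftrightarrow> subspace_of M N \<and> (\<forall>x\<in>N. T x \<in> N)"
proof
  assume "Module.submodule N (twisted_ring \<delta>) M"
  then interpret N: Module.submodule N "twisted_ring \<delta>" M .
  show "subspace_of M N \<and> (\<forall>x\<in>N. T x \<in> N)"
    using N.subset N.m_closed N.one_closed N.smult_closed by (auto simp: subspace_of_def)
next
  assume N: "subspace_of M N \<and> (\<forall>x\<in>N. T x \<in> N)"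
  note ND = subspaceD[OF conjunct1[OF N]]
  have "p \<cdot> x \<in> N" if "x \<in> N" for p x
    using that
  proof (induction p arbitrary: x)
    case 0
    thus ?case using ND(1,2) by auto
  next
    case (pCons c p)
    have "T x \<in> N" using N pCons.prems by blast
    hence "[:c:] \<cdot> x \<oplus> p \<cdot> T x \<in> N" using ND(3)[OF ND(4)[OF pCons.prems] pCons.IH] by blast
    thus ?case using pCons_act[of x c p] pCons.prems ND(1) by auto
  qed
  thus "Module.submodule N (twisted_ring \<delta>) M"
    using ND by unfold_locales (auto simp: a_inv_def[symmetric])
qed

lemma submoduleD:
  assumes "Module.submodule N (twisted_ring \<delta>) M"
  shows "subspace_of M N" "N \<subseteq> carrier M" "x \<in> N \<Longrightarrow> p \<cdot> x \<in> N"
proof -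
  interpret N: Module.submodule N "twisted_ring \<delta>" M by fact
  show "subspace_of M N" using assms submodule_iff by blast
  thus "N \<subseteq> carrier M" by (rule subspaceD)
  show "x \<in> N \<Longrightarrow> p \<cdot> x \<in> N" using N.smult_closed by simp
qed

lemma submodule_zero: "Module.submodule {\<zero>} (twisted_ring \<delta>) M"
  by (simp add: submodule_iff subspace_zero)

lemma fps_hom_kernel:
  assumes "fps_hom \<delta> M D h"
  shows "Module.submodule {x \<in> carrier M. h x = 0} (twisted_ring \<delta>) M"
  unfolding submodule_iff subspace_of_def using fps_homD(2,4)[OF assms] fps_hom_zero[OF assms] fps_hom_T[OF assms]
  by auto

lemma diff_module_submodule:
  assumes "Module.submodule N (twisted_ring \<delta>) M"
  shows "diff_module v \<delta> (M\<lparr>carrier := N\<rparr>)"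
proof -
  note ND = submoduleD[OF assms]
  note SD = subspaceD[OF ND(1)]
  have M: "x \<in> N \<Longrightarrow> x \<in> carrier M" for x using ND(2) by blast
  have "abelian_group (M\<lparr>carrier := N\<rparr>)"
  proof (rule abelian_groupI)
    fix x assume "x \<in> carrier (M\<lparr>carrier := N\<rparr>)"
    thus "\<exists>y\<in>carrier (M\<lparr>carrier := N\<rparr>). y \<oplus>\<^bsub>M\<lparr>carrier := N\<rparr>\<^esub> x = \<zero>\<^bsub>M\<lparr>carrier := N\<rparr>\<^esub>"
      using SD(5) M by (auto intro!: bexI[of _ "\<ominus> x"] simp: M.l_neg)
  qed (use SD M in \<open>auto simp: M.a_ac\<close>)
  thus ?thesis
    using ND M ring_twisted_ring
    by (intro diff_module.intro residue_char_0_diff_field_axioms left_module.intro left_module_axioms.intro)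
       (auto simp: act_add_left act_add_right act_mult)
qed

lemma submodule_restrict_iff:
  assumes "Module.submodule N (twisted_ring \<delta>) M"
  shows "Module.submodule U (twisted_ring \<delta>) (M\<lparr>carrier := N\<rparr>) \<longleftrightarrow> Module.submodule U (twisted_ring \<delta>) M \<and> U \<subseteq> N"
  using submoduleD(2)[OF assms]
  unfolding submodule_iff diff_module.submodule_iff[OF diff_module_submodule[OF assms]] subspace_of_def
  by auto

subsection \<open>Quotients\<close>

context
  fixes N assumes N: "Module.submodule N (twisted_ring \<delta>) M"
begin

lemma rcos_eq:
  assumes "x \<in> carrier M"
  shows "N +>\<^bsub>M\<^esub> x = {z \<in> carrier M. z \<ominus> x \<in> N}"
proof -
  note ND = submoduleD(2)[OF N]
  have "N +>\<^bsub>M\<^esub> x = {n \<oplus> x | n. n \<in> N}" by (auto simp: a_r_coset_def r_coset_def)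
  also have "\<dots> = {z \<in> carrier M. z \<ominus> x \<in> N}"
  proof (intro equalityI subsetI)
    fix z assume "z \<in> {n \<oplus> x | n. n \<in> N}"
    then obtain n where n: "n \<in> N" "z = n \<oplus> x" by blast
    have "n \<oplus> x \<ominus> x = n" using n ND assms by (auto simp: M.minus_eq M.a_assoc M.r_neg)
    thus "z \<in> {z \<in> carrier M. z \<ominus> x \<in> N}" using n ND assms by auto
  next
    fix z assume z: "z \<in> {z \<in> carrier M. z \<ominus> x \<in> N}"
    hence "z = (z \<ominus> x) \<oplus> x" using assms by (simp add: M.minus_eq M.a_assoc M.l_neg)
    thus "z \<in> {n \<oplus> x | n. n \<in> N}" using z by blast
  qed
  finally show ?thesis .
qed

lemma rcos_eq_iff:
  assumes x: "x \<in> carrier M" and y: "y \<in> carrier M"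
  shows "N +>\<^bsub>M\<^esub> x = N +>\<^bsub>M\<^esub> y \<longleftrightarrow> x \<ominus> y \<in> N"
proof
  note SD = subspaceD[OF submoduleD(1)[OF N]]
  assume "N +>\<^bsub>M\<^esub> x = N +>\<^bsub>M\<^esub> y"
  moreover have "x \<in> N +>\<^bsub>M\<^esub> x" using x SD(2) by (simp add: rcos_eq M.minus_eq M.r_neg)
  ultimately show "x \<ominus> y \<in> N" using y by (simp add: rcos_eq)
next
  note SD = subspaceD[OF submoduleD(1)[OF N]]
  assume xy: "x \<ominus> y \<in> N"
  have "z \<ominus> x \<in> N \<longleftrightarrow> z \<ominus> y \<in> N" if z: "z \<in> carrier M" for z
  proof -
    have "z \<ominus> y = (z \<ominus> x) \<oplus> (x \<ominus> y)" "z \<ominus> x = (z \<ominus> y) \<ominus> (x \<ominus> y)"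
      using x y z by (simp_all add: group_simps)
    thus ?thesis using SD(3)[OF _ xy] SD(6)[OF _ xy] by metis
  qed
  thus "N +>\<^bsub>M\<^esub> x = N +>\<^bsub>M\<^esub> y" using x y by (auto simp: rcos_eq)
qed

lemma quotient_carrier: "carrier (quotient_module M N) = (\<lambda>x. N +>\<^bsub>M\<^esub> x) ` carrier M"
  by (auto simp: quotient_module_def A_RCOSETS_def RCOSETS_def a_r_coset_def)

lemma quotient_zero: "\<zero>\<^bsub>quotient_module M N\<^esub> = N +>\<^bsub>M\<^esub> \<zero>"
  using submoduleD(2)[OF N] by (auto simp: quotient_module_def rcos_eq M.minus_eq)

lemma quotient_add:
  assumes x: "x \<in> carrier M" and y: "y \<in> carrier M"
  shows "(N +>\<^bsub>M\<^esub> x) \<oplus>\<^bsub>quotient_module M N\<^esub> (N +>\<^bsub>M\<^esub> y) = N +>\<^bsub>M\<^esub> (x \<oplus> y)"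
proof -
  note SD = subspaceD[OF submoduleD(1)[OF N]]
  have "(N +>\<^bsub>M\<^esub> x) \<oplus>\<^bsub>quotient_module M N\<^esub> (N +>\<^bsub>M\<^esub> y)
      = {h \<oplus> k | h k. h \<in> carrier M \<and> h \<ominus> x \<in> N \<and> k \<in> carrier M \<and> k \<ominus> y \<in> N}"
    using x y by (auto simp: quotient_module_def set_add_def set_mult_def rcos_eq)
  also have "\<dots> = {z \<in> carrier M. z \<ominus> (x \<oplus> y) \<in> N}"
  proof (intro equalityI subsetI)
    fix z assume "z \<in> {h \<oplus> k | h k. h \<in> carrier M \<and> h \<ominus> x \<in> N \<and> k \<in> carrier M \<and> k \<ominus> y \<in> N}"
    then obtain h k where hk: "h \<in> carrier M" "h \<ominus> x \<in> N" "k \<in> carrier M" "k \<ominus> y \<in> N" "z = h \<oplus> k" by blast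
    have "z \<ominus> (x \<oplus> y) = (h \<ominus> x) \<oplus> (k \<ominus> y)" using hk x y by (simp add: M.minus_eq M.minus_add M.a_ac)
    thus "z \<in> {z \<in> carrier M. z \<ominus> (x \<oplus> y) \<in> N}" using hk SD(3) by simp
  next
    fix z assume z: "z \<in> {z \<in> carrier M. z \<ominus> (x \<oplus> y) \<in> N}"
    have "z = (z \<ominus> y) \<oplus> y" "(z \<ominus> y) \<ominus> x = z \<ominus> (x \<oplus> y)" "y \<ominus> y = \<zero>"
      using z x y by (simp_all add: group_simps)
    thus "z \<in> {h \<oplus> k | h k. h \<in> carrier M \<and> h \<ominus> x \<in> N \<and> k \<in> carrier M \<and> k \<ominus> y \<in> N}"
      using z x y SD(2) by (smt (verit) M.minus_closed mem_Collect_eq)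
  qed
  finally show ?thesis using x y by (simp add: rcos_eq)
qed

lemma quotient_smult:
  assumes x: "x \<in> carrier M"
  shows "p \<odot>\<^bsub>quotient_module M N\<^esub> (N +>\<^bsub>M\<^esub> x) = N +>\<^bsub>M\<^esub> (p \<cdot> x)"
proof -
  have "N +>\<^bsub>M\<^esub> (p \<cdot> y) = N +>\<^bsub>M\<^esub> (p \<cdot> x)" if "y \<in> N +>\<^bsub>M\<^esub> x" for y
  proof -
    have y: "y \<in> carrier M" "y \<ominus> x \<in> N" using that x by (auto simp: rcos_eq)
    have "p \<cdot> y \<ominus> p \<cdot> x \<in> N" using submoduleD(3)[OF N y(2), of p] x y by (simp add: act_diff_right)
    thus ?thesis using rcos_eq_iff x y by simp
  qed
  moreover have "x \<in> N +>\<^bsub>M\<^esub> x"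
    using x subspaceD(2)[OF submoduleD(1)[OF N]] by (simp add: rcos_eq M.minus_eq M.r_neg)
  ultimately have "(\<Union>y\<in>N +>\<^bsub>M\<^esub> x. N +>\<^bsub>M\<^esub> (p \<cdot> y)) = N +>\<^bsub>M\<^esub> (p \<cdot> x)" by blast
  thus ?thesis by (simp add: quotient_module_def)
qed

lemma quotient_zero_iff:
  assumes "x \<in> carrier M"
  shows "N +>\<^bsub>M\<^esub> x = \<zero>\<^bsub>quotient_module M N\<^esub> \<longleftrightarrow> x \<in> N"
  unfolding quotient_zero using assms by (simp add: rcos_eq_iff group_simps)

lemma diff_module_quotient: "diff_module v \<delta> (quotient_module M N)"
proof -
  let ?Q = "quotient_module M N"
  note Q = quotient_carrier quotient_zero quotient_add quotient_smult
  have "abelian_group ?Q"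
  proof (rule abelian_groupI)
    fix X assume "X \<in> carrier ?Q"
    then obtain x where x: "x \<in> carrier M" "X = N +>\<^bsub>M\<^esub> x" by (auto simp: Q)
    have "(N +>\<^bsub>M\<^esub> \<ominus> x) \<oplus>\<^bsub>?Q\<^esub> X = \<zero>\<^bsub>?Q\<^esub>" using x by (simp add: Q M.l_neg)
    thus "\<exists>Y\<in>carrier ?Q. Y \<oplus>\<^bsub>?Q\<^esub> X = \<zero>\<^bsub>?Q\<^esub>" using x by (auto simp: Q(1))
  qed (auto simp: Q M.a_ac)
  thus ?thesis
    using ring_twisted_ring
    by (intro diff_module.intro residue_char_0_diff_field_axioms left_module.intro left_module_axioms.intro)
       (auto simp: Q act_add_left act_add_right act_mult)
qed

lemma quotient_hom_descend:
  assumes h: "fps_hom \<delta> M D h" and ker: "\<And>x. x \<in> N \<Longrightarrow> h x = 0"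
  obtains g where "fps_hom \<delta> (quotient_module M N) D g" "\<And>x. x \<in> carrier M \<Longrightarrow> g (N +>\<^bsub>M\<^esub> x) = h x"
proof -
  define g where "g X = h (SOME x. x \<in> carrier M \<and> X = N +>\<^bsub>M\<^esub> x)" for X
  have g: "g (N +>\<^bsub>M\<^esub> x) = h x" if x: "x \<in> carrier M" for x
  proof -
    define y where "y = (SOME y. y \<in> carrier M \<and> N +>\<^bsub>M\<^esub> x = N +>\<^bsub>M\<^esub> y)"
    have y: "y \<in> carrier M \<and> N +>\<^bsub>M\<^esub> x = N +>\<^bsub>M\<^esub> y" unfolding y_def by (rule someI[of _ x]) (use x in simp)
    hence "h (x \<ominus> y) = 0" using rcos_eq_iff x ker by blast
    moreover have "g (N +>\<^bsub>M\<^esub> x) = h y" by (simp only: g_def y_def)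
    ultimately show ?thesis using fps_hom_diff[OF h x, of y] y by simp
  qed
  have "fps_hom \<delta> (quotient_module M N) D g"
    using h by (simp add: fps_hom_def quotient_carrier quotient_add quotient_smult g)
  thus ?thesis using that g by blast
qed

end

end

section \<open>Finite dimension of submodules and quotients\<close>

context fd_diff_module
begin

text \<open>A maximal subspace spanned by finitely many vectors of \<open>N\<close> absorbs each
  vector of \<open>N\<close>; it exists by the chain condition in the ambient module.\<close>

lemma fd_submodule:
  assumes N: "Module.submodule N (twisted_ring \<delta>) M"
  shows "fd_diff_module v \<delta> (M\<lparr>carrier := N\<rparr>)"
proof -
  interpret N: diff_module v \<delta> "M\<lparr>carrier := N\<rparr>" by (rule diff_module_submodule[OF N])
  have sub: "subspace_of M U \<and> U \<subseteq> N" if "fin_span (M\<lparr>carrier := N\<rparr>) U" for U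
    using N.fin_span_subspace[OF that] submoduleD(2)[OF N] by (auto simp: subspace_of_def)
  obtain U where U: "fin_span (M\<lparr>carrier := N\<rparr>) U"
    and max: "\<And>U'. fin_span (M\<lparr>carrier := N\<rparr>) U' \<Longrightarrow> U \<subseteq> U' \<Longrightarrow> U' = U"
    by (rule maximal_subspace[of "fin_span (M\<lparr>carrier := N\<rparr>)" "{\<zero>}"])
       (use sub fin_span.zero[of "M\<lparr>carrier := N\<rparr>"] in auto)
  have "N \<subseteq> U"
  proof
    fix e assume e: "e \<in> N"
    hence "fin_span (M\<lparr>carrier := N\<rparr>) (adjoin (M\<lparr>carrier := N\<rparr>) U e)" using U by (intro fin_span.adjoin) auto
    hence "adjoin (M\<lparr>carrier := N\<rparr>) U e = U"
      by (rule max) (use N.adjoin_superset[OF N.fin_span_subspace[OF U]] e in auto)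
    thus "e \<in> U" using N.adjoin_self[OF N.fin_span_subspace[OF U], of e] e by simp
  qed
  hence "U = N" using sub[OF U] by blast
  thus ?thesis using U by unfold_locales simp
qed

lemma fd_quotient:
  assumes N: "Module.submodule N (twisted_ring \<delta>) M"
  shows "fd_diff_module v \<delta> (quotient_module M N)"
proof -
  let ?Q = "quotient_module M N" and ?\<pi> = "\<lambda>x. N +>\<^bsub>M\<^esub> x"
  interpret Q: diff_module v \<delta> ?Q by (rule diff_module_quotient[OF N])
  note Q = quotient_carrier[OF N] quotient_zero[OF N] quotient_add[OF N] quotient_smult[OF N]
  have "fin_span ?Q (?\<pi> ` W)" if "fin_span M W" for W
    using that
  proof (induction rule: fin_span_strict_induct)
    case zero
    show ?case using fin_span.zero[of ?Q] by (simp add: Q)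
  next
    case (adjoin W e)
    have W: "w \<in> W \<Longrightarrow> w \<in> carrier M" for w using subspaceD(1)[OF adjoin.hyps(2)] by blast
    have eq: "?\<pi> (w \<oplus> [:c:] \<cdot> e) = ?\<pi> w \<oplus>\<^bsub>?Q\<^esub> [:c:] \<odot>\<^bsub>?Q\<^esub> ?\<pi> e" if "w \<in> W" for w c
      using W[OF that] adjoin.hyps(3) by (simp add: Q)
    have "?\<pi> ` adjoin M W e = adjoin ?Q (?\<pi> ` W) (?\<pi> e)"
      unfolding adjoin_def using eq by (auto simp: image_iff) (metis eq)+
    thus ?case using fin_span.adjoin[OF adjoin.IH, of "?\<pi> e"] adjoin.hyps(3) by (simp add: Q)
  qed
  from this[OF fin_span_carrier] show ?thesis by unfold_locales (simp add: Q)
qed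

end

subsection \<open>Comparison with vector spaces\<close>

context diff_module
begin

lemma vectorspace_base: "vectorspace class_ring (base_space M)"
proof -
  have "abelian_group (base_space M)"
  proof (rule abelian_groupI)
    fix x assume "x \<in> carrier (base_space M)"
    thus "\<exists>y\<in>carrier (base_space M). y \<oplus>\<^bsub>base_space M\<^esub> x = \<zero>\<^bsub>base_space M\<^esub>"
      by (auto simp: base_space_def M.l_neg intro!: bexI[of _ "\<ominus> x"])
  qed (auto simp: base_space_def M.a_ac)
  hence "Module.module class_ring (base_space M)"
    using class_field
    by (intro Module.moduleI)
       (auto simp: base_space_def sc_add act_add_right sc_sc field_def domain_def)
  thus ?thesis using class_field by (intro vectorspace.intro)
qed

lemma subspace_base:
  assumes "subspace_of M W"
  shows "LinearCombinations.submodule class_ring W (base_space M)"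
proof -
  interpret vectorspace class_ring "base_space M" by (rule vectorspace_base)
  show ?thesis
    using assms module_axioms by unfold_locales (auto simp: subspace_of_def base_space_def)
qed

end

lemma fd_diff_moduleI:
  assumes "residue_char_0_diff_field v \<delta>" "fd_module \<delta> M"
  shows "fd_diff_module v \<delta> M"
proof -
  interpret diff_module v \<delta> M
    using assms by (auto simp: fd_module_def intro: diff_module.intro)
  interpret V: vectorspace class_ring "base_space M" by (rule vectorspace_base)
  obtain A where A: "finite A" "A \<subseteq> carrier M" "V.span A = carrier M"
    using assms(2) by (auto simp: fd_module_def V.fin_dim_def) (auto simp: base_space_def)
  have "\<exists>W. fin_span M W \<and> A \<subseteq> W"
    using A(1,2)
  proof (induction A rule: finite_induct)
    case empty
    show ?case using fin_span.zero by blast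
  next
    case (insert a A)
    then obtain W where W: "fin_span M W" "A \<subseteq> W" by auto
    have a: "a \<in> carrier M" using insert by simp
    note S = fin_span_subspace[OF W(1)]
    have "insert a A \<subseteq> adjoin M W a" using adjoin_superset[OF S a] adjoin_self[OF S a] W(2) by blast
    thus ?case using fin_span.adjoin[OF W(1) a] by blast
  qed
  then obtain W where W: "fin_span M W" "A \<subseteq> W" by blast
  have "V.span A \<subseteq> W" by (rule V.span_is_subset[OF W(2) subspace_base[OF fin_span_subspace[OF W(1)]]])
  hence "W = carrier M" using A(3) subspaceD(1)[OF fin_span_subspace[OF W(1)]] by blast
  thus ?thesis using W(1) by unfold_locales simp
qed

text \<open>Makes every composition factor visible in \<open>mult_function\<close>. As a least
  cardinality, \<open>dim\<close> is meaningful only once a finite spanning set is known, hence the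
  induction before the contradiction.\<close>

lemma (in fd_diff_module) dim_nonzero:
  assumes "carrier M \<noteq> {\<zero>}"
  shows "vectorspace.dim class_ring (base_space M) \<noteq> 0"
proof
  interpret V: vectorspace class_ring "base_space M" by (rule vectorspace_base)
  have car: "carrier (base_space M) = carrier M" by (simp add: base_space_def)
  have "V.span {} = {\<zero>\<^bsub>base_space M\<^esub>}" by (auto simp: V.span_def V.lincomb_def)
  hence span_empty: "V.span {} = {\<zero>}" by (simp add: base_space_def)
  have "\<exists>A. finite A \<and> A \<subseteq> carrier M \<and> W \<subseteq> V.span A" if "fin_span M W" for W
    using that
  proof (induction rule: fin_span_strict_induct)
    case zero
    show ?case using span_empty by blast
  next
    case (adjoin W e)
    then obtain A where A: "finite A" "A \<subseteq> carrier M" "W \<subseteq> V.span A" by blast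
    have ins: "insert e A \<subseteq> carrier (base_space M)" using A adjoin.hyps(3) car by simp
    interpret S: LinearCombinations.submodule class_ring "V.span (insert e A)" "base_space M"
      by (rule V.span_is_submodule[OF ins])
    have "W \<subseteq> V.span (insert e A)" "e \<in> V.span (insert e A)"
      using A(3) V.span_is_monotone[of A "insert e A"] V.in_own_span[OF ins] by auto
    hence "adjoin M W e \<subseteq> V.span (insert e A)"
      using S.m_closed S.smult_closed by (auto simp: adjoin_def base_space_def)
    thus ?case using A(1,2) adjoin.hyps(3) by (intro exI[of _ "insert e A"]) auto
  qed
  then obtain A where A: "finite A" "A \<subseteq> carrier M" "carrier M \<subseteq> V.span A" using fin_span_carrier by blast
  hence "V.span A = carrier (base_space M)" using V.span_is_subset2[of A] car by auto
  hence "\<exists>n A. finite A \<and> card A = n \<and> A \<subseteq> carrier (base_space M) \<and> V.span A = carrier (base_space M)"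
    using A car by auto
  from LeastI_ex[OF this] obtain B where
    B: "finite B" "card B = V.dim" "V.span B = carrier (base_space M)" by (auto simp: V.dim_def)
  assume "V.dim = 0"
  hence "carrier M = V.span {}" using B car by simp
  thus False using assms span_empty by simp
qed

section \<open>Spectral norms and convergence of solutions\<close>

definition gauss_norm :: "('k::field_char_0 \<Rightarrow> real) \<Rightarrow> real \<Rightarrow> 'k fps \<Rightarrow> real" where
  "gauss_norm v s F = (SUP i. v (fps_nth F i) * s ^ i)"

lemma gauss_norm_bound: "F \<in> fps_bounded v s \<Longrightarrow> gauss_bound v s (gauss_norm v s F) F"
  unfolding gauss_bound_def gauss_norm_def fps_bounded_def by (auto intro: cSUP_upper)

lemma gauss_norm_le: "gauss_bound v s C F \<Longrightarrow> gauss_norm v s F \<le> C"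
  unfolding gauss_bound_def gauss_norm_def by (auto intro: cSUP_least)

context fd_diff_module
begin

lemma some_norm: "module_norm v M (SOME \<nu>. module_norm v M \<nu>)"
  by (rule someI_ex[OF norm_exists])

text \<open>The strict inequality leaves room for \<open>\<beta>\<close> between the spectral norm
  of \<open>T\<close> and \<open>1 / t\<close>. The constant term is a bounded functional and
  factorials have absolute value \<open>1\<close>, so the solution is bounded at radius
  \<open>1 / \<beta>\<close>, which exceeds \<open>t\<close>.\<close>

lemma solution_overconv:
  assumes ne: "carrier M \<noteq> {\<zero>}" and t: "0 < t" "T_spectral_norm v M * t < 1"
    and h: "fps_hom \<delta> M UNIV h" and x: "x \<in> carrier M"
  shows "h x \<in> fps_overconv v t"
proof -
  define \<nu> where "\<nu> = (SOME \<nu>. module_norm v M \<nu>)"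
  have \<nu>: "module_norm v M \<nu>" unfolding \<nu>_def by (rule some_norm)
  interpret B: bounded_operator "carrier M" \<nu> "\<lambda>x. T x" by (rule bounded_operator_T[OF \<nu> ne])
  have "spectral_norm (carrier M) \<nu> (\<lambda>x. T x) < 1 / t"
    using t by (simp add: T_spectral_norm_def \<nu>_def field_simps)
  then obtain \<beta> where \<beta>: "spectral_norm (carrier M) \<nu> (\<lambda>x. T x) < \<beta>" "\<beta> < 1 / t" using dense by blast
  have pos: "\<beta> > 0" using B.spectral_norm_nonneg \<beta> by linarith
  obtain C where C: "C > 0" "\<And>i x. x \<in> carrier M \<Longrightarrow> \<nu> (((\<lambda>x. T x) ^^ i) x) \<le> C * \<beta> ^ i * \<nu> x"
    using B.spectral_norm_lessD[OF \<beta>(1)] by blast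
  obtain D where D: "D > 0" "\<And>x. x \<in> carrier M \<Longrightarrow> v (fps_nth (h x) 0) \<le> D * \<nu> x"
  proof (rule norm_dominates[OF \<nu>, of "\<lambda>x. v (fps_nth (h x) 0)"])
    show "v (fps_nth (h (x \<oplus> y)) 0) \<le> max (v (fps_nth (h x) 0)) (v (fps_nth (h y) 0))"
      if "x \<in> carrier M" "y \<in> carrier M" for x y
      using fps_homD(2)[OF h that] abs_ultrametric by simp
    show "\<exists>K. \<forall>c. v (fps_nth (h ([:c:] \<cdot> x)) 0) \<le> v c * K" if "x \<in> carrier M" for x
      using fps_homD(4)[OF h that] by (auto simp: abs_mult taylor_def)
  qed blast
  have "gauss_bound v (1 / \<beta>) (D * C * \<nu> x) (h x)"
    unfolding gauss_bound_def
  proof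
    fix i
    have "v (fps_nth (h x) i) \<le> D * \<nu> (((\<lambda>x. T x) ^^ i) x)"
      using D(2)[OF Tpow_closed[OF x]] fps_hom_coeff[OF h x, of i] by (simp add: v_divide)
    also have "\<dots> \<le> D * (C * \<beta> ^ i * \<nu> x)" using C(2)[OF x, of i] D(1) by (intro mult_left_mono) auto
    finally show "v (fps_nth (h x) i) * (1 / \<beta>) ^ i \<le> D * C * \<nu> x"
      using pos by (simp add: field_simps)
  qed
  moreover have "t < 1 / \<beta>" using pos \<beta>(2) t(1) by (simp add: field_simps)
  ultimately show ?thesis using fps_overconv_iff by blast
qed

text \<open>\<open>T_spectral_norm\<close> is evaluated in a norm fixed by choice. Equivalence of
  norms turns the estimate in \<open>\<mu>\<close> into one with the constant \<open>C * D\<close>,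
  which the spectral norm ignores.\<close>

lemma T_spectral_norm_le:
  assumes \<mu>: "module_norm v M \<mu>" and ne: "carrier M \<noteq> {\<zero>}" and b: "0 \<le> b"
    and T: "\<And>x. x \<in> carrier M \<Longrightarrow> \<mu> (T x) \<le> b * \<mu> x"
  shows "T_spectral_norm v M \<le> b"
proof -
  define \<nu> where "\<nu> = (SOME \<nu>. module_norm v M \<nu>)"
  have \<nu>: "module_norm v M \<nu>" unfolding \<nu>_def by (rule some_norm)
  interpret B: bounded_operator "carrier M" \<nu> "\<lambda>x. T x" by (rule bounded_operator_T[OF \<nu> ne])
  have equiv: "\<exists>C>0. \<forall>x\<in>carrier M. \<nu>2 x \<le> C * \<nu>1 x"
    if "module_norm v M \<nu>1" "module_norm v M \<nu>2" for \<nu>1 \<nu>2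
    using norm_dominates[OF that(1), of \<nu>2] module_normD(3,4)[OF that(2)] by (metis order_refl)
  obtain C where C: "C > 0" "\<And>x. x \<in> carrier M \<Longrightarrow> \<nu> x \<le> C * \<mu> x" using equiv[OF \<mu> \<nu>] by blast
  obtain D where D: "D > 0" "\<And>x. x \<in> carrier M \<Longrightarrow> \<mu> x \<le> D * \<nu> x" using equiv[OF \<nu> \<mu>] by blast
  have pow: "\<mu> (((\<lambda>x. T x) ^^ i) x) \<le> b ^ i * \<mu> x" if "x \<in> carrier M" for i x
  proof (induction i)
    case (Suc i)
    have "\<mu> (((\<lambda>x. T x) ^^ Suc i) x) \<le> b * \<mu> (((\<lambda>x. T x) ^^ i) x)" using T[OF Tpow_closed[OF that]] by simp
    also have "\<dots> \<le> b * (b ^ i * \<mu> x)" using Suc b by (rule mult_left_mono)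
    finally show ?case by (simp add: mult_ac)
  qed simp
  have "spectral_norm (carrier M) \<nu> (\<lambda>x. T x) \<le> b"
  proof (rule B.spectral_norm_leI[OF b])
    fix i x assume x: "x \<in> carrier M"
    have "\<nu> (((\<lambda>x. T x) ^^ i) x) \<le> C * \<mu> (((\<lambda>x. T x) ^^ i) x)" by (rule C(2)[OF Tpow_closed[OF x]])
    also have "\<dots> \<le> C * (b ^ i * \<mu> x)" using pow[OF x] C(1) by simp
    also have "\<dots> \<le> C * (b ^ i * (D * \<nu> x))" using D(2)[OF x] C(1) b by (simp add: mult_left_mono)
    finally show "\<nu> (((\<lambda>x. T x) ^^ i) x) \<le> C * D * b ^ i * \<nu> x" by (simp add: mult_ac)
  qed
  thus ?thesis by (simp add: T_spectral_norm_def \<nu>_def)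
qed

text \<open>The Gauss norm of \<open>g\<close> at a radius slightly larger than \<open>t\<close> is a norm on \<open>M\<close> for which \<open>T\<close>
  is strictly contracting by \<open>1 / t\<close>.\<close>

lemma overconv_solution_spectral:
  assumes irr: "irreducible_module (twisted_ring \<delta>) M"
    and t: "0 < t" "t * spectral_norm UNIV v \<delta> < 1"
    and g: "fps_hom \<delta> M (fps_overconv v t) g" and g_ne: "x0 \<in> carrier M" "g x0 \<noteq> 0"
  shows "T_spectral_norm v M * t < 1"
proof -
  let ?\<sigma> = "spectral_norm UNIV v \<delta>"
  \<comment> \<open>One radius above \<open>t\<close> has to serve all of \<open>M\<close>; along
    the finite span it is a minimum of finitely many.\<close>
  have "\<exists>s>t. s * ?\<sigma> < 1 \<and> (\<forall>x\<in>W. g x \<in> fps_bounded v s)" if "fin_span M W" for W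
    using that
  proof (induction rule: fin_span_strict_induct)
    case zero
    obtain s where "t < s" "s * ?\<sigma> < 1" using radius_margin[OF t(2), of "t + 1"] by auto
    thus ?case using fps_hom_zero[OF g] gauss_bound_0 by (auto simp: fps_bounded_iff)
  next
    case (adjoin W e)
    note WD = subspaceD[OF adjoin.hyps(2)] and e = adjoin.hyps(3)
    obtain s1 where s1: "s1 > t" "s1 * ?\<sigma> < 1" "\<And>x. x \<in> W \<Longrightarrow> g x \<in> fps_bounded v s1" using adjoin.IH by blast
    obtain s2 where s2: "s2 > t" "g e \<in> fps_bounded v s2" using fps_overconvE[OF t fps_homD(1)[OF g e]] by blast
    define s where "s = min s1 s2"
    have s: "t < s" "0 < s" "s \<le> s1" "s \<le> s2" using s1 s2 t by (auto simp: s_def)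
    have s\<sigma>: "s * ?\<sigma> < 1" using mult_right_mono[OF s(3) spectral_derivation_nonneg] s1(2) by linarith
    have "g x \<in> fps_bounded v s" if x: "x \<in> adjoin M W e" for x
    proof -
      obtain w c where wc: "w \<in> W" "x = w \<oplus> [:c:] \<cdot> e" using x unfolding adjoin_def by blast
      have w: "w \<in> carrier M" using wc WD(1) by blast
      have "g x = g w + fps_act [:c:] (g e)"
        using fps_homD(2)[OF g w act_closed[OF e]] fps_homD(3)[OF g e] by (simp add: wc)
      thus ?thesis
        using s s\<sigma> s1(3)[OF wc(1)] s2(2)
        by (metis fps_bounded_add fps_bounded_act fps_bounded_antimono)
    qed
    thus ?case using s s\<sigma> by blast
  qed
  from this[OF fin_span_carrier] obtain s where s: "t < s" "s * ?\<sigma> < 1"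
    and bd: "\<And>x. x \<in> carrier M \<Longrightarrow> g x \<in> fps_bounded v s" by blast
  have pos: "s > 0" using s t by simp
  have ne: "carrier M \<noteq> {\<zero>}" using irr by (simp add: irreducible_module_def)
  have "{x \<in> carrier M. g x = 0} = {\<zero>} \<or> {x \<in> carrier M. g x = 0} = carrier M"
    using irr fps_hom_kernel[OF g] unfolding irreducible_module_def by blast
  hence inj: "g x = 0 \<longleftrightarrow> x = \<zero>" if "x \<in> carrier M" for x using g_ne that fps_hom_zero[OF g] by blast
  define \<mu> where "\<mu> x = gauss_norm v s (g x)" for x
  have B: "gauss_bound v s (\<mu> x) (g x)" if "x \<in> carrier M" for x
    unfolding \<mu>_def by (rule gauss_norm_bound[OF bd[OF that]])
  have nonneg: "0 \<le> \<mu> x" if "x \<in> carrier M" for x using gauss_bound_nonneg[OF B[OF that]] .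
  \<comment> \<open>Only an inequality is immediate; applied to \<open>1 / c\<close> it yields the
    reverse one, so that \<open>\<mu>\<close> is homogeneous.\<close>
  have le_sc: "\<mu> ([:c:] \<cdot> x) \<le> v c * \<mu> x" if x: "x \<in> carrier M" for c x
    unfolding \<mu>_def[of "[:c:] \<cdot> x"] fps_homD(4)[OF g x]
    by (intro gauss_norm_le gauss_bound_mult[OF pos taylor_bound[OF pos s(2)] B[OF x]])
  have "module_norm v M \<mu>"
    unfolding module_norm_def
  proof (intro conjI ballI allI)
    fix x assume x: "x \<in> carrier M"
    show "0 \<le> \<mu> x" by (rule nonneg[OF x])
    show "\<mu> x = 0 \<longleftrightarrow> x = \<zero>"
    proof
      assume "\<mu> x = 0"
      hence "v (fps_nth (g x) i) * s ^ i \<le> 0" for i using B[OF x] by (simp add: gauss_bound_def)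
      hence "v (fps_nth (g x) i) = 0" for i
        using abs_nonneg[of "fps_nth (g x) i"] zero_less_power[OF pos, of i]
        by (metis mult_le_0_iff not_le order.antisym)
      hence "g x = 0" by (intro fps_ext) (simp add: abs_eq_0)
      thus "x = \<zero>" using inj[OF x] by simp
    next
      assume "x = \<zero>"
      hence "\<mu> x \<le> 0" unfolding \<mu>_def using fps_hom_zero[OF g] gauss_bound_0 by (auto intro: gauss_norm_le)
      thus "\<mu> x = 0" using nonneg[OF x] by simp
    qed
    show "\<mu> ([:c:] \<cdot> x) = v c * \<mu> x" for c
    proof (cases "c = 0")
      case True
      have "\<mu> ([:c:] \<cdot> x) \<le> 0" using le_sc[OF x, of c] True by simp
      hence "\<mu> ([:c:] \<cdot> x) = 0" using nonneg[OF act_closed[OF x], of "[:c:]"] by linarith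
      thus ?thesis using True by (simp only: v_0 mult_zero_left)
    next
      case False
      have "\<mu> x = \<mu> ([:1 / c:] \<cdot> [:c:] \<cdot> x)" using x False by (simp add: sc_sc)
      also have "\<dots> \<le> v (1 / c) * \<mu> ([:c:] \<cdot> x)" by (rule le_sc[OF act_closed[OF x]])
      finally have "v c * \<mu> x \<le> \<mu> ([:c:] \<cdot> x)" using v_pos[OF False] by (simp add: v_divide field_simps)
      thus ?thesis using le_sc[OF x, of c] by simp
    qed
    fix y assume y: "y \<in> carrier M"
    show "\<mu> (x \<oplus> y) \<le> max (\<mu> x) (\<mu> y)"
      unfolding \<mu>_def[of "x \<oplus> y"] fps_homD(2)[OF g x y]
      by (intro gauss_norm_le gauss_bound_add[OF pos] gauss_bound_mono[OF B[OF x]] gauss_bound_mono[OF B[OF y]]) auto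
  qed
  moreover have "\<mu> (T x) \<le> 1 / s * \<mu> x" if x: "x \<in> carrier M" for x
    unfolding \<mu>_def[of "T x"] fps_hom_T[OF g x] using gauss_norm_le[OF gauss_bound_deriv[OF pos B[OF x]]] by simp
  ultimately have "T_spectral_norm v M \<le> 1 / s" using pos ne by (intro T_spectral_norm_le[of \<mu>]) auto
  hence "T_spectral_norm v M * t \<le> 1 / s * t" using t(1) by (intro mult_right_mono) auto
  also have "\<dots> < 1" using s pos by simp
  finally show ?thesis .
qed

text \<open>The commutator of \<open>T\<close> with a constant \<open>c\<close> is
  \<open>\<delta> c\<close>, so an iterated derivative of \<open>c\<close> is an iterated
  commutator, a combination of products \<open>T^a c T^b\<close> with integer coefficients. The
  ultrametric inequality then bounds its growth by that of the powers of \<open>T\<close>.\<close>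

lemma spectral_derivation_le_T:
  assumes ne: "carrier M \<noteq> {\<zero>}"
  shows "spectral_norm UNIV v \<delta> \<le> T_spectral_norm v M"
proof (rule ccontr)
  assume less: "\<not> ?thesis"
  define \<nu> where "\<nu> = (SOME \<nu>. module_norm v M \<nu>)"
  have \<nu>: "module_norm v M \<nu>" unfolding \<nu>_def by (rule some_norm)
  interpret B: bounded_operator "carrier M" \<nu> "\<lambda>x. T x" by (rule bounded_operator_T[OF \<nu> ne])
  interpret K: bounded_operator UNIV v \<delta> by (rule bounded_operator_derivation)
  let ?P = "\<lambda>i. (\<lambda>x. T x) ^^ i"
  have "spectral_norm (carrier M) \<nu> (\<lambda>x. T x) < spectral_norm UNIV v \<delta>"
    using less by (simp add: T_spectral_norm_def \<nu>_def)
  then obtain \<beta> where \<beta>: "spectral_norm (carrier M) \<nu> (\<lambda>x. T x) < \<beta>" "\<beta> < spectral_norm UNIV v \<delta>"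
    using dense by blast
  have pos: "\<beta> > 0" using B.spectral_norm_nonneg \<beta> by linarith
  obtain C where C: "C > 0" "\<And>i x. x \<in> carrier M \<Longrightarrow> \<nu> (?P i x) \<le> C * \<beta> ^ i * \<nu> x"
    using B.spectral_norm_lessD[OF \<beta>(1)] by blast
  obtain x where x: "x \<in> carrier M" "\<nu> x > 0"
    using B.nontrivial B.nonneg by (metis order.not_eq_order_implies_strict)
  have Tpow_diff: "?P a (y \<ominus> z) = ?P a y \<ominus> ?P a z" if "y \<in> carrier M" "z \<in> carrier M" for a y z
    by (induction a) (use that in \<open>auto simp: act_diff_right Tpow_closed\<close>)
  \<comment> \<open>Powers of \<open>T\<close> on either side make the induction close: removing one
    \<open>\<delta>\<close> adds one \<open>T\<close> on the left or on the right and keeps the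
    exponent of \<open>\<beta>\<close>. Each side is estimated once, hence
    \<open>C * C\<close>.\<close>
  have bound: "\<nu> (?P a ([:(\<delta> ^^ i) c:] \<cdot> ?P b x)) \<le> C * C * \<beta> ^ (a + i + b) * v c * \<nu> x" for a b i c
  proof (induction i arbitrary: a b)
    case 0
    have "\<nu> (?P a ([:c:] \<cdot> ?P b x)) \<le> C * \<beta> ^ a * (v c * \<nu> (?P b x))"
      using C(2)[OF act_closed[OF Tpow_closed[OF x(1)]]] module_normD(3)[OF \<nu> Tpow_closed[OF x(1)]] by metis
    also have "\<dots> \<le> C * \<beta> ^ a * (v c * (C * \<beta> ^ b * \<nu> x))"
      using C pos x abs_nonneg by (intro mult_left_mono) auto
    finally show ?case by (simp add: power_add mult_ac)
  next
    case (Suc i)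
    let ?y = "?P b x" and ?d = "(\<delta> ^^ i) c"
    have y: "?y \<in> carrier M" by (rule Tpow_closed[OF x(1)])
    have "[:\<delta> ?d:] \<cdot> ?y = T ([:?d:] \<cdot> ?y) \<ominus> [:?d:] \<cdot> T ?y"
      using y by (simp add: T_sc group_simps)
    hence "?P a ([:\<delta> ?d:] \<cdot> ?y) = ?P a (T ([:?d:] \<cdot> ?y)) \<ominus> ?P a ([:?d:] \<cdot> T ?y)"
      using Tpow_diff y by simp
    hence "?P a ([:(\<delta> ^^ Suc i) c:] \<cdot> ?y) = ?P (Suc a) ([:?d:] \<cdot> ?P b x) \<ominus> ?P a ([:?d:] \<cdot> ?P (Suc b) x)"
      by (simp add: funpow_swap1)
    hence "\<nu> (?P a ([:(\<delta> ^^ Suc i) c:] \<cdot> ?y)) \<le>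
        max (\<nu> (?P (Suc a) ([:?d:] \<cdot> ?P b x))) (\<nu> (?P a ([:?d:] \<cdot> ?P (Suc b) x)))"
      using norm_diff[OF \<nu> Tpow_closed[OF act_closed[OF Tpow_closed[OF x(1)]]]
          Tpow_closed[OF act_closed[OF Tpow_closed[OF x(1)]]], of "Suc a" "[:?d:]" b a "[:?d:]" "Suc b"] by metis
    also have "\<dots> \<le> C * C * \<beta> ^ (a + Suc i + b) * v c * \<nu> x"
      using Suc[of "Suc a" b] Suc[of a "Suc b"] by (intro max.boundedI) simp_all
    finally show ?case .
  qed
  have "v ((\<delta> ^^ i) c) \<le> C * C * \<beta> ^ i * v c" for i c
    using bound[of 0 i c 0] x module_normD(3)[OF \<nu> x(1)] by simp
  hence "spectral_norm UNIV v \<delta> \<le> \<beta>" using pos by (intro K.spectral_norm_leI[where C = "C * C"]) auto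
  thus False using \<beta>(2) by simp
qed

end

section \<open>Extension of solutions\<close>

context diff_module
begin

abbreviation tmult (infixl \<open>\<odot>t\<close> 70) where "p \<odot>t q \<equiv> twisted_act Polynomial.smult (T_mult \<delta>) p q"

lemma degree_T_mult:
  assumes "q \<noteq> 0"
  shows "degree (T_mult \<delta> q) = Suc (degree q)" "coeff (T_mult \<delta> q) (Suc (degree q)) = lead_coeff q"
proof -
  have "degree (map_poly \<delta> q) \<le> degree q" 
    by (rule degree_le) (simp add: coeff_map_poly d_zero coeff_eq_0)
  moreover have "degree (pCons 0 q) = Suc (degree q)" using assms by simp
  ultimately show "degree (T_mult \<delta> q) = Suc (degree q)" by (simp add: T_mult_def degree_add_eq_left)
  show "coeff (T_mult \<delta> q) (Suc (degree q)) = lead_coeff q"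
    by (simp add: T_mult_def coeff_map_poly d_zero coeff_eq_0)
qed

lemma degree_T_mult_pow:
  assumes "q \<noteq> 0"
  shows "degree ((T_mult \<delta> ^^ m) q) = degree q + m \<and> coeff ((T_mult \<delta> ^^ m) q) (degree q + m) = lead_coeff q
    \<and> (T_mult \<delta> ^^ m) q \<noteq> 0"
proof (induction m)
  case (Suc m)
  have "(T_mult \<delta> ^^ m) q \<noteq> 0" using Suc by simp
  from degree_T_mult[OF this] show ?case
    using Suc assms by (auto simp del: leading_coeff_0_iff)
qed (use assms in auto)

text \<open>\<open>T^m P\<close> has the leading coefficient of \<open>P\<close>, so some
  \<open>c T^m P\<close> cancels the leading term of \<open>q\<close>, and the difference still
  sends \<open>e\<close> into \<open>U\<close>. Minimality of \<open>P\<close> supplies the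
  inequality of degrees that each reduction requires.\<close>

lemma twisted_division:
  assumes U: "Module.submodule U (twisted_ring \<delta>) M" and e: "e \<in> carrier M"
    and P: "P \<noteq> 0" "P \<cdot> e \<in> U" and min: "\<And>q. q \<noteq> 0 \<Longrightarrow> q \<cdot> e \<in> U \<Longrightarrow> degree P \<le> degree q"
    and q: "q \<cdot> e \<in> U"
  obtains u where "q = u \<odot>t P"
proof -
  interpret R: twisted_action \<delta> Polynomial.smult "T_mult \<delta>" by (rule twisted_action_poly)
  have "\<exists>u. q = u \<odot>t P" using q
  proof (induction "degree q" arbitrary: q rule: less_induct)
    case less
    show ?case
    proof (cases "q = 0")
      case True
      thus ?thesis using R.act_0[of P] by metis
    next
      case False
      define m where "m = degree q - degree P"
      have deg: "degree q = degree P + m" using min[OF False less.prems] by (simp add: m_def)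
      define c where "c = lead_coeff q / lead_coeff P"
      have c: "c \<noteq> 0" using False P by (simp add: c_def)
      define S where "S = Polynomial.smult c ((T_mult \<delta> ^^ m) P)"
      have S: "S = monom c m \<odot>t P"
        unfolding S_def twisted_act_def using c by (simp add: degree_monom_eq if_distrib[of "\<lambda>z. Polynomial.smult z _"] cong: if_cong)
      have degS: "degree S = degree q" "coeff S (degree q) = lead_coeff q"
        using degree_T_mult_pow[OF P(1), of m] c P by (auto simp: S_def deg c_def)
      have "S \<cdot> e \<in> U" unfolding S using act_mult[OF e] submoduleD(3)[OF U P(2)] by simp
      hence qS: "(q - S) \<cdot> e \<in> U"
        using act_diff_left[OF e] less.prems subspaceD(6)[OF submoduleD(1)[OF U]] by simp
      \<comment> \<open>For a constant \<open>q\<close> the degree cannot drop; equal leading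
        coefficients already make the difference \<open>0\<close>.\<close>
      have "q - S = 0 \<or> degree (q - S) < degree q"
      proof (cases "degree q = 0")
        case True
        hence "q - S = 0" using degS degree_0_id[of q] degree_0_id[of S] by (metis diff_self)
        thus ?thesis by blast
      next
        case False
        have "degree (q - S) \<le> degree q" using degree_diff_le[of q "degree q" S] degS by simp
        moreover have "coeff (q - S) (degree q) = 0" using degS by simp
        ultimately show ?thesis using False by (metis degree_0 le_neq_implies_less leading_coeff_0_iff)
      qed
      then obtain u where "q - S = u \<odot>t P" using less.hyps[OF _ qS] R.act_0[of P] by metis
      hence "q = (u + monom c m) \<odot>t P" using S R.act_add_left by (metis diff_add_cancel)
      thus ?thesis by blast
    qed
  qed
  thus ?thesis using that by blast
qed

end

context fd_diff_module
begin

text \<open>The subspaces generated by \<open>U\<close> and the first \<open>j\<close> iterates of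
  \<open>T\<close> on \<open>e\<close> increase with \<open>j\<close> and must become stationary.
  There the next iterate is redundant, which is a relation with leading term
  \<open>T^j\<close>.\<close>

lemma annihilator_nonzero:
  assumes U: "Module.submodule U (twisted_ring \<delta>) M" and e: "e \<in> carrier M"
  obtains P where "P \<noteq> 0" "P \<cdot> e \<in> U"
proof -
  note UD = subspaceD[OF submoduleD(1)[OF U]]
  define W where "W j = {u \<oplus> q \<cdot> e | u q. u \<in> U \<and> (\<forall>i\<ge>j. coeff q i = 0)}" for j :: nat
  have W: "subspace_of M (W j)" for j
    unfolding subspace_of_def
  proof (intro conjI ballI allI)
    show "W j \<subseteq> carrier M" using UD(1) e by (auto simp: W_def)
    show "\<zero> \<in> W j" unfolding W_def using UD(2) e by (auto intro!: exI[of _ \<zero>] exI[of _ 0])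
    fix x assume "x \<in> W j"
    then obtain u q where x: "u \<in> U" "\<forall>i\<ge>j. coeff q i = 0" "x = u \<oplus> q \<cdot> e" by (auto simp: W_def)
    have u: "u \<in> carrier M" using x UD(1) by blast
    have "[:c:] \<cdot> x = [:c:] \<cdot> u \<oplus> Polynomial.smult c q \<cdot> e" for c
      using u e by (simp add: x act_add_right smult_act)
    thus "[:c:] \<cdot> x \<in> W j" for c using UD(4)[OF x(1)] x(2) unfolding W_def by fastforce
    fix y assume "y \<in> W j"
    then obtain u' q' where y: "u' \<in> U" "\<forall>i\<ge>j. coeff q' i = 0" "y = u' \<oplus> q' \<cdot> e" by (auto simp: W_def)
    have u': "u' \<in> carrier M" using y UD(1) by blast
    have "x \<oplus> y = (u \<oplus> u') \<oplus> (q + q') \<cdot> e" using u u' e by (simp add: x y act_add_left M.a_ac)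
    thus "x \<oplus> y \<in> W j" using UD(3)[OF x(1) y(1)] x(2) y(2) unfolding W_def by fastforce
  qed
  obtain V where V: "\<exists>j. V = W j" and max: "\<And>V'. \<exists>j. V' = W j \<Longrightarrow> V \<subseteq> V' \<Longrightarrow> V' = V"
    by (rule maximal_subspace[of "\<lambda>V. \<exists>j. V = W j" "W 0"]) (use W in auto)
  obtain j where j: "V = W j" using V by blast
  have "W j \<subseteq> W (Suc j)" unfolding W_def using Suc_leD by blast
  hence eq: "W (Suc j) = W j" using max j by blast
  have "monom 1 j \<cdot> e = \<zero> \<oplus> monom 1 j \<cdot> e" using e by simp
  hence "monom 1 j \<cdot> e \<in> W (Suc j)" unfolding W_def using UD(2) by fastforce
  then obtain u q where u: "u \<in> U" "\<forall>i\<ge>j. coeff q i = 0" "monom 1 j \<cdot> e = u \<oplus> q \<cdot> e"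
    unfolding eq by (auto simp: W_def)
  have "(monom 1 j - q) \<cdot> e = u"
    using u e UD(1) by (auto simp: act_diff_left M.minus_eq M.a_assoc M.r_neg)
  moreover have "coeff (monom 1 j - q) j = 1" using u(2) by simp
  hence "monom 1 j - q \<noteq> 0" by (metis coeff_0 zero_neq_one)
  ultimately show ?thesis using that u(1) by blast
qed

text \<open>The image \<open>F\<close> of \<open>e\<close> may be any solution of
  \<open>fps_act P F = h (P \<cdot> e)\<close>, where \<open>P\<close> has least degree among the
  nonzero polynomials that send \<open>e\<close> into \<open>U\<close>: every other relation is a
  left multiple of this one. Solvability inside \<open>fps_overconv v t\<close> is
  \<open>twisted_poly_surj\<close>.\<close>

lemma adjoin_cyclic_hom:
  assumes U: "Module.submodule U (twisted_ring \<delta>) M" and e: "e \<in> carrier M"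
    and t: "0 < t" "t * spectral_norm UNIV v \<delta> < 1"
    and h: "fps_hom \<delta> (M\<lparr>carrier := U\<rparr>) (fps_overconv v t) h"
  obtains U' h' where "Module.submodule U' (twisted_ring \<delta>) M" "U \<subseteq> U'" "e \<in> U'"
    "fps_hom \<delta> (M\<lparr>carrier := U'\<rparr>) (fps_overconv v t) h'" "\<And>x. x \<in> U \<Longrightarrow> h' x = h x"
proof -
  interpret A: twisted_action \<delta> "\<lambda>c F. taylor \<delta> c * F" fps_deriv by (rule twisted_action_fps)
  note UD = subspaceD[OF submoduleD(1)[OF U]]
  have UM: "x \<in> U \<Longrightarrow> x \<in> carrier M" for x using UD(1) by blast
  have h_add: "h (x \<oplus> y) = h x + h y" if "x \<in> U" "y \<in> U" for x y using fps_homD(2)[OF h] that by simp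
  have h_act: "h (p \<cdot> x) = fps_act p (h x)" if "x \<in> U" for p x using fps_homD(3)[OF h] that by simp
  have h_in: "h x \<in> fps_overconv v t" if "x \<in> U" for x using fps_homD(1)[OF h] that by simp
  define J where "J = {q. q \<noteq> 0 \<and> q \<cdot> e \<in> U}"
  obtain P0 where "P0 \<noteq> 0" "P0 \<cdot> e \<in> U" by (rule annihilator_nonzero[OF U e])
  hence "P0 \<in> J" by (simp add: J_def)
  then obtain P where P: "P \<in> J" and min: "\<And>q. q \<in> J \<Longrightarrow> degree P \<le> degree q"
    using ex_has_least_nat[of "\<lambda>q. q \<in> J" P0 degree] by metis
  have P0: "P \<noteq> 0" and Pe: "P \<cdot> e \<in> U" using P by (auto simp: J_def)
  obtain F where F: "F \<in> fps_overconv v t" "fps_act P F = h (P \<cdot> e)"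
    by (rule twisted_poly_surj[OF P0 t h_in[OF Pe]])
  have rel: "fps_act q F = h (q \<cdot> e)" if q: "q \<cdot> e \<in> U" for q
  proof -
    obtain u where u: "q = u \<odot>t P"
      by (rule twisted_division[OF U e P0 Pe _ q]) (use min in \<open>auto simp: J_def\<close>)
    have "fps_act q F = fps_act u (h (P \<cdot> e))" unfolding u by (simp add: A.act_mult F)
    also have "\<dots> = h (q \<cdot> e)" unfolding u using h_act[OF Pe] act_mult[OF e] by simp
    finally show ?thesis .
  qed
  define U' where "U' = {u \<oplus> q \<cdot> e | u q. u \<in> U}"
  have U'I: "u \<oplus> q \<cdot> e \<in> U'" if "u \<in> U" for u q using that by (auto simp: U'_def)
  \<comment> \<open>Two representations of one vector differ by a relation \<open>q - q'\<close> on
    \<open>e\<close>, to which \<open>rel\<close> applies.\<close>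
  have wd: "h u + fps_act q F = h u' + fps_act q' F"
    if u: "u \<in> U" "u' \<in> U" and eq: "u \<oplus> q \<cdot> e = u' \<oplus> q' \<cdot> e" for u u' q q'
  proof -
    have "(q - q') \<cdot> e = (u \<oplus> q \<cdot> e) \<ominus> (u \<oplus> q' \<cdot> e)"
      using UM[OF u(1)] e by (simp add: act_diff_left group_simps)
    also have "\<dots> = u' \<ominus> u" unfolding eq using UM[OF u(1)] UM[OF u(2)] e by (simp add: group_simps)
    finally have d: "(q - q') \<cdot> e = u' \<ominus> u" .
    hence "fps_act (q - q') F = h (u' \<ominus> u)" using rel UD(6)[OF u(2) u(1)] by simp
    also have "\<dots> = h u' - h u"
      using h_add[OF UD(6)[OF u(2) u(1)] u(1)] UM[OF u(1)] UM[OF u(2)] by (simp add: group_simps)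
    finally have "fps_act (q - q') F + fps_act q' F = h u' - h u + fps_act q' F" by simp
    thus ?thesis using A.act_add_left[of "q - q'" q' F] by (simp add: algebra_simps)
  qed
  define h' where "h' x = (SOME F'. \<exists>u q. u \<in> U \<and> x = u \<oplus> q \<cdot> e \<and> F' = h u + fps_act q F)" for x
  have h': "h' (u \<oplus> q \<cdot> e) = h u + fps_act q F" if "u \<in> U" for u q
    unfolding h'_def
  proof (rule some_equality)
    show "\<exists>u' q'. u' \<in> U \<and> u \<oplus> q \<cdot> e = u' \<oplus> q' \<cdot> e \<and> h u + fps_act q F = h u' + fps_act q' F"
      using that by blast
    fix F' assume "\<exists>u' q'. u' \<in> U \<and> u \<oplus> q \<cdot> e = u' \<oplus> q' \<cdot> e \<and> F' = h u' + fps_act q' F"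
    then obtain u' q' where "u' \<in> U" "u \<oplus> q \<cdot> e = u' \<oplus> q' \<cdot> e" "F' = h u' + fps_act q' F" by blast
    thus "F' = h u + fps_act q F" using wd[OF that] by metis
  qed
  have add_eq: "(u \<oplus> q \<cdot> e) \<oplus> (u' \<oplus> q' \<cdot> e) = (u \<oplus> u') \<oplus> (q + q') \<cdot> e" if "u \<in> U" "u' \<in> U" for u u' q q'
    using UM[OF that(1)] UM[OF that(2)] e by (simp add: act_add_left M.a_ac)
  have act_eq: "p \<cdot> (u \<oplus> q \<cdot> e) = p \<cdot> u \<oplus> (p \<odot>t q) \<cdot> e" if "u \<in> U" for p u q
    using UM[OF that] e by (simp add: act_add_right act_mult)
  have U': "Module.submodule U' (twisted_ring \<delta>) M"
    unfolding submodule_iff subspace_of_def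
  proof (intro conjI ballI allI)
    show "U' \<subseteq> carrier M" using UM e by (auto simp: U'_def)
    show "\<zero> \<in> U'" using U'I[OF UD(2), of 0] e by simp
    show "x \<oplus> y \<in> U'" if "x \<in> U'" "y \<in> U'" for x y
      using that add_eq UD(3) unfolding U'_def by blast
    show "[:c:] \<cdot> x \<in> U'" "T x \<in> U'" if "x \<in> U'" for c x
      using that act_eq submoduleD(3)[OF U] unfolding U'_def by blast+
  qed
  have U_sub: "U \<subseteq> U'"
  proof
    fix u assume "u \<in> U" thus "u \<in> U'" using U'I[of u 0] UM e by simp
  qed
  have ext: "h' x = h x" if "x \<in> U" for x
    using h'[OF that, of 0] UM[OF that] e by (simp add: A.act_0)
  have "e \<in> U'" using U'I[OF UD(2), of 1] e by simp
  moreover have "fps_hom \<delta> (M\<lparr>carrier := U'\<rparr>) (fps_overconv v t) h'"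
    unfolding fps_hom_def
  proof (intro conjI ballI allI; simp)
    fix x assume "x \<in> U'"
    then obtain u q where x: "u \<in> U" "x = u \<oplus> q \<cdot> e" by (auto simp: U'_def)
    show "h' x \<in> fps_overconv v t"
      using h'[OF x(1)] x(2) fps_overconv_add[OF t h_in[OF x(1)] fps_overconv_act[OF t F(1)]] by simp
    show "h' (p \<cdot> x) = fps_act p (h' x)" for p
      using h'[OF x(1)] h'[OF submoduleD(3)[OF U x(1)]] act_eq[OF x(1)] h_act[OF x(1)]
      by (simp add: x(2) A.act_add_right A.act_mult)
    fix y assume "y \<in> U'"
    then obtain u' q' where y: "u' \<in> U" "y = u' \<oplus> q' \<cdot> e" by (auto simp: U'_def)
    show "h' (x \<oplus> y) = h' x + h' y"
      using h'[OF x(1)] h'[OF y(1)] h'[OF UD(3)[OF x(1) y(1)]] add_eq[OF x(1) y(1)] h_add[OF x(1) y(1)]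
      by (simp add: x(2) y(2) A.act_add_left)
  qed
  ultimately show ?thesis using that U' U_sub ext by blast
qed

text \<open>Overconvergent series behave as an injective object for finite-dimensional modules: a
  maximal domain of extension exists by the chain condition and absorbs every
  \<open>e\<close>.\<close>

lemma solution_extends:
  assumes N: "Module.submodule N (twisted_ring \<delta>) M"
    and t: "0 < t" "t * spectral_norm UNIV v \<delta> < 1"
    and h: "fps_hom \<delta> (M\<lparr>carrier := N\<rparr>) (fps_overconv v t) h"
  obtains h' where "fps_hom \<delta> M (fps_overconv v t) h'" "\<And>x. x \<in> N \<Longrightarrow> h' x = h x"
proof -
  let ?Q = "\<lambda>U. Module.submodule U (twisted_ring \<delta>) M \<and> N \<subseteq> U \<and>
    (\<exists>h'. fps_hom \<delta> (M\<lparr>carrier := U\<rparr>) (fps_overconv v t) h' \<and> (\<forall>x\<in>N. h' x = h x))"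
  obtain U where U: "?Q U" and max: "\<And>U'. ?Q U' \<Longrightarrow> U \<subseteq> U' \<Longrightarrow> U' = U"
    by (rule maximal_subspace[of ?Q N]) (use N h submoduleD(1) in auto)
  obtain h' where h': "fps_hom \<delta> (M\<lparr>carrier := U\<rparr>) (fps_overconv v t) h'" "\<forall>x\<in>N. h' x = h x" using U by blast
  have "carrier M \<subseteq> U"
  proof
    fix e assume e: "e \<in> carrier M"
    obtain U' h'' where U': "Module.submodule U' (twisted_ring \<delta>) M" "U \<subseteq> U'" "e \<in> U'"
      "fps_hom \<delta> (M\<lparr>carrier := U'\<rparr>) (fps_overconv v t) h''" "\<And>x. x \<in> U \<Longrightarrow> h'' x = h' x"
      using adjoin_cyclic_hom[OF conjunct1[OF U] e t h'(1)] by blast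
    have "?Q U'" using U' U h'(2) by (metis subset_iff)
    thus "e \<in> U" using max U' by blast
  qed
  hence "U = carrier M" using submoduleD(2) U by blast
  thus ?thesis using that h' by simp
qed

end

section \<open>Composition series\<close>

context fd_diff_module
begin

abbreviation submod :: "'b set \<Rightarrow> bool" where "submod N \<equiv> Module.submodule N (twisted_ring \<delta>) M"

abbreviation factor :: "'b set \<Rightarrow> 'b set \<Rightarrow> ('a poly, 'b set) module" where
  "factor U1 U \<equiv> quotient_module (M\<lparr>carrier := U1\<rparr>) U"

lemma irreducible_quotient:
  assumes N: "submod N" "N \<noteq> carrier M"
    and max: "\<And>N'. submod N' \<Longrightarrow> N \<subseteq> N' \<Longrightarrow> N' = N \<or> N' = carrier M"
  shows "irreducible_module (twisted_ring \<delta>) (quotient_module M N)"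
  unfolding irreducible_module_def
proof (intro conjI allI impI)
  let ?Q = "quotient_module M N" and ?\<pi> = "\<lambda>x. N +>\<^bsub>M\<^esub> x"
  note Q = quotient_carrier[OF N(1)] quotient_zero_iff[OF N(1)] quotient_add[OF N(1)] quotient_smult[OF N(1)]
  obtain x where "x \<in> carrier M" "x \<notin> N" using submoduleD(2)[OF N(1)] N(2) by blast
  thus "carrier ?Q \<noteq> {\<zero>\<^bsub>?Q\<^esub>}" using Q(1) Q(2)[of x] by blast
  fix S assume "Module.submodule S (twisted_ring \<delta>) ?Q"
  hence S: "S \<subseteq> carrier ?Q" "\<zero>\<^bsub>?Q\<^esub> \<in> S" "\<And>X Y. X \<in> S \<Longrightarrow> Y \<in> S \<Longrightarrow> X \<oplus>\<^bsub>?Q\<^esub> Y \<in> S"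
    "\<And>c X. X \<in> S \<Longrightarrow> [:c:] \<odot>\<^bsub>?Q\<^esub> X \<in> S" "\<And>X. X \<in> S \<Longrightarrow> [:0, 1:] \<odot>\<^bsub>?Q\<^esub> X \<in> S"
    unfolding diff_module.submodule_iff[OF diff_module_quotient[OF N(1)]] subspace_of_def by blast+
  define N' where "N' = {x \<in> carrier M. ?\<pi> x \<in> S}"
  have in_N: "?\<pi> x \<in> S" if "x \<in> N" for x using Q(2)[of x] submoduleD(2)[OF N(1)] that S(2) by auto
  have "submod N'"
    unfolding submodule_iff subspace_of_def N'_def
    using S(3,4,5) in_N[OF subspaceD(2)[OF submoduleD(1)[OF N(1)]]]
    by (auto simp flip: Q(3,4))
  moreover have "N \<subseteq> N'" using in_N submoduleD(2)[OF N(1)] by (auto simp: N'_def)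
  ultimately consider "N' = N" | "N' = carrier M" using max by blast
  thus "S = {\<zero>\<^bsub>?Q\<^esub>} \<or> S = carrier ?Q"
  proof cases
    case 1
    have "X = \<zero>\<^bsub>?Q\<^esub>" if X: "X \<in> S" for X
    proof -
      obtain x where x: "x \<in> carrier M" "X = ?\<pi> x" using X S(1) Q(1) by blast
      hence "x \<in> N" using 1 X by (auto simp: N'_def)
      thus ?thesis using Q(2)[OF x(1)] x(2) by simp
    qed
    thus ?thesis using S(2) by blast
  next
    case 2
    hence "carrier ?Q \<subseteq> S" using Q(1) by (auto simp: N'_def)
    thus ?thesis using S(1) by blast
  qed
qed

lemma composition_series_snoc:
  assumes U: "submod U" and U1: "submod U1" "U \<subseteq> U1"
    and Ns: "composition_series (twisted_ring \<delta>) (M\<lparr>carrier := U\<rparr>) Ns"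
    and irr: "irreducible_module (twisted_ring \<delta>) (factor U1 U)"
  shows "composition_series (twisted_ring \<delta>) (M\<lparr>carrier := U1\<rparr>) (Ns @ [U1])"
proof -
  have S: "Ns \<noteq> []" "hd Ns = {\<zero>}" "last Ns = U"
    "\<And>N. N \<in> set Ns \<Longrightarrow> Module.submodule N (twisted_ring \<delta>) (M\<lparr>carrier := U\<rparr>)"
    "\<And>i. Suc i < length Ns \<Longrightarrow> Ns ! i \<subseteq> Ns ! Suc i \<and>
       irreducible_module (twisted_ring \<delta>) (factor (Ns ! Suc i) (Ns ! i))"
    using Ns by (auto simp: composition_series_def composition_factor_def)
  show ?thesis
    unfolding composition_series_def composition_factor_def
  proof (intro conjI ballI allI impI)
    show "hd (Ns @ [U1]) = {\<zero>\<^bsub>M\<lparr>carrier := U1\<rparr>\<^esub>}" using S by simp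
    fix N assume "N \<in> set (Ns @ [U1])"
    thus "Module.submodule N (twisted_ring \<delta>) (M\<lparr>carrier := U1\<rparr>)"
      using S(4) U1 submodule_restrict_iff[OF U] submodule_restrict_iff[OF U1(1)] by auto
  next
    fix i assume i: "Suc i < length (Ns @ [U1])"
    have "(Ns @ [U1]) ! i \<subseteq> (Ns @ [U1]) ! Suc i \<and>
      irreducible_module (twisted_ring \<delta>) (factor ((Ns @ [U1]) ! Suc i) ((Ns @ [U1]) ! i))"
    proof (cases "Suc i < length Ns")
      case True
      thus ?thesis using S(5)[OF True] by (simp add: nth_append)
    next
      case False
      hence len: "i = length Ns - 1" "Suc i = length Ns" using i by simp_all
      have "(Ns @ [U1]) ! i = U" "(Ns @ [U1]) ! Suc i = U1"
        using S(1,3) len by (simp_all add: nth_append last_conv_nth)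
      thus ?thesis using irr U1(2) by simp
    qed
    thus "(Ns @ [U1]) ! i \<subseteq> (Ns @ [U1]) ! Suc i"
      "irreducible_module (twisted_ring \<delta>)
        (quotient_module (M\<lparr>carrier := U1, carrier := (Ns @ [U1]) ! Suc i\<rparr>) ((Ns @ [U1]) ! i))"
      by simp_all
  qed auto
qed

text \<open>Take a maximal submodule of \<open>N\<close> that has a series. If it were proper, a
  minimal submodule strictly above it would give an irreducible factor and a longer series.\<close>

lemma composition_series_exists:
  assumes N: "submod N"
  shows "\<exists>Ns. composition_series (twisted_ring \<delta>) (M\<lparr>carrier := N\<rparr>) Ns"
proof -
  let ?P = "\<lambda>U. submod U \<and> U \<subseteq> N \<and> (\<exists>Ns. composition_series (twisted_ring \<delta>) (M\<lparr>carrier := U\<rparr>) Ns)"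
  have "composition_series (twisted_ring \<delta>) (M\<lparr>carrier := {\<zero>}\<rparr>) [{\<zero>}]"
    using submodule_restrict_iff[OF submodule_zero] submodule_zero by (auto simp: composition_series_def)
  hence P0: "?P {\<zero>}" using submodule_zero subspaceD(2)[OF submoduleD(1)[OF N]] by auto
  obtain U where U: "?P U" and max: "\<And>U'. ?P U' \<Longrightarrow> U \<subseteq> U' \<Longrightarrow> U' = U"
    by (rule maximal_subspace[of ?P "{\<zero>}"]) (use P0 submoduleD(1) in auto)
  obtain Ns where Ns: "composition_series (twisted_ring \<delta>) (M\<lparr>carrier := U\<rparr>) Ns" using U by blast
  have "U = N"
  proof (rule ccontr)
    assume ne: "U \<noteq> N"
    let ?R = "\<lambda>V. submod V \<and> U \<subset> V \<and> V \<subseteq> N"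
    obtain U1 where U1: "?R U1" and min: "\<And>V. ?R V \<Longrightarrow> V \<subseteq> U1 \<Longrightarrow> V = U1"
      by (rule minimal_subspace[of ?R N]) (use N U ne submoduleD(1) in auto)
    have U1s: "submod U1" using U1 by blast
    have "irreducible_module (twisted_ring \<delta>) (factor U1 U)"
    proof (rule fd_diff_module.irreducible_quotient[OF fd_submodule[OF U1s]])
      show "Module.submodule U (twisted_ring \<delta>) (M\<lparr>carrier := U1\<rparr>)"
        using U U1 submodule_restrict_iff[OF U1s] by blast
      show "U \<noteq> carrier (M\<lparr>carrier := U1\<rparr>)" using U1 by auto
      fix V assume "Module.submodule V (twisted_ring \<delta>) (M\<lparr>carrier := U1\<rparr>)" "U \<subseteq> V"
      hence "submod V" "V \<subseteq> U1" "U \<subseteq> V" using submodule_restrict_iff[OF U1s] by blast+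
      thus "V = U \<or> V = carrier (M\<lparr>carrier := U1\<rparr>)" using min[of V] U1 by auto
    qed
    hence "composition_series (twisted_ring \<delta>) (M\<lparr>carrier := U1\<rparr>) (Ns @ [U1])"
      using composition_series_snoc[OF _ U1s _ Ns] U U1 by blast
    hence "?P U1" using U1 by blast
    thus False using max U1 by blast
  qed
  thus ?thesis using Ns by blast
qed

section \<open>The two filtrations\<close>

context
  fixes U U1
  assumes U: "submod U" and U1: "submod U1" and sub: "U \<subseteq> U1"
    and irr: "irreducible_module (twisted_ring \<delta>) (factor U1 U)"
begin

lemma factor_submodule: "Module.submodule U (twisted_ring \<delta>) (M\<lparr>carrier := U1\<rparr>)"
  using U sub submodule_restrict_iff[OF U1] by blast

lemma fd_factor: "fd_diff_module v \<delta> (factor U1 U)"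
  by (rule fd_diff_module.fd_quotient[OF fd_submodule[OF U1] factor_submodule])

lemma factor_nonzero: "carrier (factor U1 U) \<noteq> {\<zero>\<^bsub>factor U1 U\<^esub>}"
  using irr by (simp add: irreducible_module_def)

text \<open>The quotient map is returned only as some \<open>\<pi>\<close>, so that solutions on
  \<open>U1\<close> and on the factor can be compared without touching cosets.\<close>

lemma factor_hom:
  assumes h: "fps_hom \<delta> M UNIV h" and ker: "\<And>x. x \<in> U \<Longrightarrow> h x = 0"
    and D: "\<And>x. x \<in> U1 \<Longrightarrow> h x \<in> D"
  obtains g \<pi> where "fps_hom \<delta> (factor U1 U) D g" "\<And>x. x \<in> U1 \<Longrightarrow> \<pi> x \<in> carrier (factor U1 U)"
    "\<And>x. x \<in> U1 \<Longrightarrow> g (\<pi> x) = h x"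
proof -
  interpret U1: diff_module v \<delta> "M\<lparr>carrier := U1\<rparr>" by (rule diff_module_submodule[OF U1])
  have "fps_hom \<delta> (M\<lparr>carrier := U1\<rparr>) D h"
    using fps_hom_mono[OF fps_hom_restrict[OF h submoduleD(2)[OF U1]], of D] D by simp
  from U1.quotient_hom_descend[OF factor_submodule this] ker obtain g where
    "fps_hom \<delta> (factor U1 U) D g"
    "\<And>x. x \<in> carrier (M\<lparr>carrier := U1\<rparr>) \<Longrightarrow> g (U +>\<^bsub>M\<lparr>carrier := U1\<rparr>\<^esub> x) = h x" by blast
  thus ?thesis
    using that[of g "\<lambda>x. U +>\<^bsub>M\<lparr>carrier := U1\<rparr>\<^esub> x"] U1.quotient_carrier[OF factor_submodule] by simp
qed

text \<open>A solution that does not vanish on \<open>U\<close> does not descend to the factor.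
  Subtracting an overconvergent extension \<open>h0\<close> of its restriction to \<open>U\<close>
  repairs this; on the factor every solution overconverges, and adding \<open>h0\<close> back loses
  nothing.\<close>

lemma solution_overconv_step:
  assumes t: "0 < t" "t * spectral_norm UNIV v \<delta> < 1" and sp: "T_spectral_norm v (factor U1 U) * t < 1"
    and h: "fps_hom \<delta> M UNIV h" and hU: "\<And>x. x \<in> U \<Longrightarrow> h x \<in> fps_overconv v t"
    and x: "x \<in> U1"
  shows "h x \<in> fps_overconv v t"
proof -
  have "fps_hom \<delta> (M\<lparr>carrier := U\<rparr>) (fps_overconv v t) h"
    using fps_hom_mono[OF fps_hom_restrict[OF h submoduleD(2)[OF U]], of "fps_overconv v t"] hU by simp
  then obtain h0 where h0: "fps_hom \<delta> M (fps_overconv v t) h0" "\<And>x. x \<in> U \<Longrightarrow> h0 x = h x"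
    using solution_extends[OF U t] by blast
  interpret A: twisted_action \<delta> "\<lambda>c F. taylor \<delta> c * F" fps_deriv by (rule twisted_action_fps)
  have act_diff: "fps_act p (F - G) = fps_act p F - fps_act p G" for p F G
    using A.act_add_right[of p "F - G" G] by (simp add: algebra_simps)
  have k: "fps_hom \<delta> M UNIV (\<lambda>x. h x - h0 x)"
    using h h0(1) by (simp add: fps_hom_def act_diff)
  obtain g \<pi> where g: "fps_hom \<delta> (factor U1 U) UNIV g" "\<And>x. x \<in> U1 \<Longrightarrow> \<pi> x \<in> carrier (factor U1 U)"
    "\<And>x. x \<in> U1 \<Longrightarrow> g (\<pi> x) = h x - h0 x"
    using factor_hom[OF k, of UNIV] h0(2) by auto
  have "g (\<pi> x) \<in> fps_overconv v t"
    by (rule fd_diff_module.solution_overconv[OF fd_factor factor_nonzero t(1) sp g(1) g(2)[OF x]])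
  moreover have "x \<in> carrier M" using x submoduleD(2)[OF U1] by blast
  ultimately have "(h x - h0 x) + h0 x \<in> fps_overconv v t"
    using g(3)[OF x] fps_homD(1)[OF h0(1)] by (intro fps_overconv_add t) auto
  thus ?thesis by simp
qed

text \<open>A nonzero value would make \<open>h\<close> descend to a nonzero overconvergent solution
  at \<open>r\<close> on an irreducible module, which forces its spectral norm below
  \<open>1 / r\<close>.\<close>

lemma overconv_solution_vanishes_step:
  assumes r: "0 < r" "r * spectral_norm UNIV v \<delta> < 1" and sp: "T_spectral_norm v (factor U1 U) * r = 1"
    and h: "fps_hom \<delta> M (fps_overconv v r) h" and hU: "\<And>x. x \<in> U \<Longrightarrow> h x = 0" and x: "x \<in> U1"
  shows "h x = 0"
proof (rule ccontr)
  assume ne: "h x \<noteq> 0"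
  have "fps_hom \<delta> M UNIV h" using fps_hom_mono[OF h] by blast
  moreover have "h y \<in> fps_overconv v r" if "y \<in> U1" for y
    using fps_homD(1)[OF h] that submoduleD(2)[OF U1] by blast
  ultimately obtain g \<pi> where g: "fps_hom \<delta> (factor U1 U) (fps_overconv v r) g"
    "\<And>x. x \<in> U1 \<Longrightarrow> \<pi> x \<in> carrier (factor U1 U)" "\<And>x. x \<in> U1 \<Longrightarrow> g (\<pi> x) = h x"
    using factor_hom[of h "fps_overconv v r"] hU by blast
  have "T_spectral_norm v (factor U1 U) * r < 1"
    by (rule fd_diff_module.overconv_solution_spectral[OF fd_factor irr r g(1) g(2)[OF x]])
       (use g(3)[OF x] ne in simp)
  thus False using sp by simp
qed

text \<open>Both inequalities are tested on one solution \<open>h\<close> of \<open>M\<close> that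
  vanishes on \<open>U\<close> but not at some \<open>x\<close> in \<open>U1\<close>. Convergence at
  \<open>r\<close> excludes a factor of radius below \<open>r\<close>. A radius above
  \<open>r\<close> would make \<open>h\<close> overconvergent on \<open>U1\<close>; its extension to
  \<open>M\<close> would fall under \<open>le\<close> and vanish at \<open>x\<close>.\<close>

lemma factor_spectral:
  assumes r: "0 < r" "r * spectral_norm UNIV v \<delta> \<le> 1"
    and ge: "\<And>h x. fps_hom \<delta> M UNIV h \<Longrightarrow> x \<in> U1 \<Longrightarrow> h x \<in> fps_conv v r"
    and le: "\<And>h x. r * spectral_norm UNIV v \<delta> < 1 \<Longrightarrow> fps_hom \<delta> M (fps_overconv v r) h \<Longrightarrow> x \<in> U1 \<Longrightarrow> h x = 0"
  shows "T_spectral_norm v (factor U1 U) * r = 1"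
proof -
  let ?\<sigma> = "spectral_norm UNIV v \<delta>" and ?\<rho> = "T_spectral_norm v (factor U1 U)"
  interpret U1: diff_module v \<delta> "M\<lparr>carrier := U1\<rparr>" by (rule diff_module_submodule[OF U1])
  have "\<not> U1 \<subseteq> U"
  proof
    assume "U1 \<subseteq> U"
    hence "U +>\<^bsub>M\<lparr>carrier := U1\<rparr>\<^esub> y = \<zero>\<^bsub>factor U1 U\<^esub>" if "y \<in> U1" for y
      using U1.quotient_zero_iff[OF factor_submodule, of y] that by auto
    hence "carrier (factor U1 U) \<subseteq> {\<zero>\<^bsub>factor U1 U\<^esub>}"
      unfolding U1.quotient_carrier[OF factor_submodule] by (simp add: image_subset_iff)
    moreover have "\<zero>\<^bsub>factor U1 U\<^esub> \<in> carrier (factor U1 U)"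
      using U1.quotient_carrier[OF factor_submodule] U1.quotient_zero[OF factor_submodule]
        subspaceD(2)[OF submoduleD(1)[OF U1]] by auto
    ultimately show False using factor_nonzero by blast
  qed
  then obtain x where x: "x \<in> U1" "x \<notin> U" by blast
  have xM: "x \<in> carrier M" using x submoduleD(2)[OF U1] by blast
  \<comment> \<open>The functional lives on all of \<open>M\<close>, because \<open>ge\<close>
    speaks of solutions on \<open>M\<close> and not on \<open>U1\<close>.\<close>
  obtain \<phi> where \<phi>: "\<And>w. w \<in> U \<Longrightarrow> \<phi> w = (0::'a)" "\<phi> x = 1"
    "\<And>y z. y \<in> carrier M \<Longrightarrow> z \<in> carrier M \<Longrightarrow> \<phi> (y \<oplus>\<^bsub>M\<^esub> z) = \<phi> y + \<phi> z"
    "\<And>c y. y \<in> carrier M \<Longrightarrow> \<phi> ([:c:] \<odot>\<^bsub>M\<^esub> y) = c * \<phi> y"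
    by (rule separating_functional[OF submoduleD(1)[OF U] xM x(2)]) blast
  define h where "h x = Abs_fps (\<lambda>i. \<phi> (((\<lambda>x. [:0, 1:] \<odot>\<^bsub>M\<^esub> x) ^^ i) x) / fact i)" for x
  have h: "fps_hom \<delta> M UNIV h" unfolding h_def by (rule functional_fps_hom[OF \<phi>(3,4)])
  have "((\<lambda>x. [:0, 1:] \<odot>\<^bsub>M\<^esub> x) ^^ i) u \<in> U" if "u \<in> U" for u i
    by (induction i) (use that submoduleD(3)[OF U] in auto)
  hence hU: "h u = 0" if "u \<in> U" for u
    using \<phi>(1) that by (intro fps_ext) (simp add: h_def)
  have "fps_nth (h x) 0 = 1" using \<phi>(2) by (simp add: h_def)
  hence hx: "h x \<noteq> 0" by auto
  obtain g \<pi> where g: "fps_hom \<delta> (factor U1 U) (fps_conv v r) g" "\<And>x. x \<in> U1 \<Longrightarrow> \<pi> x \<in> carrier (factor U1 U)"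
    "\<And>x. x \<in> U1 \<Longrightarrow> g (\<pi> x) = h x"
    using factor_hom[OF h hU, of "fps_conv v r"] ge[OF h] by blast
  have gx: "g (\<pi> x) \<noteq> 0" using g(3)[OF x(1)] hx by simp
  have \<sigma>\<rho>: "?\<sigma> \<le> ?\<rho>" by (rule fd_diff_module.spectral_derivation_le_T[OF fd_factor factor_nonzero])
  have "?\<rho> * r \<le> 1"
  proof (rule ccontr)
    assume "\<not> ?\<rho> * r \<le> 1"
    hence gt: "1 < ?\<rho> * r" by simp
    hence "0 < ?\<rho> * r" by linarith
    hence \<rho>: "?\<rho> > 0" by (rule zero_less_mult_pos2[OF _ r(1)])
    \<comment> \<open>The borderline radius of the factor: a nonzero overconvergent solution at
      \<open>t\<close> would force \<open>?\<rho> * t < 1\<close>.\<close>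
    define t where "t = 1 / ?\<rho>"
    have t: "0 < t" "t < r" using \<rho> gt by (auto simp: t_def field_simps)
    have t\<sigma>: "t * ?\<sigma> < 1"
    proof (cases "?\<sigma> = 0")
      case False
      hence "t * ?\<sigma> < r * ?\<sigma>" using t spectral_derivation_nonneg by (intro mult_strict_right_mono) auto
      thus ?thesis using r(2) by simp
    qed simp
    have "fps_conv v r \<subseteq> fps_overconv v t"
    proof -
      obtain s where "t < s" "s < r" using t(2) dense by blast
      thus ?thesis using t(1) by (auto simp: fps_conv_def fps_overconv_def)
    qed
    hence gt: "fps_hom \<delta> (factor U1 U) (fps_overconv v t) g" using g(1) by (auto simp: fps_hom_def)
    have "?\<rho> * t < 1"
      by (rule fd_diff_module.overconv_solution_spectral[OF fd_factor irr t(1) t\<sigma> gt g(2)[OF x(1)] gx])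
    thus False using \<rho> by (simp add: t_def)
  qed
  moreover have "\<not> ?\<rho> * r < 1"
  proof
    assume lt: "?\<rho> * r < 1"
    \<comment> \<open>This excludes the end point \<open>r = 1 / ?\<sigma>\<close>, where solutions
      could not be extended.\<close>
    have "?\<sigma> * r \<le> ?\<rho> * r" by (rule mult_right_mono[OF \<sigma>\<rho>]) (use r in simp)
    hence r\<sigma>: "r * ?\<sigma> < 1" using lt by (simp add: mult.commute[of r])
    have "h y \<in> fps_overconv v r" if "y \<in> U1" for y
      using fd_diff_module.solution_overconv[OF fd_factor factor_nonzero r(1) lt _ g(2)[OF that]]
        fps_hom_mono[OF g(1), of UNIV] g(3)[OF that] by (metis UNIV_I)
    hence "fps_hom \<delta> (M\<lparr>carrier := U1\<rparr>) (fps_overconv v r) h"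
      using fps_hom_mono[OF fps_hom_restrict[OF h submoduleD(2)[OF U1]], of "fps_overconv v r"] by simp
    then obtain h' where h': "fps_hom \<delta> M (fps_overconv v r) h'" "\<And>x. x \<in> U1 \<Longrightarrow> h' x = h x"
      using solution_extends[OF U1 r(1) r\<sigma>] by blast
    show False using le[OF r\<sigma> h'(1) x(1)] h'(2)[OF x(1)] hx by simp
  qed
  ultimately show ?thesis by simp
qed

end

section \<open>Membership in the solution filtration\<close>

lemma fps_conv_iff_overconv:
  assumes "0 < r"
  shows "F \<in> fps_conv v r \<longleftrightarrow> (\<forall>t. 0 < t \<longrightarrow> t < r \<longrightarrow> F \<in> fps_overconv v t)"
proof
  assume F: "F \<in> fps_conv v r"
  show "\<forall>t. 0 < t \<longrightarrow> t < r \<longrightarrow> F \<in> fps_overconv v t"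
  proof (intro allI impI)
    fix t :: real assume t: "0 < t" "t < r"
    obtain s where "t < s" "s < r" using t(2) dense by blast
    thus "F \<in> fps_overconv v t" using t(1) F by (auto simp: fps_conv_def fps_overconv_def)
  qed
next
  assume F: "\<forall>t. 0 < t \<longrightarrow> t < r \<longrightarrow> F \<in> fps_overconv v t"
  show "F \<in> fps_conv v r"
    unfolding fps_conv_def
  proof
    fix t assume t: "t \<in> {0<..<r}"
    then obtain s where "t < s" "F \<in> fps_bounded v s" using F by (auto simp: fps_overconv_def)
    thus "F \<in> fps_bounded v t" using fps_bounded_antimono[of t s F] t by auto
  qed
qed

lemma fps_conv_add: "F \<in> fps_conv v r \<Longrightarrow> G \<in> fps_conv v r \<Longrightarrow> F + G \<in> fps_conv v r"
  by (auto simp: fps_conv_def intro: fps_bounded_add)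

lemma fps_conv_act:
  assumes r: "r * spectral_norm UNIV v \<delta> \<le> 1" and F: "F \<in> fps_conv v r"
  shows "fps_act p F \<in> fps_conv v r"
  unfolding fps_conv_def
proof
  fix s assume s: "s \<in> {0<..<r}"
  have "s * spectral_norm UNIV v \<delta> < 1"
  proof (cases "spectral_norm UNIV v \<delta> = 0")
    case False
    hence "s * spectral_norm UNIV v \<delta> < r * spectral_norm UNIV v \<delta>"
      using s spectral_derivation_nonneg by (intro mult_strict_right_mono) auto
    thus ?thesis using r by simp
  qed simp
  thus "fps_act p F \<in> fps_bounded v s" using s F by (intro fps_bounded_act) (auto simp: fps_conv_def)
qed

lemma F_sol_mem_iff:
  assumes "residue_char v = 0" "0 < r" "r \<le> diff_radius v \<delta>"
  shows "x \<in> F_sol v \<delta> r M \<longleftrightarrow> x \<in> carrier M \<and> (\<forall>h. fps_hom \<delta> M UNIV h \<longrightarrow> h x \<in> fps_conv v r) \<and>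
    (r * spectral_norm UNIV v \<delta> < 1 \<longrightarrow> (\<forall>h. fps_hom \<delta> M (fps_overconv v r) h \<longrightarrow> h x = 0))"
proof -
  \<comment> \<open>Division by \<open>0\<close> gives \<open>0\<close>, so a vanishing spectral
    norm would make \<open>diff_radius\<close> equal to \<open>0\<close> and leave no room for
    \<open>r\<close>.\<close>
  have "spectral_norm UNIV v \<delta> > 0"
    using assms spectral_derivation_nonneg unfolding diff_radius_eq[OF assms(1)]
    by (metis div_by_0 linorder_not_le order.not_eq_order_implies_strict)
  hence "r < diff_radius v \<delta> \<longleftrightarrow> r * spectral_norm UNIV v \<delta> < 1"
    unfolding diff_radius_eq[OF assms(1)] by (simp add: field_simps)
  thus ?thesis
    by (auto simp: F_sol_def F_le_def F_ge_def left_module_hom_fps left_module_hom_fps_UNIV)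
qed

lemma submodule_F_sol:
  assumes r: "residue_char v = 0" "0 < r" "r \<le> diff_radius v \<delta>" "r * spectral_norm UNIV v \<delta> \<le> 1"
  shows "submod (F_sol v \<delta> r M)"
proof -
  interpret A: twisted_action \<delta> "\<lambda>c F. taylor \<delta> c * F" fps_deriv by (rule twisted_action_fps)
  have act_0: "fps_act p 0 = 0" for p using A.act_add_right[of p 0 0] by simp
  have conv_0: "0 \<in> fps_conv v r" by (auto simp: fps_conv_def fps_bounded_iff intro: gauss_bound_0)
  note mem = F_sol_mem_iff[OF r(1-3)]
  have act: "p \<cdot> x \<in> F_sol v \<delta> r M" if x: "x \<in> F_sol v \<delta> r M" for p x
  proof -
    have "h (p \<cdot> x) = fps_act p (h x)" if "fps_hom \<delta> M D h" for D h
      using fps_homD(3)[OF that] x mem by blast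
    thus ?thesis using x fps_conv_act[OF r(4)] act_0 unfolding mem by (metis act_closed)
  qed
  show ?thesis
    unfolding submodule_iff subspace_of_def
  proof (intro conjI ballI allI)
    show "F_sol v \<delta> r M \<subseteq> carrier M" unfolding subset_iff F_sol_mem_iff[OF r(1-3)] by blast
    show "\<zero> \<in> F_sol v \<delta> r M"
    proof -
      have "h \<zero> = 0" if "fps_hom \<delta> M D h" for D h by (rule fps_hom_zero[OF that])
      thus ?thesis using conv_0 unfolding mem by (metis M.zero_closed)
    qed
    show "x \<oplus> y \<in> F_sol v \<delta> r M" if "x \<in> F_sol v \<delta> r M" "y \<in> F_sol v \<delta> r M" for x y
    proof -
      have "h (x \<oplus> y) = h x + h y" if "fps_hom \<delta> M D h" for D h
        using fps_homD(2)[OF that] \<open>x \<in> _\<close> \<open>y \<in> _\<close> mem by blast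
      thus ?thesis using that fps_conv_add unfolding mem by (metis M.a_closed add_0)
    qed
  qed (use act in auto)
qed

lemma composition_seriesD:
  assumes N: "submod N" and Ns: "composition_series (twisted_ring \<delta>) (M\<lparr>carrier := N\<rparr>) Ns"
  shows "Ns \<noteq> []" "Ns ! 0 = {\<zero>}" "Ns ! (length Ns - 1) = N"
    "i < length Ns \<Longrightarrow> submod (Ns ! i) \<and> Ns ! i \<subseteq> N"
    "Suc i < length Ns \<Longrightarrow> Ns ! i \<subseteq> Ns ! Suc i \<and> irreducible_module (twisted_ring \<delta>) (factor (Ns ! Suc i) (Ns ! i))"
  using Ns submodule_restrict_iff[OF N] nth_mem[of i Ns]
  by (auto simp: composition_series_def composition_factor_def hd_conv_nth last_conv_nth)

text \<open>The series returned is the one chosen inside \<open>mult_function\<close>. A sum of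
  naturals is nonzero when some summand is, and every factor contributes its nonzero dimension at
  its own radius, so the support is the set of radii of the factors.\<close>

lemma mult_function_support:
  assumes p: "residue_char v = 0" and N: "submod N"
  obtains Ns where "composition_series (twisted_ring \<delta>) (M\<lparr>carrier := N\<rparr>) Ns"
    "\<And>r. 0 < r \<Longrightarrow> {r'. mult_function v \<delta> (M\<lparr>carrier := N\<rparr>) r' \<noteq> 0} \<subseteq> {r} \<longleftrightarrow>
       (\<forall>i. Suc i < length Ns \<longrightarrow> T_spectral_norm v (factor (Ns ! Suc i) (Ns ! i)) * r = 1)"
proof -
  define Ns where "Ns = (SOME Ns. composition_series (twisted_ring \<delta>) (M\<lparr>carrier := N\<rparr>) Ns)"
  have Ns: "composition_series (twisted_ring \<delta>) (M\<lparr>carrier := N\<rparr>) Ns"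
    unfolding Ns_def by (rule someI_ex[OF composition_series_exists[OF N]])
  note S = composition_seriesD[OF N Ns]
  have dim: "vectorspace.dim class_ring (base_space (factor (Ns ! Suc i) (Ns ! i))) \<noteq> 0"
    if i: "Suc i < length Ns" for i
    using fd_diff_module.dim_nonzero[OF fd_factor factor_nonzero] S(4)[of i] S(4)[of "Suc i"] S(5)[OF i] i by simp
  have "mult_function v \<delta> (M\<lparr>carrier := N\<rparr>) r' \<noteq> 0 \<longleftrightarrow>
      (\<exists>i. Suc i < length Ns \<and> r' = 1 / T_spectral_norm v (factor (Ns ! Suc i) (Ns ! i)))" for r'
  proof -
    have "mult_function v \<delta> (M\<lparr>carrier := N\<rparr>) r' =
        (\<Sum>i<length Ns - 1. mult_irreducible v (factor (Ns ! Suc i) (Ns ! i)) r')"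
      by (simp add: mult_function_def Ns_def[symmetric] composition_factor_def)
    also have "\<dots> \<noteq> 0 \<longleftrightarrow> (\<exists>i. Suc i < length Ns \<and> mult_irreducible v (factor (Ns ! Suc i) (Ns ! i)) r' \<noteq> 0)"
      by (simp add: sum_eq_0_iff) (auto simp: less_diff_conv)
    also have "\<dots> \<longleftrightarrow> (\<exists>i. Suc i < length Ns \<and> r' = 1 / T_spectral_norm v (factor (Ns ! Suc i) (Ns ! i)))"
      using dim p by (auto simp: mult_irreducible_def omega_def)
    finally show ?thesis .
  qed
  hence "{r'. mult_function v \<delta> (M\<lparr>carrier := N\<rparr>) r' \<noteq> 0} \<subseteq> {r} \<longleftrightarrow>
      (\<forall>i. Suc i < length Ns \<longrightarrow> 1 / T_spectral_norm v (factor (Ns ! Suc i) (Ns ! i)) = r)" for r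
    by auto
  \<comment> \<open>Holds also at \<open>a = 0\<close>, where both sides are false because
    \<open>1 / 0 = 0\<close>.\<close>
  moreover have "1 / a = r \<longleftrightarrow> a * r = 1" if "0 < r" for a r :: real
    using that by (cases "a = 0") (auto simp: field_simps)
  ultimately show ?thesis using that Ns by simp
qed

text \<open>The greatest element behind \<open>F_sp\<close> is not built separately:
  \<open>F_sol\<close> belongs to its family by \<open>factor_spectral\<close> and contains every
  other member by the two step lemmas.\<close>

lemma F_sp_eq_F_sol:
  assumes p: "residue_char v = 0" and r: "0 < r" "r \<le> diff_radius v \<delta>"
  shows "F_sp v \<delta> r M = F_sol v \<delta> r M"
proof -
  let ?\<sigma> = "spectral_norm UNIV v \<delta>"
  have "?\<sigma> > 0"
    using r spectral_derivation_nonneg unfolding diff_radius_eq[OF p]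
    by (metis div_by_0 linorder_not_le order.not_eq_order_implies_strict)
  hence r\<sigma>: "r * ?\<sigma> \<le> 1" using r(2) unfolding diff_radius_eq[OF p] by (simp add: field_simps)
  have small: "t * ?\<sigma> < 1" if "0 < t" "t < r" for t
    using mult_strict_right_mono[OF that(2) \<open>?\<sigma> > 0\<close>] r\<sigma> by simp
  note mem = F_sol_mem_iff[OF p r]
  have sol: "submod (F_sol v \<delta> r M)" by (rule submodule_F_sol[OF p r r\<sigma>])
  show ?thesis
    unfolding F_sp_def
  proof (rule Greatest_equality)
    obtain Ns where Ns: "composition_series (twisted_ring \<delta>) (M\<lparr>carrier := F_sol v \<delta> r M\<rparr>) Ns"
      and supp: "{r'. mult_function v \<delta> (M\<lparr>carrier := F_sol v \<delta> r M\<rparr>) r' \<noteq> 0} \<subseteq> {r} \<longleftrightarrow>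
       (\<forall>i. Suc i < length Ns \<longrightarrow> T_spectral_norm v (factor (Ns ! Suc i) (Ns ! i)) * r = 1)"
      using mult_function_support[OF p sol] r(1) by metis
    note S = composition_seriesD[OF sol Ns]
    have "T_spectral_norm v (factor (Ns ! Suc i) (Ns ! i)) * r = 1" if i: "Suc i < length Ns" for i
    proof (rule factor_spectral)
      show "submod (Ns ! i)" "submod (Ns ! Suc i)" using S(4) i by simp_all
      show "Ns ! i \<subseteq> Ns ! Suc i" "irreducible_module (twisted_ring \<delta>) (factor (Ns ! Suc i) (Ns ! i))"
        using S(5)[OF i] by simp_all
      have inF: "x \<in> F_sol v \<delta> r M" if "x \<in> Ns ! Suc i" for x using S(4)[OF i] that by blast
      show "h x \<in> fps_conv v r" if "fps_hom \<delta> M UNIV h" "x \<in> Ns ! Suc i" for h x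
        using inF[OF that(2)] that(1) mem by blast
      show "h x = 0" if "r * ?\<sigma> < 1" "fps_hom \<delta> M (fps_overconv v r) h" "x \<in> Ns ! Suc i" for h x
        using inF[OF that(3)] that(1,2) mem by blast
    qed (fact r(1) r\<sigma>)+
    thus "submod (F_sol v \<delta> r M) \<and>
        {r'. mult_function v \<delta> (M\<lparr>carrier := F_sol v \<delta> r M\<rparr>) r' \<noteq> 0} \<subseteq> {r}"
      using sol supp by blast
  next
    fix N assume N: "submod N \<and> {r'. mult_function v \<delta> (M\<lparr>carrier := N\<rparr>) r' \<noteq> 0} \<subseteq> {r}"
    hence subN: "submod N" by blast
    obtain Ns where Ns: "composition_series (twisted_ring \<delta>) (M\<lparr>carrier := N\<rparr>) Ns"
      and supp: "{r'. mult_function v \<delta> (M\<lparr>carrier := N\<rparr>) r' \<noteq> 0} \<subseteq> {r} \<longleftrightarrow>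
       (\<forall>i. Suc i < length Ns \<longrightarrow> T_spectral_norm v (factor (Ns ! Suc i) (Ns ! i)) * r = 1)"
      using mult_function_support[OF p subN] r(1) by metis
    note S = composition_seriesD[OF subN Ns]
    have sp: "T_spectral_norm v (factor (Ns ! Suc i) (Ns ! i)) * r = 1" if "Suc i < length Ns" for i
      using supp N that by blast
    have len: "length Ns - 1 < length Ns" using S(1) by simp
    have step: "submod (Ns ! i)" "submod (Ns ! Suc i)" "Ns ! i \<subseteq> Ns ! Suc i"
      "irreducible_module (twisted_ring \<delta>) (factor (Ns ! Suc i) (Ns ! i))" if "Suc i < length Ns" for i
      using S(4)[of i] S(4)[of "Suc i"] S(5)[OF that] that by simp_all
    have conv: "h x \<in> fps_conv v r" if h: "fps_hom \<delta> M UNIV h" and x: "x \<in> N" for h x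
    proof -
      \<comment> \<open>Convergence at \<open>r\<close> is tested at each smaller \<open>t\<close>,
        where every factor has spectral norm strictly below \<open>1 / t\<close>; this also covers
        an \<open>r\<close> at the end point.\<close>
      have "h x \<in> fps_overconv v t" if t: "0 < t" "t < r" for t
      proof -
        have "\<forall>x\<in>Ns ! i. h x \<in> fps_overconv v t" if "i < length Ns" for i
          using that
        proof (induction i)
          case 0
          have "0 \<in> fps_overconv v t" 
            unfolding fps_overconv_iff using gauss_bound_0 less_add_one by blast
          thus ?case using S(2) fps_hom_zero[OF h] by simp
        next
          case (Suc i)
          have "T_spectral_norm v (factor (Ns ! Suc i) (Ns ! i)) * t < 1"
          proof -
            have "0 < T_spectral_norm v (factor (Ns ! Suc i) (Ns ! i))"
              by (rule zero_less_mult_pos2[OF _ r(1)]) (simp add: sp[OF Suc.prems])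
            from mult_strict_left_mono[OF t(2) this] show ?thesis using sp[OF Suc.prems] by simp
          qed
          from solution_overconv_step[OF step[OF Suc.prems] t(1) small[OF t] this h] Suc
          show ?case by simp
        qed
        from this[OF len] show ?thesis using S(3) x by simp
      qed
      thus ?thesis using fps_conv_iff_overconv[OF r(1)] by blast
    qed
    have vanish: "h x = 0" if h: "fps_hom \<delta> M (fps_overconv v r) h" and x: "x \<in> N" and lt: "r * ?\<sigma> < 1" for h x
    proof -
      have "\<forall>x\<in>Ns ! i. h x = 0" if "i < length Ns" for i
        using that
      proof (induction i)
        case 0
        thus ?case using S(2) fps_hom_zero[OF h] by simp
      next
        case (Suc i)
        from overconv_solution_vanishes_step[OF step[OF Suc.prems] r(1) lt sp[OF Suc.prems] h] Suc
        show ?case by simp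
      qed
      from this[OF len] show ?thesis using S(3) x by simp
    qed
    show "N \<le> F_sol v \<delta> r M"
      using conv vanish mem submoduleD(2)[OF subN] by blast
  qed
qed

end

theorem theorem6p5:
  fixes v :: "'k::field_char_0 \<Rightarrow> real" and \<delta> :: "'k \<Rightarrow> 'k"
    and M :: "('k poly, 'm) module" and r :: real
  assumes "complete_nonarch_diff_field v \<delta>"
    and "residue_char v = 0"
    and "fd_module \<delta> M"
    and "0 < r" and "r \<le> diff_radius v \<delta>"
  shows "F_sp v \<delta> r M = F_sol v \<delta> r M"
  by (rule fd_diff_module.F_sp_eq_F_sol[OF fd_diff_moduleI[OF residue_char_0_diff_fieldI]]) (fact assms)+

end
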